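(* Consider either of the following two cases, with a convex compact set $\mathcal K\subseteq[0,1]^d$ and objective functions $f_{t,i}:[0,1]^d\to\mathbb R$ ($t\in[T]$, $i\in[N]$): (Case A.2) $\mathbf 0\in\mathcal K$, the $f_{t,i}$ are non-negative, monotone and $\gamma$-weakly up-concave for some $0<\gamma\le1$, and $\alpha=1-e^{-\gamma}$; (Case A.3) the $f_{t,i}$ are non-negative and up-concave (not necessarily monotone), $\underline{\mathbf u}\in\mathcal K$ is a fixed point, and $\alpha=\frac{1-\|\underline{\mathbf u}\|_\infty}{4}$. Suppose the $f_{t,i}$ are continuous, differentiable, Lipschitz continuous and smooth (with common constants), that the zeroth-order query oracle is bounded, and that the weight matrix $A$ is symmetric and doubly stochastic with second largest eigenvalue $\lambda_2<1$. Run the bandit algorithm described in the context with parameters $K,L,\eta,\delta$ and error tolerance $\epsilon=K^2\eta^2\delta^{-2}$. Then for every agent $i$ $$\mathbb E[\mathcal R_\alpha^i]=O\left(\frac L\eta+\eta TK\delta^{-2}+\delta T+\frac TL\right),$$ with at most $O\left(\frac{T}{\epsilon KL}\right)$ linear optimization oracle (LOO) calls and $O\left(\frac T{KL}\right)$ communication complexity. In particular, if $0\le\theta\le4/5$ and $K=T^{1-5\theta/4}$, $\delta=T^{-\theta/4}$, $L=T^{\theta/4}$, $\eta=T^{\theta/2-1}$, then $\mathbb E[\mathcal R_\alpha^i]=O(T^{1-\theta/4})$ with at most $O(T^{2\theta})$ LOO calls and $O(T^\theta)$ communication complexity.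
   Context: **Functions.** Inequalities between vectors are coordinatewise. A differentiable $f$ is $\gamma$-weakly up-concave if for all $\mathbf x\le\mathbf y$: $\gamma\langle\nabla f(\mathbf y),\mathbf y-\mathbf x\rangle\le f(\mathbf y)-f(\mathbf x)\le\frac1\gamma\langle\nabla f(\mathbf x),\mathbf y-\mathbf x\rangle$; up-concave means $\gamma=1$. Monotone means $\mathbf x\le\mathbf y$ implies $f(\mathbf x)\le f(\mathbf y)$. **Network.** $N$ agents are the nodes of an undirected graph $([N],E)$; $\mathcal N_i=\{j:(i,j)\in E\}\cup\{i\}$. $A=[a_{ij}]\in\mathbb R_+^{N\times N}$ has $a_{ij}>0$ only if $(i,j)\in E$ or $i=j$; its largest eigenvalue is $1$ and $\lambda_2$ is its second largest eigenvalue ($\lambda_2=1$ corresponds to a disconnected network). In one communication, agent $i$ receives $\sum_{j\in\mathcal N_i}a_{ij}\mathbf s^j$ from its neighbors' state vectors $\mathbf s^j$. Communication complexity is the total number of communications over the horizon. **Problem.** An adversary chooses the sequence $f_{t,i}$. At round $t$ agent $i$ plays $\mathbf z_t^i$ and may query a zeroth-order oracle $\mathcal Q$ only at the played point (bandit feedback); the response is a random number with mean $f_{t,i}(\mathbf z_t^i)$, bounded in absolute value by a constant $B_0$. The $\alpha$-regret is $$\mathcal R_\alpha^i=\alpha\max_{\mathbf u\in\mathcal K}\frac1N\sum_{t=1}^T\sum_{j=1}^Nf_{t,j}(\mathbf u)-\frac1N\sum_{t=1}^T\sum_{j=1}^Nf_{t,j}(\mathbf z_t^i).$$ **LOO and infeasible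 projection oracle.** Let $R=\max_{\mathbf x\in\mathcal K}\|\mathbf x\|$. For a convex compact $\mathcal K'\subseteq\mathcal K$, an LOO returns $\arg\max_{\mathbf u\in\mathcal K'}\langle\mathbf x,\mathbf u\rangle$. The infeasible projection oracle $\mathcal O_{IP}(\mathcal K',\mathbf x_0,\mathbf y_0,\epsilon)$ takes $\mathbf x_0\in\mathcal K'$, $\mathbf y_0\in\mathbb R^d$ and returns $(\mathbf x,\tilde{\mathbf y})$ with $\mathbf x\in\mathcal K'$, $\|\tilde{\mathbf y}\|\le R$, $\|\mathbf x-\tilde{\mathbf y}\|^2\le3\epsilon$ and $\|\tilde{\mathbf y}-\mathbf z\|^2\le\|\mathbf y_0-\mathbf z\|^2$ for all $\mathbf z\in\mathcal K'$. It is a known fact (used as given) that it can be implemented with at most $\lceil27R^2/\epsilon-2\rceil\max\big(1,\frac{\|\mathbf x_0-\mathbf y_0\|^2(\|\mathbf x_0-\mathbf y_0\|^2-\epsilon)}{4\epsilon^2}+1\big)$ LOO calls; this implementation is used. **Shrunk set.** Fix $\mathbf c\in\mathrm{relint}(\mathcal K)$ and $r>0$ such that $\mathrm{aff}(\mathcal K)\cap\mathbb B_r(\mathbf c)\subseteq\mathcal K$, where $\mathbb B_r(\mathbf c)$ is the ball of radius $r$ around $\mathbf c$. For $0<\delta<r$ let $\hat{\mathcal K}_\delta=(1-\frac\delta r)\mathcal K+\frac\delta r\mathbf c$. Let $\mathcal L_0=\mathrm{aff}(\mathcal K)-\mathbf x$ (any $\mathbf x\in\mathcal K$), $k=\dim\mathcal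 L_0$, and $\mathbb S^1$ the unit sphere centered at the origin of $\mathbb R^d$. **Case-dependent maps.** Case A.2: $h(\mathbf x)=\mathbf x$; the random $z\in[0,1]$ has law $\mathbb P(z\le s)=\int_0^s\frac{\gamma e^{\gamma(u-1)}}{1-e^{-\gamma}}du$; $\mathbf w(\mathbf x,z)=z\mathbf x$. Case A.3: $h(\mathbf x)=\frac{\mathbf x+\underline{\mathbf u}}2$; $z\in[0,1]$ has law $\mathbb P(z\le s)=\int_0^s\frac{du}{3(1-u/2)^3}$; $\mathbf w(\mathbf x,z)=\frac z2(\mathbf x-\underline{\mathbf u})+\underline{\mathbf u}$. **Algorithm.** Set $\mathbf x_1^i=\tilde{\mathbf y}_1^i=\mathbf c$ for all $i$. For $m=1,\dots,\frac T{LK}$, each agent $i$ in parallel: for each $q=1,\dots,K$, lets $\hat{\mathbf x}_q^i=h(\mathbf x_m^i)$, samples $\mathbf v_q^i$ uniformly from $\mathbb S^1\cap\mathcal L_0$ and $z$ from its law, lets $\mathbf w_q^i=\mathbf w(\mathbf x_m^i,z)$ and $\hat{\mathbf w}_q^i=\mathbf w_q^i+\delta\mathbf v_q^i$, samples $t'_q$ uniformly from $\{(m-1)KL+(q-1)L+1,\dots,(m-1)KL+qL\}$; for each $t$ in this set: if $t=t'_q$, plays $\mathbf z_t^i=\hat{\mathbf w}_q^i$, queries $\mathcal Q$ at $\hat{\mathbf w}_q^i$ receiving $o_q^i$, and sets $\mathbf o_q^i=\frac k\delta o_q^i\mathbf v_q^i$; otherwise plays $\mathbf z_t^i=\hat{\mathbf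 x}_q^i$. Then (once per $m$) it communicates $(\mathbf x_m^i,\tilde{\mathbf y}_m^i)$ with its neighbors and sets $$\mathbf y_{m+1}^i=\sum_{j\in\mathcal N_i}a_{ij}\tilde{\mathbf y}_m^j+\eta\sum_{q=1}^K\mathbf o_q^i,\qquad(\mathbf x_{m+1}^i,\tilde{\mathbf y}_{m+1}^i)=\mathcal O_{IP}\Big(\hat{\mathcal K}_\delta,\sum_{j\in\mathcal N_i}a_{ij}\mathbf x_m^j,\mathbf y_{m+1}^i,\epsilon\Big).$$ **Conventions.** $K,L$ are positive integers with $KL$ dividing $T$, and $0<\delta<r$. Constants implied by $O(\cdot)$ may depend on the fixed problem parameters ($\gamma,d,k,R,r,N,\lambda_2$, the Lipschitz and smoothness constants, $B_0$) but not on $T,K,L,\eta,\epsilon,\delta$. LOO calls are counted per agent over the whole horizon.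
   Formalization: Queries can leave [0,1]^d, so the f_{t,i} (and oracle) are assumed defined, Lipschitz and smooth on a convex set containing the cube and all x+δv, x in K; λ2 is the second largest eigenvalue in absolute value, as the signed version fails for the two-agent swap matrix. *)

theory Defs
  imports "HOL-Probability.Probability"
begin

abbreviation cube :: "(real^'d) set" where
  "cube \<equiv> {0..1}"

text \<open>The gradient relative to \<open>X\<close> is unique when \<open>X\<close> is convex with nonempty interior, the only
  situation in which it is used; at boundary points it is the one-sided one.\<close>

definition grad :: "(real^'d) set \<Rightarrow> (real^'d \<Rightarrow> real) \<Rightarrow> real^'d \<Rightarrow> real^'d" where
  "grad X f x = (SOME g. (f has_derivative (\<lambda>h. g \<bullet> h)) (at x within X))"

definition weakly_up_concave_on :: "(real^'d) set \<Rightarrow> real \<Rightarrow> (real^'d \<Rightarrow> real) \<Rightarrow> bool" where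
  "weakly_up_concave_on X \<gamma> f \<longleftrightarrow>
     (\<forall>x\<in>X. \<forall>y\<in>X. x \<le> y \<longrightarrow>
        \<gamma> * (grad X f y \<bullet> (y - x)) \<le> f y - f x \<and>
        f y - f x \<le> 1 / \<gamma> * (grad X f x \<bullet> (y - x)))"

definition eigenspace :: "real^'n^'n \<Rightarrow> real \<Rightarrow> (real^'n) set" where
  "eigenspace A \<mu> = {v. A *v v = \<mu> *\<^sub>R v}"

text \<open>Second largest eigenvalue of a symmetric doubly stochastic matrix. Eigenvalues are counted
  with multiplicity and compared in absolute value, so one copy of the top eigenvalue \<open>1\<close> is removed
  before the maximum is taken. With a signed comparison the swap matrix on two agents would have
  second eigenvalue \<open>-1\<close> although it never mixes. The inserted \<open>0\<close> matters only for a single agent.\<close>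

definition lambda2 :: "real^'n^'n \<Rightarrow> real" where
  "lambda2 A = Max (insert 0 {\<bar>\<mu>\<bar> |\<mu>. dim (eigenspace A \<mu>) > (if \<mu> = 1 then 1 else 0)})"

definition is_loo :: "('v::real_inner) set \<Rightarrow> ('v \<Rightarrow> 'v) \<Rightarrow> bool" where
  "is_loo X lmo \<longleftrightarrow> (\<forall>x. lmo x \<in> X \<and> (\<forall>u\<in>X. x \<bullet> u \<le> x \<bullet> lmo x))"

text \<open>A computation with oracle access: \<open>Call x k\<close> submits the direction \<open>x\<close> to the oracle and
  continues with \<open>k\<close> applied to the answer.\<close>

datatype ('v, 'b) loo_prog = Return 'b | Call 'v "'v \<Rightarrow> ('v, 'b) loo_prog"

primrec loo_run :: "('v \<Rightarrow> 'v) \<Rightarrow> ('v, 'b) loo_prog \<Rightarrow> 'b" where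
  "loo_run lmo (Return b) = b"
| "loo_run lmo (Call x k) = loo_run lmo (k (lmo x))"

primrec loo_count :: "('v \<Rightarrow> 'v) \<Rightarrow> ('v, 'b) loo_prog \<Rightarrow> nat" where
  "loo_count lmo (Return b) = 0"
| "loo_count lmo (Call x k) = Suc (loo_count lmo (k (lmo x)))"

text \<open>Joint measurability in the two inputs makes the iterates of the algorithm random variables.
  The factor \<open>max 0\<close> only excludes a negative number of calls, for tolerances of at least \<open>27 R\<^sup>2\<close>.\<close>

definition infeasible_projection ::
  "('v::euclidean_space) set \<Rightarrow> real \<Rightarrow> real \<Rightarrow> ('v \<Rightarrow> 'v) \<Rightarrow>
     ('v \<Rightarrow> 'v \<Rightarrow> ('v, 'v \<times> 'v) loo_prog) \<Rightarrow> bool" where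
  "infeasible_projection X R \<epsilon> lmo ip \<longleftrightarrow>
     (\<lambda>(x0, y0). loo_run lmo (ip x0 y0)) \<in> borel \<Otimes>\<^sub>M borel \<rightarrow>\<^sub>M borel \<Otimes>\<^sub>M borel \<and>
     (\<forall>x0\<in>X. \<forall>y0.
        (case loo_run lmo (ip x0 y0) of (x, y) \<Rightarrow>
           x \<in> X \<and> norm y \<le> R \<and> (norm (x - y))\<^sup>2 \<le> 3 * \<epsilon> \<and>
           (\<forall>z\<in>X. (norm (y - z))\<^sup>2 \<le> (norm (y0 - z))\<^sup>2)) \<and>
        real (loo_count lmo (ip x0 y0)) \<le>
          max 0 (of_int \<lceil>27 * R\<^sup>2 / \<epsilon> - 2\<rceil>) *
          max 1 ((norm (x0 - y0))\<^sup>2 * ((norm (x0 - y0))\<^sup>2 - \<epsilon>) / (4 * \<epsilon>\<^sup>2) + 1))"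

datatype 'v setting = Monotone real | Nonmonotone 'v

primrec approx_ratio :: "(real^'d) setting \<Rightarrow> real" where
  "approx_ratio (Monotone \<gamma>) = 1 - exp (- \<gamma>)"
| "approx_ratio (Nonmonotone u) = (1 - infnorm u) / 4"

primrec h_map :: "(real^'d) setting \<Rightarrow> real^'d \<Rightarrow> real^'d" where
  "h_map (Monotone \<gamma>) x = x"
| "h_map (Nonmonotone u) x = (1 / 2) *\<^sub>R (x + u)"

primrec w_map :: "(real^'d) setting \<Rightarrow> real^'d \<Rightarrow> real \<Rightarrow> real^'d" where
  "w_map (Monotone \<gamma>) x z = z *\<^sub>R x"
| "w_map (Nonmonotone u) x z = (z / 2) *\<^sub>R (x - u) + u"

primrec z_law :: "(real^'d) setting \<Rightarrow> real measure" where
  "z_law (Monotone \<gamma>) = density lborel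
     (\<lambda>s. ennreal (indicator {0..1} s * (\<gamma> * exp (\<gamma> * (s - 1)) / (1 - exp (- \<gamma>)))))"
| "z_law (Nonmonotone u) = density lborel
     (\<lambda>s. ennreal (indicator {0..1} s * (1 / (3 * (1 - s / 2) ^ 3))))"

text \<open>
  \<open>fdom\<close> is the set on which the objectives are defined and regular. The order-theoretic assumptions
  are imposed on the cube only, but the perturbed query points may leave the cube (in the monotone
  case they always do so with positive probability, as the origin lies in the feasible set), so
  \<open>fdom\<close> has to contain the cube and all query points.

  \<open>response t i x \<xi>\<close> is the answer of the zeroth-order oracle for the objective of agent \<open>i\<close> at round
  \<open>t\<close> when queried at \<open>x\<close>, where the noise seed \<open>\<xi>\<close> is drawn from \<open>seed_law\<close>.\<close>

record ('n::finite, 'd::finite, 's) problem =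
  region :: "(real^'d) set"
  setting :: "(real^'d) setting"
  fdom :: "(real^'d) set"
  objective :: "nat \<Rightarrow> 'n \<Rightarrow> real^'d \<Rightarrow> real"
  seed_law :: "'s measure"
  response :: "nat \<Rightarrow> 'n \<Rightarrow> real^'d \<Rightarrow> 's \<Rightarrow> real"
  edges :: "('n \<times> 'n) set"
  weights :: "real^'n^'n"
  center :: "real^'d"
  radius :: real
  horizon :: nat
  par_K :: nat
  par_L :: nat
  par_eta :: real
  par_delta :: real
  lmo :: "real^'d \<Rightarrow> real^'d"
  proj_alg :: "real^'d \<Rightarrow> real^'d \<Rightarrow> (real^'d, (real^'d) \<times> (real^'d)) loo_prog"

definition max_norm :: "('n::finite, 'd::finite, 's) problem \<Rightarrow> real" where
  "max_norm P = (SUP x\<in>region P. norm x)"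

definition directions :: "('n::finite, 'd::finite, 's) problem \<Rightarrow> (real^'d) set" where
  "directions P = (\<lambda>y. y - center P) ` (affine hull region P)"

definition shrunk :: "('n::finite, 'd::finite, 's) problem \<Rightarrow> (real^'d) set" where
  "shrunk P = (\<lambda>x. (1 - par_delta P / radius P) *\<^sub>R x
                  + (par_delta P / radius P) *\<^sub>R center P) ` region P"

definition tolerance :: "('n::finite, 'd::finite, 's) problem \<Rightarrow> real" where
  "tolerance P = (real (par_K P))\<^sup>2 * (par_eta P)\<^sup>2 / (par_delta P)\<^sup>2"

definition blocks :: "('n::finite, 'd::finite, 's) problem \<Rightarrow> nat" where
  "blocks P = horizon P div (par_L P * par_K P)"

definition window :: "('n::finite, 'd::finite, 's) problem \<Rightarrow> nat \<Rightarrow> nat \<Rightarrow> nat set" where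
  "window P m q =
     {(m - 1) * par_K P * par_L P + (q - 1) * par_L P + 1
      .. (m - 1) * par_K P * par_L P + q * par_L P}"

text \<open>The sample drawn by agent \<open>i\<close> in repetition \<open>q\<close> of block \<open>m\<close> consists of the direction \<open>v\<close>, the
  scalar \<open>z\<close>, the query round, and the seed of the oracle response. The algorithm is a deterministic
  function of all samples.\<close>

type_synonym ('d, 's) sample = "(real^'d) \<times> real \<times> nat \<times> 's"
type_synonym ('n, 'd, 's) samples = "nat \<times> nat \<times> 'n \<Rightarrow> ('d, 's) sample"

record ('n, 'd) state =
  x_pos :: "'n \<Rightarrow> real^'d"
  y_pos :: "'n \<Rightarrow> real^'d"
  loo_calls :: "'n \<Rightarrow> nat"
  comms :: "'n \<Rightarrow> nat"

definition mix ::
  "('n::finite, 'd::finite, 's) problem \<Rightarrow> ('n \<Rightarrow> real^'d) \<Rightarrow> 'n \<Rightarrow> real^'d" where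
  "mix P s i = (\<Sum>j\<in>{j. (i, j) \<in> edges P} \<union> {i}. weights P $ i $ j *\<^sub>R s j)"

definition query_point ::
  "('n::finite, 'd::finite, 's) problem \<Rightarrow> real^'d \<Rightarrow> ('d, 's) sample \<Rightarrow> real^'d" where
  "query_point P x = (\<lambda>(v, z, t, \<xi>). w_map (setting P) x z + par_delta P *\<^sub>R v)"

definition estimate ::
  "('n::finite, 'd::finite, 's) problem \<Rightarrow> 'n \<Rightarrow> real^'d \<Rightarrow> ('d, 's) sample \<Rightarrow> real^'d" where
  "estimate P i x = (\<lambda>(v, z, t, \<xi>).
     (real (dim (directions P)) / par_delta P
        * response P t i (query_point P x (v, z, t, \<xi>)) \<xi>) *\<^sub>R v)"

text \<open>\<open>run_alg P s m\<close> is the state after \<open>m\<close> blocks, that is, at the beginning of block \<open>m + 1\<close>.\<close>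

primrec run_alg ::
  "('n::finite, 'd::finite, 's) problem \<Rightarrow> ('n, 'd, 's) samples \<Rightarrow> nat \<Rightarrow> ('n, 'd) state" where
  "run_alg P s 0 =
     \<lparr>x_pos = (\<lambda>i. center P), y_pos = (\<lambda>i. center P), loo_calls = (\<lambda>i. 0), comms = (\<lambda>i. 0)\<rparr>"
| "run_alg P s (Suc m) =
     (let st = run_alg P s m;
          y = (\<lambda>i. mix P (y_pos st) i
                + par_eta P *\<^sub>R (\<Sum>q=1..par_K P. estimate P i (x_pos st i) (s (Suc m, q, i))));
          prog = (\<lambda>i. proj_alg P (mix P (x_pos st) i) (y i))
      in \<lparr>x_pos = (\<lambda>i. fst (loo_run (lmo P) (prog i))),
          y_pos = (\<lambda>i. snd (loo_run (lmo P) (prog i))),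
          loo_calls = (\<lambda>i. loo_calls st i + loo_count (lmo P) (prog i)),
          comms = (\<lambda>i. comms st i + 1)\<rparr>)"

definition played ::
  "('n::finite, 'd::finite, 's) problem \<Rightarrow> ('n, 'd, 's) samples \<Rightarrow> nat \<Rightarrow> 'n \<Rightarrow> real^'d" where
  "played P s t i =
     (let m = (t - 1) div (par_K P * par_L P) + 1;
          q = (t - 1) mod (par_K P * par_L P) div par_L P + 1;
          x = x_pos (run_alg P s (m - 1)) i
      in case s (m, q, i) of (v, z, t', \<xi>) \<Rightarrow>
           if t = t' then query_point P x (v, z, t', \<xi>) else h_map (setting P) x)"

definition avg_total :: "('n::finite, 'd::finite, 's) problem \<Rightarrow> (nat \<Rightarrow> real^'d) \<Rightarrow> real" where
  "avg_total P p = 1 / real CARD('n) * (\<Sum>t=1..horizon P. \<Sum>j\<in>UNIV. objective P t j (p t))"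

definition regret ::
  "('n::finite, 'd::finite, 's) problem \<Rightarrow> ('n, 'd, 's) samples \<Rightarrow> 'n \<Rightarrow> real" where
  "regret P s i = approx_ratio (setting P) * (SUP u\<in>region P. avg_total P (\<lambda>t. u))
                  - avg_total P (\<lambda>t. played P s t i)"

definition region_ok :: "('n::finite, 'd::finite, 's) problem \<Rightarrow> bool" where
  "region_ok P \<longleftrightarrow>
     convex (region P) \<and> compact (region P) \<and> region P \<subseteq> cube \<and>
     center P \<in> rel_interior (region P) \<and> 0 < radius P \<and>
     affine hull region P \<inter> ball (center P) (radius P) \<subseteq> region P"

definition network_ok :: "('n::finite, 'd::finite, 's) problem \<Rightarrow> bool" where
  "network_ok P \<longleftrightarrow>
     sym (edges P) \<and>
     (\<forall>i j. 0 \<le> weights P $ i $ j) \<and>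
     (\<forall>i j. 0 < weights P $ i $ j \<longrightarrow> (i, j) \<in> edges P \<or> i = j) \<and>
     transpose (weights P) = weights P \<and>
     (\<forall>i. (\<Sum>j\<in>UNIV. weights P $ i $ j) = 1) \<and>
     (\<forall>j. (\<Sum>i\<in>UNIV. weights P $ i $ j) = 1)"

definition parameters_ok :: "('n::finite, 'd::finite, 's) problem \<Rightarrow> bool" where
  "parameters_ok P \<longleftrightarrow>
     0 < par_K P \<and> 0 < par_L P \<and> par_K P * par_L P dvd horizon P \<and>
     0 < par_eta P \<and> 0 < par_delta P \<and> par_delta P < radius P"

definition case_ok :: "real \<Rightarrow> ('n::finite, 'd::finite, 's) problem \<Rightarrow> bool" where
  "case_ok \<gamma> P \<longleftrightarrow>
     (case setting P of
        Monotone g \<Rightarrow>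
          g = \<gamma> \<and> 0 < \<gamma> \<and> \<gamma> \<le> 1 \<and> 0 \<in> region P \<and>
          (\<forall>t\<in>{1..horizon P}. \<forall>i.
             (\<forall>x\<in>cube. 0 \<le> objective P t i x) \<and>
             mono_on cube (objective P t i) \<and>
             weakly_up_concave_on cube \<gamma> (objective P t i))
      | Nonmonotone u \<Rightarrow>
          u \<in> region P \<and>
          (\<forall>t\<in>{1..horizon P}. \<forall>i.
             (\<forall>x\<in>cube. 0 \<le> objective P t i x) \<and>
             weakly_up_concave_on cube 1 (objective P t i)))"

definition regular_ok :: "real \<Rightarrow> real \<Rightarrow> ('n::finite, 'd::finite, 's) problem \<Rightarrow> bool" where
  "regular_ok G M P \<longleftrightarrow>
     convex (fdom P) \<and> cube \<subseteq> fdom P \<and>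
     (\<forall>x\<in>region P. \<forall>v\<in>sphere 0 1 \<inter> directions P. x + par_delta P *\<^sub>R v \<in> fdom P) \<and>
     (\<forall>t\<in>{1..horizon P}. \<forall>i.
        continuous_on (fdom P) (objective P t i) \<and>
        objective P t i differentiable_on fdom P \<and>
        G-lipschitz_on (fdom P) (objective P t i) \<and>
        M-lipschitz_on (fdom P) (grad (fdom P) (objective P t i)))"

definition oracle_ok :: "real \<Rightarrow> ('n::finite, 'd::finite, 's) problem \<Rightarrow> bool" where
  "oracle_ok B P \<longleftrightarrow>
     prob_space (seed_law P) \<and>
     (\<forall>t\<in>{1..horizon P}. \<forall>i.
        (\<lambda>(x, \<xi>). response P t i x \<xi>) \<in> borel_measurable (borel \<Otimes>\<^sub>M seed_law P) \<and>
        (\<forall>x\<in>fdom P.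
           (\<forall>\<xi>\<in>space (seed_law P). \<bar>response P t i x \<xi>\<bar> \<le> B) \<and>
           (\<integral>\<xi>. response P t i x \<xi> \<partial>seed_law P) = objective P t i x))"

definition projection_ok :: "('n::finite, 'd::finite, 's) problem \<Rightarrow> bool" where
  "projection_ok P \<longleftrightarrow>
     is_loo (shrunk P) (lmo P) \<and>
     infeasible_projection (shrunk P) (max_norm P) (tolerance P) (lmo P) (proj_alg P)"

text \<open>The uniform distribution on the unit sphere of a subspace \<open>U\<close> is its unique probability measure
  invariant under all rotations and reflections of \<open>U\<close>. It does not exist for \<open>U = {0}\<close>.\<close>

definition uniform_on_unit_sphere :: "(real^'d) set \<Rightarrow> (real^'d) measure \<Rightarrow> bool" where
  "uniform_on_unit_sphere U \<mu> \<longleftrightarrow>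
     prob_space \<mu> \<and> sets \<mu> = sets borel \<and> emeasure \<mu> (sphere 0 1 \<inter> U) = 1 \<and>
     (\<forall>g. orthogonal_transformation g \<and> g ` U = U \<longrightarrow> distr \<mu> borel g = \<mu>)"

abbreviation sample_space ::
  "('n::finite, 'd::finite, 's) problem \<Rightarrow> ('d, 's) sample measure" where
  "sample_space P \<equiv> borel \<Otimes>\<^sub>M (borel \<Otimes>\<^sub>M (count_space UNIV \<Otimes>\<^sub>M seed_law P))"

definition sampling_ok ::
  "('n::finite, 'd::finite, 's) problem \<Rightarrow> 'w measure \<Rightarrow>
     (nat \<times> nat \<times> 'n \<Rightarrow> 'w \<Rightarrow> ('d, 's) sample) \<Rightarrow> bool" where
  "sampling_ok P \<Omega> S \<longleftrightarrow>
     prob_space \<Omega> \<and>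
     (\<forall>m\<in>{1..blocks P}. \<forall>q\<in>{1..par_K P}. \<forall>i. \<forall>\<omega>\<in>space \<Omega>.
        S (m, q, i) \<omega> \<in>
          (sphere 0 1 \<inter> directions P) \<times> {0..1} \<times> window P m q \<times> space (seed_law P)) \<and>
     prob_space.indep_vars \<Omega> (\<lambda>_. sample_space P) S ({1..blocks P} \<times> {1..par_K P} \<times> UNIV) \<and>
     (\<forall>m\<in>{1..blocks P}. \<forall>q\<in>{1..par_K P}. \<forall>i. \<exists>\<mu>.
        uniform_on_unit_sphere (directions P) \<mu> \<and>
        distr \<Omega> (sample_space P) (S (m, q, i)) =
          \<mu> \<Otimes>\<^sub>M (z_law (setting P) \<Otimes>\<^sub>M
            (measure_pmf (pmf_of_set (window P m q)) \<Otimes>\<^sub>M seed_law P)))"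

end

theory Submission
  imports Defs
begin

text \<open>
  Three facts drive the proof.

  \<^item> \<^bold>\<open>Upper linearization\<close> (\<open>upper_linearization\<close>). Averaging the gradient of an objective \<open>f\<close> along
    the path \<open>z \<mapsto> w(x, z)\<close> against the law of \<open>z\<close> gives a vector \<open>g(x)\<close> such that
    \<open>\<alpha> f(y) - f(h(x)) \<le> \<beta> \<langle>g(x), y - x\<rangle>\<close> for all \<open>y\<close> in the cube, with \<open>0 \<le> \<beta> \<le> 1\<close>. In both cases a constant
    multiple of the density, times \<open>\<langle>\<nabla>f(w(x, z)), y - x\<rangle>\<close>, dominates an exact derivative in \<open>z\<close>, and
    the law of \<open>z\<close> is designed so that the boundary terms of this derivative are at least the left-hand
    side.
    The regret is thereby reduced to the regret of a linear problem with gains \<open>g(x)\<close>.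

  \<^item> \<^bold>\<open>One-point estimates\<close> (\<open>clipped_estimate_mean_ge\<close>). If \<open>v\<close> is uniform on the unit sphere of a
    \<open>k\<close>-dimensional space, then \<open>v\<close> has mean zero and covariance \<open>1/k\<close> times the identity
    (\<open>uniform_on_unit_sphere_second_moment\<close>). Taylor expansion of \<open>f(w + \<delta> v)\<close> therefore shows that
    \<open>(k/\<delta>) f(w + \<delta> v) v\<close> has mean \<open>\<nabla>f(w)\<close> along the space, up to an error of order \<open>\<delta>\<close>. Since the
    sample of an agent is independent of its position, this passes to the expected linear gains
    (\<open>expectation_estimate\<close>).

  \<^item> \<^bold>\<open>Consensus gradient ascent\<close> (\<open>linear_regret_bound\<close>). The infeasible projection does not
    increase the distance of its target to any point of the shrunk set, and averaging with a doubly stochastic matrix does not increase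
    the sum of squared distances to a comparator. So the usual potential argument for online
    gradient ascent applies to the \<open>y\<close>-states. The \<open>x\<close>-states follow them within a multiple of
    \<open>sqrt \<epsilon> = K \<eta> / \<delta>\<close>: each block perturbs the mixing dynamics by that order, and the spectral gap
    makes the perturbations sum like a geometric series (\<open>consensus_bound\<close>).

  Comparing with the shrunk set costs \<open>O(\<delta> T)\<close> and the \<open>T / L\<close> exploration rounds cost \<open>O(T / L)\<close>. Every call
  of the projection starts within a multiple of \<open>sqrt \<epsilon>\<close> of its target, so that it needs \<open>O(1 / \<epsilon>)\<close>
  calls of the linear optimizer.
\<close>

section \<open>The spectral gap of a symmetric doubly stochastic matrix\<close>

lemma inner_symmetric_matrix:
  fixes A :: "real^'n^'n"
  assumes "transpose A = A"
  shows "(A *v x) \<bullet> y = x \<bullet> (A *v y)"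
  using dot_lmul_matrix[of x A y] assms by (simp add: transpose_matrix_vector[symmetric])

text \<open>Eigenvectors of distinct eigenvalues are orthogonal, hence independent. Finiteness is what gives
  the maximum in the definition of the second eigenvalue its meaning.\<close>

lemma finite_eigenvalues_symmetric:
  fixes A :: "real^'n^'n"
  assumes sym: "transpose A = A"
  shows "finite {\<mu>. \<exists>v. v \<noteq> 0 \<and> A *v v = \<mu> *\<^sub>R v}"
proof -
  let ?E = "{\<mu>. \<exists>v. v \<noteq> 0 \<and> A *v v = \<mu> *\<^sub>R v}"
  define ev where "ev \<mu> = (SOME v. v \<noteq> 0 \<and> A *v v = \<mu> *\<^sub>R v)" for \<mu>
  have ev: "ev \<mu> \<noteq> 0 \<and> A *v ev \<mu> = \<mu> *\<^sub>R ev \<mu>" if "\<mu> \<in> ?E" for \<mu>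
    unfolding ev_def by (rule someI_ex) (use that in auto)
  have orth: "orthogonal (ev \<mu>) (ev \<nu>)" if "\<mu> \<in> ?E" "\<nu> \<in> ?E" "\<mu> \<noteq> \<nu>" for \<mu> \<nu>
  proof -
    have "\<mu> * (ev \<mu> \<bullet> ev \<nu>) = \<nu> * (ev \<mu> \<bullet> ev \<nu>)"
      using inner_symmetric_matrix[OF sym, of "ev \<mu>" "ev \<nu>"] ev that by simp
    then show ?thesis using that(3) by (simp add: orthogonal_def)
  qed
  have "pairwise orthogonal (ev ` ?E)"
    using orth by (auto simp: pairwise_def)
  then have "independent (ev ` ?E)"
    by (intro pairwise_orthogonal_independent) (use ev in force)+
  then have "finite (ev ` ?E)"
    by (rule independent_imp_finite)
  moreover have "inj_on ev ?E"
  proof (rule inj_onI, rule ccontr)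
    fix \<mu> \<nu> assume "\<mu> \<in> ?E" "\<nu> \<in> ?E" "ev \<mu> = ev \<nu>" "\<mu> \<noteq> \<nu>"
    then show False using orth[of \<mu> \<nu>] ev[of \<nu>] by (simp add: orthogonal_self)
  qed
  ultimately show ?thesis
    by (rule finite_imageD)
qed

lemma
  fixes A :: "real^'n^'n"
  assumes sym: "transpose A = A"
  shows lambda2_nonneg: "0 \<le> lambda2 A"
    and lambda2_ge: "dim (eigenspace A \<mu>) > (if \<mu> = 1 then 1 else 0) \<Longrightarrow> \<bar>\<mu>\<bar> \<le> lambda2 A"
proof -
  let ?S = "{\<bar>\<mu>\<bar> |\<mu>. dim (eigenspace A \<mu>) > (if \<mu> = 1 then 1 else 0)}"
  have "?S \<subseteq> abs ` {\<mu>. \<exists>v. v \<noteq> 0 \<and> A *v v = \<mu> *\<^sub>R v}"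
  proof clarify
    fix \<mu> :: real
    assume "(if \<mu> = 1 then 1 else 0) < dim (eigenspace A \<mu>)"
    then have "dim (eigenspace A \<mu>) \<noteq> 0" by linarith
    then have "\<exists>v. v \<noteq> 0 \<and> A *v v = \<mu> *\<^sub>R v"
      by (auto simp: eigenspace_def)
    then show "\<bar>\<mu>\<bar> \<in> abs ` {\<mu>. \<exists>v. v \<noteq> 0 \<and> A *v v = \<mu> *\<^sub>R v}"
      by (intro imageI) simp
  qed
  then have fin: "finite ?S"
    using finite_eigenvalues_symmetric[OF sym] finite_subset by blast
  show "0 \<le> lambda2 A"
    unfolding lambda2_def using fin by (intro Max_ge) auto
  show "\<bar>\<mu>\<bar> \<le> lambda2 A" if "dim (eigenspace A \<mu>) > (if \<mu> = 1 then 1 else 0)"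
    unfolding lambda2_def using fin that by (intro Max_ge finite.insertI insertI2 CollectI exI[of _ \<mu>] conjI refl)
qed

text \<open>An eigenvector orthogonal to the constant vector counts towards the second eigenvalue even if its
  eigenvalue is \<open>1\<close>: then it spans, together with the constant vector, a plane in that eigenspace.\<close>

lemma eigenvalue_le_lambda2:
  fixes A :: "real^'n^'n"
  assumes sym: "transpose A = A" and rows: "\<And>i. (\<Sum>j\<in>UNIV. A $ i $ j) = 1"
    and v: "v \<noteq> 0" "(\<Sum>i\<in>UNIV. v $ i) = 0" "A *v v = \<mu> *\<^sub>R v"
  shows "\<bar>\<mu>\<bar> \<le> lambda2 A"
proof (rule lambda2_ge[OF sym])
  have v_in: "v \<in> eigenspace A \<mu>"
    using v by (simp add: eigenspace_def)
  show "dim (eigenspace A \<mu>) > (if \<mu> = 1 then 1 else 0)"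
  proof (cases "\<mu> = 1")
    case True
    have one_in: "(1 :: real^'n) \<in> eigenspace A \<mu>"
      using rows True by (simp add: eigenspace_def matrix_vector_mult_def vec_eq_iff)
    have "orthogonal v 1"
      using v(2) by (simp add: orthogonal_def inner_vec_def)
    moreover have one: "(1 :: real^'n) \<noteq> 0" by simp
    ultimately have ne: "v \<noteq> 1" using v(1) by (auto simp: orthogonal_def)
    have "pairwise orthogonal {v, 1}"
      using \<open>orthogonal v 1\<close> by (auto simp: pairwise_def orthogonal_commute)
    then have "independent {v, 1}"
      using v(1) one by (intro pairwise_orthogonal_independent) auto
    then have "card {v, 1} \<le> dim (eigenspace A \<mu>)"
      using v_in one_in by (intro independent_card_le_dim) auto
    then show ?thesis using ne True by simp
  next
    case False
    then show ?thesis using v_in v(1) by (auto simp: dim_eq_0 intro!: gr0I)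
  qed
qed

text \<open>A maximiser \<open>w\<close> of \<open>norm (A w)\<close> on the unit sphere orthogonal to the constants, with maximum \<open>s\<close>,
  satisfies \<open>A\<^sup>2 w = s\<^sup>2 w\<close>. Hence \<open>(A - s)(A + s) w = 0\<close>, and \<open>s\<close> or \<open>- s\<close> is an eigenvalue.\<close>

lemma norm_mult_le_lambda2:
  fixes A :: "real^'n^'n"
  assumes sym: "transpose A = A" and rows: "\<And>i. (\<Sum>j\<in>UNIV. A $ i $ j) = 1"
    and v0: "(\<Sum>i\<in>UNIV. v $ i) = 0"
  shows "norm (A *v v) \<le> lambda2 A * norm v"
proof (cases "v = 0")
  case True
  then show ?thesis by simp
next
  case False
  define U :: "(real^'n) set" where "U = {v. 1 \<bullet> v = 0}"
  have subU: "subspace U"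
    unfolding U_def by (simp add: subspace_hyperplane)
  have U_iff: "w \<in> U \<longleftrightarrow> (\<Sum>i\<in>UNIV. w $ i) = 0" for w
    by (simp add: U_def inner_vec_def)
  have A1: "A *v 1 = 1"
    using rows by (simp add: matrix_vector_mult_def vec_eq_iff)
  have AU: "A *v w \<in> U" if "w \<in> U" for w
    using that inner_symmetric_matrix[OF sym, of 1 w] A1 by (simp add: U_def)
  have "compact (sphere 0 1 \<inter> U)"
    by (intro compact_Int_closed closed_subspace subU) auto
  moreover have "(1 / norm v) *\<^sub>R v \<in> sphere 0 1 \<inter> U"
    using False v0 subspace_scale[OF subU, of v "1 / norm v"] U_iff[of v] by simp
  moreover have "continuous_on (sphere 0 1 \<inter> U) (\<lambda>w. norm (A *v w))"
    by (intro continuous_intros matrix_vector_mult_linear_continuous_on)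
  ultimately obtain w where w: "w \<in> sphere 0 1 \<inter> U"
    and wmax: "\<And>u. u \<in> sphere 0 1 \<inter> U \<Longrightarrow> norm (A *v u) \<le> norm (A *v w)"
    using continuous_attains_sup[of "sphere 0 1 \<inter> U" "\<lambda>w. norm (A *v w)"] by blast
  define s where "s = norm (A *v w)"
  have s0: "0 \<le> s" by (simp add: s_def)
  have bound: "norm (A *v u) \<le> s * norm u" if "u \<in> U" for u
  proof (cases "u = 0")
    case False
    then have "norm (A *v ((1 / norm u) *\<^sub>R u)) \<le> s"
      unfolding s_def using False that subspace_scale[OF subU, of u "1 / norm u"] by (intro wmax) simp
    then show ?thesis using False by (simp add: matrix_vector_mult_scaleR field_simps)
  qed simp
  have nw: "norm w = 1" "w \<bullet> w = 1" and wU: "w \<in> U"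
    using w by (auto simp: dot_square_norm)
  \<comment> \<open>By maximality, the expanded square is at most \<open>s\<^sup>4 - 2 s\<^sup>4 + s\<^sup>4 = 0\<close>.\<close>
  have "(norm (A *v (A *v w) - s\<^sup>2 *\<^sub>R w))\<^sup>2
      = (norm (A *v (A *v w)))\<^sup>2 - 2 * s\<^sup>2 * ((A *v (A *v w)) \<bullet> w) + s^4"
    unfolding power2_norm_eq_inner inner_diff using nw
    by (simp add: inner_commute algebra_simps power2_eq_square power4_eq_xxxx)
  also have "(A *v (A *v w)) \<bullet> w = s\<^sup>2"
    unfolding s_def power2_norm_eq_inner by (rule inner_symmetric_matrix[OF sym])
  also have "(norm (A *v (A *v w)))\<^sup>2 \<le> (s * s)\<^sup>2"
    using bound[OF AU[OF wU]] by (intro power_mono) (simp_all flip: s_def)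
  finally have "(norm (A *v (A *v w) - s\<^sup>2 *\<^sub>R w))\<^sup>2 \<le> 0"
    by (simp add: power_mult_distrib power4_eq_xxxx power2_eq_square del: power2_less_eq_zero_iff power_eq_0_iff)
  then have AA: "A *v (A *v w) = s\<^sup>2 *\<^sub>R w"
    unfolding power2_less_eq_zero_iff norm_eq_zero by simp
  have "s \<le> lambda2 A"
  proof (cases "A *v w + s *\<^sub>R w = 0")
    case True
    then have "A *v w = (- s) *\<^sub>R w"
      unfolding scaleR_minus_left by (rule eq_neg_iff_add_eq_0[THEN iffD2])
    then have "\<bar>- s\<bar> \<le> lambda2 A"
      using wU U_iff nw by (intro eigenvalue_le_lambda2[OF sym rows, of w]) auto
    then show ?thesis using s0 by simp
  next
    case False
    have "A *v (A *v w + s *\<^sub>R w) = s *\<^sub>R (A *v w + s *\<^sub>R w)"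
      unfolding matrix_vector_right_distrib AA matrix_vector_mult_scaleR
      by (simp only: scaleR_right_distrib scaleR_scaleR power2_eq_square add.commute)
    moreover have "A *v w + s *\<^sub>R w \<in> U"
      by (intro subspace_add[OF subU] subspace_scale[OF subU] AU wU)
    ultimately have "\<bar>s\<bar> \<le> lambda2 A"
      using False U_iff by (intro eigenvalue_le_lambda2[OF sym rows]) auto
    then show ?thesis by simp
  qed
  then show ?thesis
    using bound[of v] v0 U_iff[of v] mult_right_mono[of s "lambda2 A" "norm v"] by simp
qed

lemma sum_norm_squared_mix_le:
  fixes A :: "real^'n^'n" and x :: "'n \<Rightarrow> 'a::euclidean_space"
  assumes sym: "transpose A = A" and rows: "\<And>i. (\<Sum>j\<in>UNIV. A $ i $ j) = 1"
    and x0: "(\<Sum>i\<in>UNIV. x i) = 0"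
  shows "(\<Sum>i\<in>UNIV. (norm (\<Sum>j\<in>UNIV. A $ i $ j *\<^sub>R x j))\<^sup>2)
    \<le> (lambda2 A)\<^sup>2 * (\<Sum>i\<in>UNIV. (norm (x i))\<^sup>2)"
proof -
  have comp: "(\<Sum>i\<in>UNIV. (\<Sum>j\<in>UNIV. A $ i $ j * (x j \<bullet> b))\<^sup>2)
    \<le> (lambda2 A)\<^sup>2 * (\<Sum>i\<in>UNIV. (x i \<bullet> b)\<^sup>2)" for b
  proof -
    define v where "v = (\<chi> i. x i \<bullet> b)"
    have "(\<Sum>i\<in>UNIV. v $ i) = (\<Sum>i\<in>UNIV. x i) \<bullet> b"
      by (simp add: v_def inner_sum_left)
    then have "norm (A *v v) \<le> lambda2 A * norm v"
      using x0 by (intro norm_mult_le_lambda2[OF sym rows]) simp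
    then have "(norm (A *v v))\<^sup>2 \<le> (lambda2 A * norm v)\<^sup>2"
      by (intro power_mono) auto
    then show ?thesis
      unfolding power_mult_distrib power2_norm_eq_inner inner_vec_def
      by (simp add: v_def matrix_vector_mult_def power2_eq_square)
  qed
  have nrm: "(norm u)\<^sup>2 = (\<Sum>b\<in>Basis. (u \<bullet> b)\<^sup>2)" for u :: 'a
    unfolding power2_norm_eq_inner by (subst euclidean_inner) (simp add: power2_eq_square)
  have "(\<Sum>i\<in>UNIV. (norm (\<Sum>j\<in>UNIV. A $ i $ j *\<^sub>R x j))\<^sup>2)
      = (\<Sum>b\<in>Basis. \<Sum>i\<in>UNIV. (\<Sum>j\<in>UNIV. A $ i $ j * (x j \<bullet> b))\<^sup>2)"
    unfolding nrm by (subst sum.swap) (simp add: inner_sum_left)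
  also have "\<dots> \<le> (\<Sum>b\<in>Basis. (lambda2 A)\<^sup>2 * (\<Sum>i\<in>UNIV. (x i \<bullet> b)\<^sup>2))"
    by (intro sum_mono comp)
  also have "\<dots> = (lambda2 A)\<^sup>2 * (\<Sum>i\<in>UNIV. (norm (x i))\<^sup>2)"
    unfolding nrm by (subst sum.swap) (simp add: sum_distrib_left)
  finally show ?thesis .
qed

section \<open>Moments of the uniform distribution on a sphere\<close>

definition householder :: "'a::real_inner \<Rightarrow> 'a \<Rightarrow> 'a" where
  "householder n x = x - (2 * (n \<bullet> x) / (n \<bullet> n)) *\<^sub>R n"

lemma orthogonal_transformation_householder: "orthogonal_transformation (householder n)"
proof (cases "n = 0")
  case False
  show ?thesis
    unfolding orthogonal_transformation_def
  proof (intro conjI allI linearI)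
    fix v w :: 'a and c :: real
    show "householder n (v + w) = householder n v + householder n w"
      by (simp add: householder_def inner_add_right add_divide_distrib distrib_left scaleR_add_left)
    show "householder n (c *\<^sub>R v) = c *\<^sub>R householder n v"
      by (simp add: householder_def scaleR_diff_right)
    have "(2 * (n \<bullet> v) / (n \<bullet> n)) * (2 * (n \<bullet> w) / (n \<bullet> n)) * (n \<bullet> n)
        = (2 * (n \<bullet> v) / (n \<bullet> n)) * (2 * (n \<bullet> w))"
      using False by simp
    then show "householder n v \<bullet> householder n w = v \<bullet> w"
      by (simp add: householder_def inner_diff inner_commute mult.commute)
  qed
qed (simp add: householder_def[abs_def])

lemma householder_in_subspace:
  assumes "subspace U" "n \<in> U" "x \<in> U"
  shows "householder n x \<in> U"
  unfolding householder_def using assms by (intro subspace_diff subspace_scale)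

lemma householder_involution: "householder n (householder n x) = x"
  by (cases "n = 0") (simp_all add: householder_def inner_diff_right)

lemma householder_image:
  assumes "subspace U" "n \<in> U"
  shows "householder n ` U = U"
proof
  show "U \<subseteq> householder n ` U"
  proof
    fix x assume "x \<in> U"
    then show "x \<in> householder n ` U"
      using householder_in_subspace[OF assms] householder_involution[of n x] by (metis imageI)
  qed
qed (use householder_in_subspace[OF assms] in auto)

lemma householder_swap:
  assumes "norm a = norm b"
  shows "householder (a - b) a = b"
proof (cases "a = b")
  case False
  have "a \<bullet> a = b \<bullet> b" using assms by (simp add: norm_eq)
  then have "(a - b) \<bullet> (a - b) = 2 * ((a - b) \<bullet> a)"
    by (simp add: inner_diff inner_commute)
  moreover have "(a - b) \<bullet> (a - b) \<noteq> 0" using False by simp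
  ultimately show ?thesis by (simp add: householder_def)
qed (simp add: householder_def)

lemma AE_uniform_on_unit_sphere:
  fixes U :: "(real^'d) set"
  assumes "uniform_on_unit_sphere U \<mu>"
  shows "AE v in \<mu>. norm v = 1 \<and> v \<in> U"
proof -
  interpret prob_space \<mu> using assms by (simp add: uniform_on_unit_sphere_def)
  have "prob (sphere 0 1 \<inter> U) = 1"
    using assms by (simp add: uniform_on_unit_sphere_def measure_def)
  from AE_prob_1[OF this] show ?thesis by eventually_elim simp
qed

lemma integral_uniform_on_unit_sphere_invariant:
  fixes f :: "real^'d \<Rightarrow> real"
  assumes \<mu>: "uniform_on_unit_sphere U \<mu>" and g: "orthogonal_transformation g" "g ` U = U"
    and f: "f \<in> borel_measurable borel"
  shows "(\<integral>v. f (g v) \<partial>\<mu>) = (\<integral>v. f v \<partial>\<mu>)"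
proof -
  have "g \<in> borel_measurable borel"
    using g(1) by (intro borel_measurable_continuous_onI linear_continuous_on)
      (auto simp: linear_conv_bounded_linear[symmetric] orthogonal_transformation_linear)
  moreover have sets: "sets \<mu> = sets borel" and inv: "distr \<mu> borel g = \<mu>"
    using \<mu> g by (auto simp: uniform_on_unit_sphere_def)
  ultimately have gm: "g \<in> \<mu> \<rightarrow>\<^sub>M borel"
    by (simp add: measurable_def sets_eq_imp_space_eq[OF sets])
  have "(\<integral>v. f v \<partial>\<mu>) = (\<integral>v. f v \<partial>distr \<mu> borel g)"
    by (simp add: inv)
  also have "\<dots> = (\<integral>v. f (g v) \<partial>\<mu>)"
    by (rule integral_distr[OF gm f])
  finally show ?thesis by simp
qed

lemma integrable_uniform_on_unit_sphere:
  fixes f :: "real^'d \<Rightarrow> real"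
  assumes \<mu>: "uniform_on_unit_sphere U \<mu>" and f: "f \<in> borel_measurable borel"
    and bd: "\<And>v. norm v = 1 \<Longrightarrow> v \<in> U \<Longrightarrow> \<bar>f v\<bar> \<le> B"
  shows "integrable \<mu> f"
proof -
  interpret prob_space \<mu> using \<mu> by (simp add: uniform_on_unit_sphere_def)
  have sets: "sets \<mu> = sets borel" using \<mu> by (simp add: uniform_on_unit_sphere_def)
  show ?thesis
  proof (rule integrable_const_bound)
    show "AE v in \<mu>. norm (f v) \<le> B"
      using AE_uniform_on_unit_sphere[OF \<mu>] by eventually_elim (use bd in simp)
    show "f \<in> borel_measurable \<mu>" using f sets by (simp cong: measurable_cong_sets)
  qed
qed

lemma integrable_inner_unit_sphere:
  assumes \<mu>: "uniform_on_unit_sphere U \<mu>"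
  shows "integrable \<mu> (\<lambda>v. a \<bullet> v)" "integrable \<mu> (\<lambda>v. (a \<bullet> v) * (b \<bullet> v))"
proof -
  show "integrable \<mu> (\<lambda>v. a \<bullet> v)"
  proof (rule integrable_uniform_on_unit_sphere[OF \<mu>])
    show "\<bar>a \<bullet> v\<bar> \<le> norm a" if "norm v = 1" for v
      using Cauchy_Schwarz_ineq2[of a v] that by simp
  qed simp
  show "integrable \<mu> (\<lambda>v. (a \<bullet> v) * (b \<bullet> v))"
  proof (rule integrable_uniform_on_unit_sphere[OF \<mu>])
    show "\<bar>(a \<bullet> v) * (b \<bullet> v)\<bar> \<le> norm a * norm b" if "norm v = 1" for v
      unfolding abs_mult using Cauchy_Schwarz_ineq2[of a v] Cauchy_Schwarz_ineq2[of b v] that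
      by (intro mult_mono) auto
  qed simp
qed

lemma uniform_on_unit_sphere_mean:
  assumes \<mu>: "uniform_on_unit_sphere U \<mu>" and U: "subspace U"
  shows "(\<integral>v. a \<bullet> v \<partial>\<mu>) = 0"
proof -
  have "uminus ` U = U"
    using U subspace_neg[OF U] by (auto simp: image_iff) (metis minus_minus)
  then have "(\<integral>v. a \<bullet> (- v) \<partial>\<mu>) = (\<integral>v. a \<bullet> v \<partial>\<mu>)"
    by (intro integral_uniform_on_unit_sphere_invariant[OF \<mu>, where g = uminus])
      (auto simp: orthogonal_transformation_def intro!: linearI)
  then show ?thesis by simp
qed

text \<open>Any two vectors of \<open>U\<close> of equal length are exchanged by a reflection that preserves \<open>U\<close>, so
  \<open>\<integral> (a \<bullet> v)\<^sup>2\<close> depends only on the length of \<open>a\<close>. Summing over an orthonormal basis of \<open>U\<close> fixes the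
  constant \<open>1 / dim U\<close>, and polarisation gives the bilinear form.\<close>

lemma uniform_on_unit_sphere_second_moment:
  fixes U :: "(real^'d) set"
  assumes \<mu>: "uniform_on_unit_sphere U \<mu>" and U: "subspace U" and a: "a \<in> U"
  shows "(\<integral>v. (g \<bullet> v) * (a \<bullet> v) \<partial>\<mu>) = (g \<bullet> a) / dim U"
proof -
  define q where "q a = (\<integral>v. (a \<bullet> v)\<^sup>2 \<partial>\<mu>)" for a
  note int = integrable_inner_unit_sphere(2)[OF \<mu>]
  have q_eq: "q a = q b" if ab: "a \<in> U" "b \<in> U" "norm a = norm b" for a b
  proof -
    let ?h = "householder (a - b)"
    have o: "orthogonal_transformation ?h" by (rule orthogonal_transformation_householder)
    have swap: "b \<bullet> ?h v = a \<bullet> v" for v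
      using o householder_swap[OF ab(3)] by (metis orthogonal_transformation_def)
    have "q b = (\<integral>v. (b \<bullet> ?h v)\<^sup>2 \<partial>\<mu>)"
      unfolding q_def using ab
      by (intro integral_uniform_on_unit_sphere_invariant[OF \<mu> o, symmetric]
          householder_image[OF U] subspace_diff[OF U]) auto
    then show ?thesis by (simp add: q_def swap)
  qed
  have q_scale: "q (c *\<^sub>R a) = c\<^sup>2 * q a" for c a
    by (simp add: q_def power_mult_distrib)
  obtain B where B: "B \<subseteq> U" "pairwise orthogonal B" "\<And>x. x \<in> B \<Longrightarrow> norm x = 1"
    "independent B" "card B = dim U" "span B = U"
    using orthonormal_basis_subspace[OF U] by metis
  have fB: "finite B" by (rule independent_imp_finite[OF B(4)])
  have pars: "(\<Sum>b\<in>B. (b \<bullet> v)\<^sup>2) = (norm v)\<^sup>2" if "v \<in> U" for v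
  proof -
    have "(\<Sum>b\<in>B. (v \<bullet> b) *\<^sub>R b) = v"
      using B that fB by (intro orthonormal_basis_expand) auto
    then have "v \<bullet> v = v \<bullet> (\<Sum>b\<in>B. (v \<bullet> b) *\<^sub>R b)" by simp
    then show ?thesis
      unfolding power2_norm_eq_inner by (simp add: inner_sum_right inner_commute power2_eq_square)
  qed
  have sum_q: "(\<Sum>b\<in>B. q b) = 1"
  proof -
    interpret prob_space \<mu> using \<mu> by (simp add: uniform_on_unit_sphere_def)
    have "(\<Sum>b\<in>B. q b) = (\<integral>v. (\<Sum>b\<in>B. (b \<bullet> v)\<^sup>2) \<partial>\<mu>)"
      unfolding q_def power2_eq_square using int by (subst Bochner_Integration.integral_sum) auto
    also have "\<dots> = (\<integral>v. 1 \<partial>\<mu>)"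
    proof (rule integral_cong_AE)
      have sets: "sets \<mu> = sets borel" using \<mu> by (simp add: uniform_on_unit_sphere_def)
      show "(\<lambda>v. \<Sum>b\<in>B. (b \<bullet> v)\<^sup>2) \<in> borel_measurable \<mu>"
        by (simp cong: measurable_cong_sets[OF sets refl])
      show "AE v in \<mu>. (\<Sum>b\<in>B. (b \<bullet> v)\<^sup>2) = 1"
        using AE_uniform_on_unit_sphere[OF \<mu>] by eventually_elim (simp add: pars)
    qed simp
    finally show ?thesis by (simp add: prob_space)
  qed
  have q_val: "q a = (norm a)\<^sup>2 / dim U" if a: "a \<in> U" for a
  proof (cases "a = 0")
    case False
    define e where "e = (1 / norm a) *\<^sub>R a"
    have e: "e \<in> U" "norm e = 1" using a False subspace_scale[OF U] by (auto simp: e_def)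
    have "(\<Sum>b\<in>B. q b) = (\<Sum>b\<in>B. q e)"
      using B e by (intro sum.cong refl q_eq) auto
    then have "dim U * q e = 1" using sum_q B by simp
    moreover have "a = norm a *\<^sub>R e" using False by (simp add: e_def)
    then have "q a = (norm a)\<^sup>2 * q e" using q_scale[of "norm a" e] by simp
    moreover have "q e = 1 / dim U"
      using \<open>dim U * q e = 1\<close> by (cases "dim U = 0") (simp_all add: eq_divide_eq mult.commute)
    ultimately show ?thesis by simp
  qed (simp add: q_def)
  obtain g' p where g': "g' \<in> U" and p: "\<And>w. w \<in> U \<Longrightarrow> orthogonal p w" and g: "g = g' + p"
    using orthogonal_subspace_decomp_exists[of U g] unfolding span_eq_iff[THEN iffD2, OF U] by blast
  have "(\<integral>v. (g \<bullet> v) * (a \<bullet> v) \<partial>\<mu>) = (\<integral>v. (g' \<bullet> v) * (a \<bullet> v) \<partial>\<mu>)"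
  proof (intro integral_cong_AE borel_measurable_integrable int)
    show "AE v in \<mu>. (g \<bullet> v) * (a \<bullet> v) = (g' \<bullet> v) * (a \<bullet> v)"
      using AE_uniform_on_unit_sphere[OF \<mu>]
      by eventually_elim (use p in \<open>simp add: g inner_add_left orthogonal_def\<close>)
  qed
  also have "\<dots> = (\<integral>v. (((g' + a) \<bullet> v)\<^sup>2 - ((g' - a) \<bullet> v)\<^sup>2) / 4 \<partial>\<mu>)"
    by (intro Bochner_Integration.integral_cong refl)
      (simp add: inner_add_left inner_diff_left power2_eq_square algebra_simps)
  also have "\<dots> = (q (g' + a) - q (g' - a)) / 4"
    unfolding q_def power2_eq_square by (simp add: int)
  also have "\<dots> = ((norm (g' + a))\<^sup>2 - (norm (g' - a))\<^sup>2) / 4 / dim U"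
    using g' a U by (simp add: q_val subspace_add subspace_diff diff_divide_distrib)
  also have "((norm (g' + a))\<^sup>2 - (norm (g' - a))\<^sup>2) / 4 = g' \<bullet> a"
    unfolding power2_norm_eq_inner by (simp add: inner_add inner_diff inner_commute algebra_simps)
  also have "g' \<bullet> a = g \<bullet> a"
    using p[OF a] by (simp add: g inner_add_left orthogonal_def)
  finally show ?thesis .
qed

section \<open>Gradients\<close>

lemma has_derivative_grad:
  fixes f :: "real^'d \<Rightarrow> real"
  assumes "f differentiable_on X" "x \<in> X"
  shows "(f has_derivative (\<lambda>h. grad X f x \<bullet> h)) (at x within X)"
proof -
  obtain D where D: "(f has_derivative D) (at x within X)"
    using assms by (auto simp: differentiable_on_def differentiable_def)
  have "linear D" using D by (rule has_derivative_linear)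
  then have "D = (\<lambda>h. adjoint D 1 \<bullet> h)"
    using adjoint_works[of D _ 1] by (auto simp: inner_commute)
  then have "\<exists>g. (f has_derivative (\<lambda>h. g \<bullet> h)) (at x within X)"
    using D by metis
  then show ?thesis unfolding grad_def by (rule someI_ex)
qed

lemma cube_eq_cbox: "(cube :: (real^'d) set) = cbox 0 1"
  by (rule interval_cbox)

text \<open>The order conditions speak of the gradient relative to the cube, the smoothness conditions of the
  gradient relative to a larger domain. Derivatives within a box with nonempty interior are unique,
  so both agree on the cube.\<close>

lemma grad_cube_eq:
  fixes f :: "real^'d \<Rightarrow> real"
  assumes f: "f differentiable_on X" and sub: "cube \<subseteq> X" and x: "x \<in> cube"
  shows "grad cube f x = grad X f x"
proof -
  have d1: "(f has_derivative (\<lambda>h. grad cube f x \<bullet> h)) (at x within cbox 0 1)"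
    using has_derivative_grad[OF differentiable_on_subset[OF f sub] x] by (simp add: cube_eq_cbox)
  have d2: "(f has_derivative (\<lambda>h. grad X f x \<bullet> h)) (at x within cbox 0 1)"
    using has_derivative_subset[OF has_derivative_grad[OF f] sub] x sub by (auto simp: cube_eq_cbox)
  have "(\<lambda>h. grad cube f x \<bullet> h) = (\<lambda>h. grad X f x \<bullet> h)"
  proof (rule frechet_derivative_unique_within_closed_interval[OF _ _ d1 d2])
    show "(0::real^'d) \<bullet> i < 1 \<bullet> i" if "i \<in> Basis" for i
      using that by (auto simp: Basis_vec_def cart_eq_inner_axis[symmetric])
    show "x \<in> cbox 0 1" using x by (simp add: cube_eq_cbox)
  qed
  then show ?thesis
    by (metis vector_eq_rdot)
qed

lemma abs_taylor_remainder_le: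
  fixes f :: "real^'d \<Rightarrow> real"
  assumes X: "convex X" "x \<in> X" "y \<in> X" and f: "f differentiable_on X"
    and lip: "M-lipschitz_on X (grad X f)"
  shows "\<bar>f y - f x - grad X f x \<bullet> (y - x)\<bar> \<le> M * (norm (y - x))\<^sup>2"
proof -
  let ?S = "closed_segment x y"
  have sub: "?S \<subseteq> X" using X by (simp add: closed_segment_subset)
  have "norm (f y - f x - grad X f x \<bullet> (y - x)) \<le> norm (y - x) * (M * norm (y - x))"
  proof (rule differentiable_bound_linearization[where S = ?S and f' = "\<lambda>x h. grad X f x \<bullet> h"])
    show "x + t *\<^sub>R (y - x) \<in> ?S" if "t \<in> {0..1}" for t
      using that by (auto simp: in_segment algebra_simps intro!: exI[of _ t])
    show "(f has_derivative (\<bullet>) (grad X f z)) (at z within ?S)" if "z \<in> ?S" for z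
      using has_derivative_subset[OF has_derivative_grad[OF f] sub, of z] that sub by auto
    show "onorm ((\<bullet>) (grad X f z) - (\<bullet>) (grad X f x)) \<le> M * norm (y - x)" if z: "z \<in> ?S" for z
    proof (rule onorm_le)
      fix h :: "real^'d"
      have "norm (grad X f z - grad X f x) \<le> M * norm (z - x)"
        using lipschitz_onD[OF lip, of z x] z sub X by (auto simp: dist_norm)
      also have "\<dots> \<le> M * norm (y - x)"
        using segment_bound(1)[OF z] lipschitz_on_nonneg[OF lip]
        by (intro mult_left_mono) (auto simp: norm_minus_commute)
      finally have "norm (grad X f z - grad X f x) * norm h \<le> M * norm (y - x) * norm h"
        by (rule mult_right_mono) simp
      then show "norm (((\<bullet>) (grad X f z) - (\<bullet>) (grad X f x)) h) \<le> M * norm (y - x) * norm h"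
        using Cauchy_Schwarz_ineq2[of "grad X f z - grad X f x" h] by (simp add: inner_diff_left)
    qed
  qed simp
  then show ?thesis by (simp add: power2_eq_square mult.commute mult.left_commute)
qed

lemma has_real_derivative_along_line:
  fixes f :: "real^'d \<Rightarrow> real"
  assumes f: "f differentiable_on X" and p: "\<And>z. z \<in> S \<Longrightarrow> a + z *\<^sub>R b \<in> X" and z: "z \<in> S"
  shows "((\<lambda>z. f (a + z *\<^sub>R b)) has_real_derivative grad X f (a + z *\<^sub>R b) \<bullet> b) (at z within S)"
proof -
  have "((\<lambda>z. a + z *\<^sub>R b) has_derivative (\<lambda>t. t *\<^sub>R b)) (at z within S)"
    by (auto intro!: derivative_eq_intros)
  moreover have "(f has_derivative (\<lambda>h. grad X f (a + z *\<^sub>R b) \<bullet> h))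
      (at (a + z *\<^sub>R b) within (\<lambda>z. a + z *\<^sub>R b) ` S)"
    using p z by (intro has_derivative_subset[OF has_derivative_grad[OF f]]) auto
  ultimately have "((\<lambda>z. f (a + z *\<^sub>R b)) has_derivative (\<lambda>t. grad X f (a + z *\<^sub>R b) \<bullet> (t *\<^sub>R b)))
      (at z within S)"
    by (rule has_derivative_in_compose)
  then show ?thesis
    by (simp add: has_field_derivative_def mult.commute mult_commute_abs)
qed

section \<open>The law of the interpolation parameter\<close>

definition z_density :: "(real^'d) setting \<Rightarrow> real \<Rightarrow> real" where
  "z_density s z = (case s of
      Monotone \<gamma> \<Rightarrow> \<gamma> * exp (\<gamma> * (z - 1)) / (1 - exp (- \<gamma>))
    | Nonmonotone u \<Rightarrow> 1 / (3 * (1 - z / 2) ^ 3))"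

definition setting_ok :: "(real^'d) setting \<Rightarrow> bool" where
  "setting_ok s = (case s of Monotone \<gamma> \<Rightarrow> 0 < \<gamma> | Nonmonotone u \<Rightarrow> u \<in> cube)"

lemma z_law_eq:
  "z_law s = density lborel (\<lambda>z. ennreal (indicator {0..1} z * z_density s z))"
  by (cases s) (simp_all add: z_density_def)

lemma z_density_nonneg: "setting_ok s \<Longrightarrow> z \<in> {0..1} \<Longrightarrow> 0 \<le> z_density s z"
  by (cases s) (auto simp: z_density_def setting_ok_def intro!: divide_nonneg_nonneg)

lemma continuous_on_z_density: "setting_ok s \<Longrightarrow> continuous_on {0..1} (z_density s)"
  by (cases s) (auto simp: z_density_def setting_ok_def intro!: continuous_intros)

lemma borel_measurable_indicator_continuous:
  fixes g :: "real \<Rightarrow> 'a::euclidean_space"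
  assumes "continuous_on {a..b} g"
  shows "(\<lambda>z. indicator {a..b} z *\<^sub>R g z) \<in> borel_measurable borel"
  using assms by (intro borel_measurable_continuous_on_indicator) auto

lemma measurable_z_weight:
  assumes "setting_ok s"
  shows "(\<lambda>z. indicator {0..1} z * z_density s z) \<in> borel_measurable borel"
  using borel_measurable_indicator_continuous[OF continuous_on_z_density[OF assms]] by simp

lemma sets_z_law [simp, measurable_cong]: "sets (z_law s) = sets borel"
  by (simp add: z_law_eq)

lemma space_z_law [simp]: "space (z_law s) = UNIV"
  by (simp add: z_law_eq)

lemma integral_z_law:
  fixes g :: "real \<Rightarrow> 'a::euclidean_space"
  assumes s: "setting_ok s" and g: "continuous_on {0..1} g"
  shows "(\<integral>z. indicator {0..1} z *\<^sub>R g z \<partial>z_law s)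
    = (\<integral>z. indicator {0..1} z *\<^sub>R (z_density s z *\<^sub>R g z) \<partial>lborel)"
proof -
  have "(\<integral>z. indicator {0..1} z *\<^sub>R g z \<partial>z_law s)
    = (\<integral>z. (indicator {0..1} z * z_density s z) *\<^sub>R (indicator {0..1} z *\<^sub>R g z) \<partial>lborel)"
    unfolding z_law_eq
    using borel_measurable_indicator_continuous[OF g] measurable_z_weight[OF s] z_density_nonneg[OF s]
    by (intro integral_density) (auto simp: indicator_def)
  also have "\<dots> = (\<integral>z. indicator {0..1} z *\<^sub>R (z_density s z *\<^sub>R g z) \<partial>lborel)"
    by (intro Bochner_Integration.integral_cong refl) (simp add: indicator_def)
  finally show ?thesis .
qed

lemma prob_space_z_law:
  assumes s: "setting_ok s"
  shows "prob_space (z_law s)"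
proof
  define F where "F z = (case s of Monotone \<gamma> \<Rightarrow> exp (\<gamma> * (z - 1)) / (1 - exp (- \<gamma>))
     | Nonmonotone u \<Rightarrow> (1 / 3) * inverse ((1 - z / 2)\<^sup>2))" for z :: real
  have dF: "(F has_real_derivative z_density s z) (at z within {0..1})" if "z \<in> {0..1}" for z
  proof (cases s)
    case (Monotone \<gamma>)
    then have "1 - exp (- \<gamma>) \<noteq> 0" using s by (simp add: setting_ok_def)
    then show ?thesis unfolding F_def z_density_def Monotone
      by (auto intro!: derivative_eq_intros)
  next
    case (Nonmonotone u)
    define w where "w = 1 - z / 2"
    have w: "w \<noteq> 0" using that by (auto simp: w_def)
    have "((\<lambda>z. (1 / 3) * inverse ((1 - z / 2)\<^sup>2)) has_real_derivative
        (1 / 3) * - (inverse (w\<^sup>2) * (2 * w * (- 1 / 2)) * inverse (w\<^sup>2))) (at z within {0..1})"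
      using w unfolding w_def by (auto intro!: derivative_eq_intros)
    moreover have "(1 / 3) * - (inverse (w\<^sup>2) * (2 * w * (- 1 / 2)) * inverse (w\<^sup>2)) = 1 / (3 * w ^ 3)"
      using w by (simp add: field_simps power2_eq_square power3_eq_cube)
    ultimately show ?thesis unfolding F_def z_density_def Nonmonotone w_def by simp
  qed
  have F: "F 1 - F 0 = 1"
    using s by (cases s) (auto simp: F_def setting_ok_def diff_divide_distrib[symmetric] power2_eq_square)
  have *: "has_bochner_integral lborel (\<lambda>z. indicator {0..1} z *\<^sub>R z_density s z) (F 1 - F 0)"
    using dF continuous_on_z_density[OF s]
    by (intro has_bochner_integral_FTC_Icc) (auto simp: has_real_derivative_iff_has_vector_derivative)
  have "emeasure (z_law s) (space (z_law s)) = (\<integral>\<^sup>+z. ennreal (indicator {0..1} z * z_density s z) \<partial>lborel)"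
    unfolding z_law_eq using measurable_z_weight[OF s] by (simp add: emeasure_density)
  also have "\<dots> = ennreal (F 1 - F 0)"
    using * z_density_nonneg[OF s]
    by (subst nn_integral_eq_integral) (auto simp: has_bochner_integral_iff indicator_def)
  finally show "emeasure (z_law s) (space (z_law s)) = 1" by (simp add: F)
qed

lemma AE_z_law:
  assumes "setting_ok s" shows "AE z in z_law s. z \<in> {0..1}"
  unfolding z_law_eq using measurable_z_weight[OF assms]
  by (subst AE_density) (auto simp: indicator_def split: if_splits)

text \<open>The form in which the law of \<open>z\<close> is used: a pointwise lower bound of the weighted integrand by a
  derivative gives a lower bound of the integral by boundary values. The indicator keeps the
  integrand measurable, as nothing is known about it outside the unit interval.\<close>

lemma integral_z_law_ge:
  assumes s: "setting_ok s" and g: "continuous_on {0..1} g"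
    and deriv: "\<And>z. z \<in> {0..1} \<Longrightarrow> (F has_real_derivative F' z) (at z within {0..1})"
    and F': "continuous_on {0..1} F'"
    and le: "\<And>z. z \<in> {0..1} \<Longrightarrow> F' z \<le> \<beta> * z_density s z * g z"
  shows "F 1 - F 0 \<le> \<beta> * (\<integral>z. indicator {0..1} z *\<^sub>R g z \<partial>z_law s)"
proof -
  have int: "integrable lborel (\<lambda>z. indicator {0..1} z *\<^sub>R q z)" if "continuous_on {0..1} q" for q :: "real \<Rightarrow> real"
    using borel_integrable_compact[OF _ that] by auto
  have "F 1 - F 0 = (\<integral>z. indicator {0..1} z *\<^sub>R F' z \<partial>lborel)"
    using deriv F'
    by (intro integral_FTC_Icc[symmetric]) (auto simp: has_real_derivative_iff_has_vector_derivative)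
  also have "\<dots> \<le> (\<integral>z. indicator {0..1} z *\<^sub>R (\<beta> * z_density s z * g z) \<partial>lborel)"
    using le by (intro integral_mono int F' continuous_intros continuous_on_z_density s g)
      (auto simp: indicator_def)
  also have "\<dots> = (\<integral>z. \<beta> * (indicator {0..1} z *\<^sub>R (z_density s z *\<^sub>R g z)) \<partial>lborel)"
    by (intro Bochner_Integration.integral_cong refl) (simp add: algebra_simps)
  also have "\<dots> = \<beta> * (\<integral>z. indicator {0..1} z *\<^sub>R g z \<partial>z_law s)"
    using integral_z_law[OF s g] by simp
  finally show ?thesis .
qed

section \<open>Upper linearization\<close>

text \<open>A monotone function cannot have a negative derivative in a nonnegative direction; here the
  direction is known to be admissible only backwards from \<open>a\<close>.\<close>

lemma grad_cube_nonneg_backward: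
  fixes f :: "real^'d \<Rightarrow> real"
  assumes f: "f differentiable_on cube" and mono: "mono_on cube f"
    and a: "a \<in> cube" "a - d \<in> cube" and d: "0 \<le> d"
  shows "0 \<le> grad cube f a \<bullet> d"
proof (rule ccontr)
  assume neg: "\<not> 0 \<le> grad cube f a \<bullet> d"
  have seg: "(a - d) + u *\<^sub>R d \<in> cube" if "u \<in> {0..1}" for u
  proof -
    have "(1 - u) *\<^sub>R (a - d) + u *\<^sub>R a \<in> cube"
      using that a convex_box(1)[of 0 "1::real^'d"]
      by (intro convexD) (auto simp: cube_eq_cbox)
    then show ?thesis by (simp add: algebra_simps)
  qed
  have "((\<lambda>u. f ((a - d) + u *\<^sub>R d)) has_real_derivative grad cube f ((a - d) + 1 *\<^sub>R d) \<bullet> d) (at 1 within {0..1})"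
    by (rule has_real_derivative_along_line[OF f seg]) auto
  then have "((\<lambda>u. f ((a - d) + u *\<^sub>R d)) has_real_derivative grad cube f a \<bullet> d) (at 1 within {0..1})"
    by simp
  then obtain e where e: "e > 0" and
    dec: "\<And>h. h > 0 \<Longrightarrow> 1 - h \<in> {0..1} \<Longrightarrow> h < e \<Longrightarrow> f ((a - d) + 1 *\<^sub>R d) < f ((a - d) + (1 - h) *\<^sub>R d)"
    using has_real_derivative_neg_dec_left[of "\<lambda>u. f ((a - d) + u *\<^sub>R d)" _ 1 "{0..1}"] neg
    by (meson not_le)
  define h where "h = min 1 (e / 2)"
  have h: "h > 0" "1 - h \<in> {0..1}" "h < e" using e by (auto simp: h_def)
  have "(1 - h) *\<^sub>R d \<le> 1 *\<^sub>R d" using h d by (intro scaleR_right_mono) auto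
  then have "f ((a - d) + (1 - h) *\<^sub>R d) \<le> f ((a - d) + 1 *\<^sub>R d)"
    using seg[of 1] seg[OF h(2)] by (intro mono_onD[OF mono]) auto
  then show False using dec[OF h] by simp
qed

lemma mem_cube_iff: "x \<in> cube \<longleftrightarrow> (\<forall>i. 0 \<le> x $ i \<and> x $ i \<le> 1)"
  by (auto simp: less_eq_vec_def)

lemma cubeD: "x \<in> cube \<Longrightarrow> 0 \<le> x $ i" "x \<in> cube \<Longrightarrow> x $ i \<le> 1"
  unfolding mem_cube_iff by auto

lemma cubeI: "(\<And>i. 0 \<le> x $ i) \<Longrightarrow> (\<And>i. x $ i \<le> 1) \<Longrightarrow> x \<in> cube"
  unfolding mem_cube_iff by auto

lemma convex_cube: "convex (cube :: (real^'d) set)"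
  by (simp add: cube_eq_cbox)

lemma weakly_up_concave_sup:
  assumes "weakly_up_concave_on cube \<gamma> f" "0 < \<gamma>" "a \<in> cube" "y \<in> cube"
  shows "\<gamma> * (f (sup y a) - f a) \<le> grad cube f a \<bullet> (sup y a - a)"
proof -
  have "sup y a \<in> cube" using assms(3,4) by (auto intro: le_supI1 le_supI2)
  then have "f (sup y a) - f a \<le> 1 / \<gamma> * (grad cube f a \<bullet> (sup y a - a))"
    using assms by (auto simp: weakly_up_concave_on_def)
  then show ?thesis using assms(2) by (simp add: field_simps)
qed

lemma weakly_up_concave_inf:
  assumes "weakly_up_concave_on cube \<gamma> f" "a \<in> cube" "y \<in> cube"
  shows "\<gamma> * (grad cube f a \<bullet> (a - inf y a)) \<le> f a - f (inf y a)"
proof -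
  have "inf y a \<in> cube" using assms(2,3) by (auto intro: le_infI1 le_infI2)
  then show ?thesis using assms by (auto simp: weakly_up_concave_on_def)
qed

lemma vec_sup_minus: "sup y a - a = y - inf y (a :: real^'d)"
  by (simp add: vec_eq_iff sup_vec_def inf_vec_def sup_real_def inf_real_def max_def min_def)

lemma up_concave_convex_combination:
  assumes f: "weakly_up_concave_on cube 1 f" and y: "y \<in> cube" "q \<in> cube" "y \<le> q" and m: "0 \<le> m" "m \<le> 1"
  shows "(1 - m) * f y + m * f q \<le> f (y + m *\<^sub>R (q - y))"
proof -
  define p where "p = y + m *\<^sub>R (q - y)"
  have p: "p = (1 - m) *\<^sub>R y + m *\<^sub>R q" by (simp add: p_def algebra_simps)
  have "p \<in> cube"
    unfolding p using y m convex_cube by (intro convexD) auto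
  moreover have d1: "p - y = m *\<^sub>R (q - y)" and d2: "q - p = (1 - m) *\<^sub>R (q - y)"
    by (simp_all add: p_def algebra_simps)
  have "0 \<le> p - y" "0 \<le> q - p"
    unfolding d1 d2 using y m by (auto intro!: scaleR_nonneg_nonneg)
  then have "y \<le> p" "p \<le> q" by simp_all
  ultimately have "1 * (grad cube f p \<bullet> (p - y)) \<le> f p - f y" "f q - f p \<le> 1 / 1 * (grad cube f p \<bullet> (q - p))"
    using f y unfolding weakly_up_concave_on_def by blast+
  then have "m * (grad cube f p \<bullet> (q - y)) \<le> f p - f y" "f q - f p \<le> (1 - m) * (grad cube f p \<bullet> (q - y))"
    by (simp_all add: d1 d2)
  then have "(1 - m) * (m * (grad cube f p \<bullet> (q - y))) \<le> (1 - m) * (f p - f y)"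
    "m * (f q - f p) \<le> m * ((1 - m) * (grad cube f p \<bullet> (q - y)))"
    using m by (auto intro: mult_left_mono)
  then show ?thesis unfolding p_def[symmetric] by (simp add: algebra_simps)
qed

text \<open>The segment from \<open>y\<close> to \<open>sup y a\<close> can be prolonged by the factor \<open>1 / m\<close> without leaving the cube.
  Concavity along the prolonged segment, together with nonnegativity at its far end, gives the bound.\<close>

lemma up_concave_sup_lower_bound:
  assumes f: "weakly_up_concave_on cube 1 f" and nonneg: "\<And>x. x \<in> cube \<Longrightarrow> 0 \<le> f x"
    and y: "y \<in> cube" and a: "a \<in> cube" "\<And>i. a $ i \<le> m" and m: "0 \<le> m" "m \<le> 1"
  shows "(1 - m) * f y \<le> f (sup y a)"
proof (cases "m = 0")
  case True
  then have "a \<le> y"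
    using a(2) cubeD(1)[OF y] unfolding less_eq_vec_def by (meson order_trans)
  then have "sup y a = y" by (rule sup_absorb1)
  then show ?thesis using True by simp
next
  case False
  define q where "q = y + (1 / m) *\<^sub>R (sup y a - y)"
  have "q \<in> cube"
  proof (rule cubeI)
    fix i
    have yi: "0 \<le> y $ i" "y $ i \<le> 1" "a $ i \<le> m" using cubeD[OF y] a(2) by auto
    have q_i: "q $ i = y $ i + (max (y $ i) (a $ i) - y $ i) / m"
      by (simp add: q_def sup_vec_def sup_real_def)
    show "0 \<le> q $ i" unfolding q_i using yi m by (auto intro!: add_nonneg_nonneg divide_nonneg_nonneg)
    have "max (y $ i) (a $ i) - y $ i \<le> m * (1 - y $ i)"
    proof (cases "y $ i \<le> a $ i")
      case True
      have "m * y $ i \<le> 1 * y $ i" using yi m by (intro mult_right_mono) auto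
      then show ?thesis using True yi by (simp add: algebra_simps)
    next
      case False
      then show ?thesis using yi m by simp
    qed
    then have "(max (y $ i) (a $ i) - y $ i) / m \<le> 1 - y $ i"
      using False m by (simp add: divide_le_eq mult.commute)
    then show "q $ i \<le> 1" unfolding q_i by simp
  qed
  moreover have "y \<le> q"
    using m by (auto simp: q_def intro!: scaleR_nonneg_nonneg)
  ultimately have "(1 - m) * f y + m * f q \<le> f (y + m *\<^sub>R (q - y))"
    by (intro up_concave_convex_combination f y m)
  also have "y + m *\<^sub>R (q - y) = sup y a"
    using False by (simp add: q_def)
  finally show ?thesis
    using nonneg[OF \<open>q \<in> cube\<close>] m by (smt (verit) mult_nonneg_nonneg)
qed

lemma continuous_on_grad_along_line:
  assumes "continuous_on cube (grad cube f)" "\<And>z. z \<in> {0..1::real} \<Longrightarrow> b + z *\<^sub>R c \<in> cube"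
  shows "continuous_on {0..1} (\<lambda>z. grad cube f (b + z *\<^sub>R c) \<bullet> v)"
  by (intro continuous_intros continuous_on_compose2[OF assms(1)]) (use assms(2) in auto)

text \<open>By monotonicity and weak up-concavity, \<open>\<langle>\<nabla>f(z x), y\<rangle> \<ge> \<gamma> (f y - f(z x))\<close>. Hence
  \<open>e\<^bsup>\<gamma>(z-1)\<^esup> \<langle>\<nabla>f(z x), y - x\<rangle>\<close> is at least the derivative of \<open>e\<^bsup>\<gamma>(z-1)\<^esup> (f y - f(z x))\<close>.\<close>

lemma linearize_monotone:
  fixes f :: "real^'d \<Rightarrow> real"
  assumes \<gamma>: "0 < \<gamma>" and f: "f differentiable_on cube" and cont: "continuous_on cube (grad cube f)"
    and nonneg: "\<And>x. x \<in> cube \<Longrightarrow> 0 \<le> f x" and mono: "mono_on cube f"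
    and wuc: "weakly_up_concave_on cube \<gamma> f" and x: "x \<in> cube" and y: "y \<in> cube"
  shows "(1 - exp (- \<gamma>)) * f y - f x \<le> (1 - exp (- \<gamma>)) / \<gamma> *
    (\<integral>z. indicator {0..1} z *\<^sub>R (grad cube f (z *\<^sub>R x) \<bullet> (y - x)) \<partial>z_law (Monotone \<gamma> :: (real^'d) setting))"
proof -
  let ?s = "Monotone \<gamma> :: (real^'d) setting"
  have s: "setting_ok ?s" using \<gamma> by (simp add: setting_ok_def)
  have zx: "0 + z *\<^sub>R x \<in> cube" if "z \<in> {0..1}" for z
    using that cubeD[OF x] by (intro cubeI) (auto simp: mult_le_one)
  note c = continuous_on_grad_along_line[OF cont zx, simplified]
  have cf: "continuous_on {0..1} (\<lambda>z. f (z *\<^sub>R x))"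
    by (intro continuous_intros continuous_on_compose2[OF differentiable_imp_continuous_on[OF f]])
      (use zx in auto)
  have df: "((\<lambda>z. f (z *\<^sub>R x)) has_real_derivative grad cube f (z *\<^sub>R x) \<bullet> x) (at z within {0..1})"
    if "z \<in> {0..1}" for z
    using has_real_derivative_along_line[OF f zx that] by simp
  define F where "F z = exp (\<gamma> * (z - 1)) * (f y - f (z *\<^sub>R x))" for z
  define F' where "F' z = exp (\<gamma> * (z - 1)) * (\<gamma> * (f y - f (z *\<^sub>R x)) - grad cube f (z *\<^sub>R x) \<bullet> x)" for z
  have "F 1 - F 0 \<le> (1 - exp (- \<gamma>)) / \<gamma> *
      (\<integral>z. indicator {0..1} z *\<^sub>R (grad cube f (z *\<^sub>R x) \<bullet> (y - x)) \<partial>z_law ?s)"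
  proof (rule integral_z_law_ge[OF s c])
    show "continuous_on {0..1} F'"
      unfolding F'_def by (intro continuous_intros cf c)
    show "(F has_real_derivative F' z) (at z within {0..1})" if "z \<in> {0..1}" for z
      unfolding F_def F'_def using that
      by (auto intro!: derivative_eq_intros df simp: algebra_simps)
    show "F' z \<le> (1 - exp (- \<gamma>)) / \<gamma> * z_density ?s z * (grad cube f (z *\<^sub>R x) \<bullet> (y - x))"
      if z: "z \<in> {0..1}" for z
    proof -
      let ?a = "z *\<^sub>R x"
      have a: "?a \<in> cube" using zx[OF z] by simp
      have sup: "sup y ?a \<in> cube" using y a by (auto intro: le_supI1 le_supI2)
      have "\<gamma> * (f y - f ?a) \<le> \<gamma> * (f (sup y ?a) - f ?a)"
        using \<gamma> mono_onD[OF mono y sup] by (intro mult_left_mono) auto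
      also have "\<dots> \<le> grad cube f ?a \<bullet> (y - inf y ?a)"
        using weakly_up_concave_sup[OF wuc \<gamma> a y] by (simp add: vec_sup_minus)
      also have "\<dots> \<le> grad cube f ?a \<bullet> y"
      proof -
        have "?a - inf y ?a \<in> cube"
        proof (rule cubeI)
          fix i
          have "(?a - inf y ?a) $ i = ?a $ i - min (y $ i) (?a $ i)"
            by (simp add: inf_vec_def inf_real_def)
          then show "0 \<le> (?a - inf y ?a) $ i" "(?a - inf y ?a) $ i \<le> 1"
            using cubeD[OF y, of i] cubeD[OF a, of i] by linarith+
        qed
        moreover have "0 \<le> inf y ?a" using a y by auto
        ultimately have "0 \<le> grad cube f ?a \<bullet> inf y ?a"
          by (intro grad_cube_nonneg_backward f mono a)
        then show ?thesis by (simp add: inner_diff_right)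
      qed
      finally have "\<gamma> * (f y - f ?a) - grad cube f ?a \<bullet> x \<le> grad cube f ?a \<bullet> (y - x)"
        by (simp add: inner_diff_right)
      moreover have "1 - exp (- \<gamma>) \<noteq> 0" using \<gamma> by simp
      then have "(1 - exp (- \<gamma>)) / \<gamma> * z_density ?s z = exp (\<gamma> * (z - 1))"
        using \<gamma> by (simp add: z_density_def)
      ultimately show ?thesis
        unfolding F'_def by (simp add: mult_left_mono)
    qed
  qed
  moreover have "(0::real^'d) \<in> cube" by (rule cubeI) simp_all
  then have "0 \<le> exp (- \<gamma>) * f 0" by (intro mult_nonneg_nonneg nonneg) simp_all
  ultimately show ?thesis by (simp add: F_def algebra_simps)
qed

text \<open>Write \<open>x\<^sub>z = u + (z/2)(x - u)\<close> and \<open>c = 1 - infnorm u\<close>. Splitting \<open>y - x\<^sub>z\<close> into its positive and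
  negative part and using up-concavity for each gives
  \<open>\<langle>\<nabla>f(x\<^sub>z), y - x\<^sub>z\<rangle> \<ge> f (sup y x\<^sub>z) - 2 f x\<^sub>z \<ge> (1 - z/2) c f y - 2 f x\<^sub>z\<close>, while \<open>x - x\<^sub>z\<close> is
  \<open>2 (1 - z/2)\<close> times the velocity of the path. Multiplied by \<open>(1 - z/2)\<^sup>-\<^sup>3\<close>, the resulting lower bound
  is an exact derivative.\<close>

lemma linearize_nonmonotone:
  fixes f :: "real^'d \<Rightarrow> real"
  assumes u: "u \<in> cube" and f: "f differentiable_on cube" and cont: "continuous_on cube (grad cube f)"
    and nonneg: "\<And>x. x \<in> cube \<Longrightarrow> 0 \<le> f x"
    and uc: "weakly_up_concave_on cube 1 f" and x: "x \<in> cube" and y: "y \<in> cube"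
  shows "(1 - infnorm u) / 4 * f y - f ((1 / 2) *\<^sub>R (x + u)) \<le> 3 / 8 *
    (\<integral>z. indicator {0..1} z *\<^sub>R (grad cube f (u + z *\<^sub>R ((1 / 2) *\<^sub>R (x - u))) \<bullet> (y - x)) \<partial>z_law (Nonmonotone u))"
proof -
  let ?s = "Nonmonotone u"
  define c where "c = 1 - infnorm u"
  define d where "d = (1 / 2) *\<^sub>R (x - u)"
  have s: "setting_ok ?s" using u by (simp add: setting_ok_def)
  have u_le: "u $ i \<le> infnorm u" for i using component_le_infnorm_cart[of u i] by simp
  have inf1: "infnorm u \<le> 1"
    unfolding infnorm_cart using cubeD[OF u] by (intro cSup_least) auto
  have path: "u + z *\<^sub>R d = (1 - z / 2) *\<^sub>R u + (z / 2) *\<^sub>R x" for z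
    by (simp add: d_def algebra_simps)
  have p: "u + z *\<^sub>R d \<in> cube" if "z \<in> {0..1}" for z
    unfolding path using that u x convex_cube by (intro convexD) auto
  note cg = continuous_on_grad_along_line[OF cont p, simplified]
  have cf: "continuous_on {0..1} (\<lambda>z. f (u + z *\<^sub>R d))"
    by (intro continuous_intros continuous_on_compose2[OF differentiable_imp_continuous_on[OF f]])
      (use p in auto)
  note df = has_real_derivative_along_line[OF f p]
  define F where "F z = (1 / 4) * (c * f y * inverse (1 - z / 2) - inverse ((1 - z / 2)\<^sup>2) * f (u + z *\<^sub>R d))" for z
  define F' where "F' z = (1 / 8) * inverse ((1 - z / 2) ^ 3) * ((1 - z / 2) * c * f y - 2 * f (u + z *\<^sub>R d)
      - 2 * (1 - z / 2) * (grad cube f (u + z *\<^sub>R d) \<bullet> d))" for z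
  have "F 1 - F 0 \<le> 3 / 8 *
      (\<integral>z. indicator {0..1} z *\<^sub>R (grad cube f (u + z *\<^sub>R d) \<bullet> (y - x)) \<partial>z_law ?s)"
  proof (rule integral_z_law_ge[OF s cg])
    show "continuous_on {0..1} F'"
      unfolding F'_def by (intro continuous_intros cf cg) auto
    show "(F has_real_derivative F' z) (at z within {0..1})" if z: "z \<in> {0..1}" for z
    proof -
      define w where "w = 1 - z / 2"
      have w: "w \<noteq> 0" using z by (auto simp: w_def)
      have "(F has_real_derivative (1 / 4) * (c * f y * - (inverse w * (- 1 / 2) * inverse w)
          - (- (inverse (w\<^sup>2) * (2 * w * (- 1 / 2)) * inverse (w\<^sup>2)) * f (u + z *\<^sub>R d)
            + grad cube f (u + z *\<^sub>R d) \<bullet> d * inverse (w\<^sup>2)))) (at z within {0..1})"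
        unfolding F_def w_def using z w[unfolded w_def]
        by (auto intro!: derivative_eq_intros df)
      moreover have "(1 / 4) * (c * Y * - (inverse w * (- 1 / 2) * inverse w)
          - (- (inverse (w\<^sup>2) * (2 * w * (- 1 / 2)) * inverse (w\<^sup>2)) * Z + D * inverse (w\<^sup>2)))
        = (1 / 8) * inverse (w ^ 3) * (w * c * Y - 2 * Z - 2 * w * D)" for Y Z D
        using w by (simp add: field_simps power2_eq_square power3_eq_cube)
      ultimately show ?thesis unfolding F'_def w_def[symmetric] by (simp only:)
    qed
    show "F' z \<le> 3 / 8 * z_density ?s z * (grad cube f (u + z *\<^sub>R d) \<bullet> (y - x))"
      if z: "z \<in> {0..1}" for z
    proof -
      define w where "w = 1 - z / 2"
      have w: "1 / 2 \<le> w" "w \<le> 1" using z by (auto simp: w_def)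
      let ?a = "u + z *\<^sub>R d" let ?g = "grad cube f ?a"
      have a: "?a \<in> cube" by (rule p[OF z])
      have a_le: "?a $ i \<le> 1 - w * c" for i
      proof -
        have "?a $ i = w * u $ i + (1 - w) * x $ i"
          unfolding path by (simp add: w_def)
        also have "\<dots> \<le> w * infnorm u + (1 - w) * 1"
          using w u_le[of i] cubeD[OF x] by (intro add_mono mult_left_mono) auto
        finally show ?thesis by (simp add: c_def algebra_simps)
      qed
      have c01: "0 \<le> c" "c \<le> 1" using inf1 infnorm_pos_le[of u] by (auto simp: c_def)
      have wc: "0 \<le> w * c" "w * c \<le> 1" using w c01 mult_le_one[of w c] by auto
      have "w * c * f y \<le> f (sup y ?a)"
        using up_concave_sup_lower_bound[OF uc nonneg y a a_le] wc by simp
      moreover have "f (sup y ?a) - f ?a \<le> ?g \<bullet> (y - inf y ?a)"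
        using weakly_up_concave_sup[OF uc _ a y] by (simp add: vec_sup_minus)
      moreover have "?g \<bullet> (?a - inf y ?a) \<le> f ?a - f (inf y ?a)"
        using weakly_up_concave_inf[OF uc a y] by simp
      moreover have "0 \<le> f (inf y ?a)"
        using a y by (intro nonneg) (auto intro: le_infI1 le_infI2)
      moreover have "x - ?a = (2 * w) *\<^sub>R d"
        by (simp add: vec_eq_iff path d_def w_def field_simps)
      then have "?g \<bullet> (x - ?a) = ?g \<bullet> ((2 * w) *\<^sub>R d)" by (rule arg_cong)
      then have "?g \<bullet> x = ?g \<bullet> ?a + 2 * w * (?g \<bullet> d)"
        unfolding inner_diff_right inner_scaleR_right by linarith
      ultimately have "w * c * f y - 2 * f ?a - 2 * w * (?g \<bullet> d) \<le> ?g \<bullet> (y - x)"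
        unfolding inner_diff_right by linarith
      then have "(1 / 8) * inverse (w ^ 3) * (w * c * f y - 2 * f ?a - 2 * w * (?g \<bullet> d))
          \<le> (1 / 8) * inverse (w ^ 3) * (?g \<bullet> (y - x))"
        using w by (intro mult_left_mono) auto
      moreover have "3 / 8 * z_density ?s z = (1 / 8) * inverse (w ^ 3)"
        by (simp add: z_density_def w_def inverse_eq_divide)
      ultimately show ?thesis
        unfolding F'_def w_def[symmetric] by (simp only:)
    qed
  qed
  moreover have "F 1 - F 0 = c / 4 * f y - f (u + d) + f u / 4"
  proof -
    have "F 1 = (1 / 4) * (c * f y * 2 - 4 * f (u + d))" "F 0 = (1 / 4) * (c * f y - f u)"
      by (simp_all add: F_def power2_eq_square)
    then show ?thesis by (simp add: algebra_simps)
  qed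
  moreover have "u + d = (1 / 2) *\<^sub>R (x + u)"
    by (simp add: vec_eq_iff d_def field_simps)
  ultimately show ?thesis
    using nonneg[OF u] by (simp add: c_def d_def)
qed

text \<open>The constants that turn the density of \<open>z\<close> into the weights \<open>e\<^bsup>\<gamma>(z-1)\<^esup>\<close> and \<open>1 / (8 (1 - z/2)\<^sup>3)\<close>.\<close>

primrec lin_coeff :: "(real^'d) setting \<Rightarrow> real" where
  "lin_coeff (Monotone \<gamma>) = (1 - exp (- \<gamma>)) / \<gamma>"
| "lin_coeff (Nonmonotone u) = 3 / 8"

lemma lin_coeff_bounds:
  assumes "setting_ok s"
  shows "0 \<le> lin_coeff s" "lin_coeff s \<le> 1"
proof -
  have "0 \<le> lin_coeff s \<and> lin_coeff s \<le> 1"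
  proof (cases s)
    case (Monotone \<gamma>)
    then show ?thesis
      using assms exp_ge_add_one_self[of "- \<gamma>"] by (simp add: setting_ok_def divide_le_eq)
  qed simp
  then show "0 \<le> lin_coeff s" "lin_coeff s \<le> 1" by auto
qed

definition order_conditions :: "(real^'d) setting \<Rightarrow> (real^'d \<Rightarrow> real) \<Rightarrow> bool" where
  "order_conditions s f \<longleftrightarrow> (\<forall>x\<in>cube. 0 \<le> f x) \<and>
     (case s of Monotone \<gamma> \<Rightarrow> mono_on cube f \<and> weakly_up_concave_on cube \<gamma> f
      | Nonmonotone u \<Rightarrow> weakly_up_concave_on cube 1 f)"

lemma upper_linearization:
  fixes f :: "real^'d \<Rightarrow> real"
  assumes s: "setting_ok s" and f: "f differentiable_on cube" and cont: "continuous_on cube (grad cube f)"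
    and ord: "order_conditions s f" and x: "x \<in> cube" and y: "y \<in> cube"
  shows "approx_ratio s * f y - f (h_map s x) \<le> lin_coeff s *
    (\<integral>z. indicator {0..1} z *\<^sub>R (grad cube f (w_map s x z) \<bullet> (y - x)) \<partial>z_law s)"
proof (cases s)
  case (Monotone \<gamma>)
  then show ?thesis
    using linearize_monotone[OF _ f cont _ _ _ x y, of \<gamma>] s ord by (auto simp: setting_ok_def order_conditions_def)
next
  case (Nonmonotone u)
  have "w_map s x z = u + z *\<^sub>R ((1 / 2) *\<^sub>R (x - u))" for z
    unfolding Nonmonotone by (simp add: algebra_simps)
  moreover have "u \<in> cube" "\<And>x. x \<in> cube \<Longrightarrow> 0 \<le> f x" "weakly_up_concave_on cube 1 f"
    using s ord Nonmonotone by (auto simp: setting_ok_def order_conditions_def)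
  ultimately show ?thesis
    using linearize_nonmonotone[OF _ f cont _ _ x y, of u] Nonmonotone
    by (simp del: w_map.simps z_law.simps)
qed

section \<open>Consensus under perturbed mixing\<close>

lemma norm_convex_combination_squared_le:
  fixes w :: "'n::finite \<Rightarrow> 'a::real_inner" and a :: "'n \<Rightarrow> real"
  assumes a: "\<And>i. 0 \<le> a i" "(\<Sum>i\<in>UNIV. a i) = 1"
  shows "(norm (\<Sum>i\<in>UNIV. a i *\<^sub>R w i))\<^sup>2 \<le> (\<Sum>i\<in>UNIV. a i * (norm (w i))\<^sup>2)"
proof -
  define c where "c = (\<Sum>i\<in>UNIV. a i *\<^sub>R w i)"
  have sq: "(norm (w i - c))\<^sup>2 = (norm (w i))\<^sup>2 - 2 * (w i \<bullet> c) + (norm c)\<^sup>2" for i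
    unfolding power2_norm_eq_inner by (simp add: inner_diff inner_commute)
  have "0 \<le> (\<Sum>i\<in>UNIV. a i * (norm (w i - c))\<^sup>2)"
    using a by (intro sum_nonneg mult_nonneg_nonneg) auto
  also have "\<dots> = (\<Sum>i\<in>UNIV. a i * ((norm (w i))\<^sup>2 - 2 * (w i \<bullet> c) + (norm c)\<^sup>2))"
    by (simp only: sq)
  also have "(\<Sum>i\<in>UNIV. a i * ((norm (w i))\<^sup>2 - 2 * (w i \<bullet> c) + (norm c)\<^sup>2))
      = (\<Sum>i\<in>UNIV. a i * (norm (w i))\<^sup>2) - 2 * (\<Sum>i\<in>UNIV. (a i *\<^sub>R w i) \<bullet> c) + (\<Sum>i\<in>UNIV. a i) * (norm c)\<^sup>2"
    by (simp add: algebra_simps sum.distrib sum_subtractf sum_distrib_left sum_distrib_right)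
  also have "(\<Sum>i\<in>UNIV. (a i *\<^sub>R w i) \<bullet> c) = (norm c)\<^sup>2"
    unfolding inner_sum_left[symmetric] c_def[symmetric] by (simp add: power2_norm_eq_inner)
  finally show ?thesis using a(2) by (simp add: c_def)
qed

lemma norm_convex_combination_le:
  fixes w :: "'n::finite \<Rightarrow> 'a::real_normed_vector" and a :: "'n \<Rightarrow> real"
  assumes a: "\<And>i. 0 \<le> a i" "(\<Sum>i\<in>UNIV. a i) = 1" and w: "\<And>i. norm (w i) \<le> c"
  shows "norm (\<Sum>i\<in>UNIV. a i *\<^sub>R w i) \<le> c"
proof -
  have "norm (\<Sum>i\<in>UNIV. a i *\<^sub>R w i) \<le> (\<Sum>i\<in>UNIV. a i * c)"
    using a w by (intro sum_norm_le) (auto intro: mult_left_mono)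
  also have "\<dots> = c" using a(2) by (simp add: sum_distrib_right[symmetric])
  finally show ?thesis .
qed

lemma L2_set_norm_triangle:
  fixes u v :: "'n \<Rightarrow> 'a::real_normed_vector"
  shows "L2_set (\<lambda>i. norm (u i + v i)) S \<le> L2_set (\<lambda>i. norm (u i)) S + L2_set (\<lambda>i. norm (v i)) S"
proof -
  have "L2_set (\<lambda>i. norm (u i + v i)) S \<le> L2_set (\<lambda>i. norm (u i) + norm (v i)) S"
    by (intro L2_set_mono norm_triangle_ineq) auto
  also have "\<dots> \<le> L2_set (\<lambda>i. norm (u i)) S + L2_set (\<lambda>i. norm (v i)) S"
    by (rule L2_set_triangle_ineq)
  finally show ?thesis .
qed

text \<open>The deviations from the network average form a vector orthogonal to the constants. Each step
  contracts it by the second eigenvalue and adds at most \<open>2 \<rho>\<close> per agent, whence a geometric series.\<close>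

lemma consensus_bound:
  fixes A :: "real^'n^'n" and x :: "nat \<Rightarrow> 'n \<Rightarrow> 'a::euclidean_space"
  assumes sym: "transpose A = A" and rows: "\<And>i. (\<Sum>j\<in>UNIV. A $ i $ j) = 1"
    and lam: "lambda2 A < 1"
    and init: "\<And>i j. x 0 i = x 0 j"
    and step: "\<And>m i. m < n \<Longrightarrow> norm (x (Suc m) i - (\<Sum>j\<in>UNIV. A $ i $ j *\<^sub>R x m j)) \<le> \<rho>"
    and m: "m \<le> n" and \<rho>: "0 \<le> \<rho>"
  shows "norm (x m i - x m j) \<le> 4 * sqrt CARD('n) * \<rho> / (1 - lambda2 A)"
proof -
  define avg where "avg y = (1 / CARD('n)) *\<^sub>R (\<Sum>i\<in>UNIV. y i)" for y :: "'n \<Rightarrow> 'a"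
  define D where "D m = L2_set (\<lambda>i. norm (x m i - avg (x m))) UNIV" for m
  define b where "b = 2 * sqrt CARD('n) * \<rho>"
  have b0: "0 \<le> b" using \<rho> by (simp add: b_def)
  have lam0: "0 \<le> lambda2 A" by (rule lambda2_nonneg[OF sym])
  have sum_avg: "(\<Sum>i\<in>UNIV. y i - avg y) = 0" for y
    by (simp add: avg_def sum_subtractf sum_constant_scaleR)
  have cols: "(\<Sum>i\<in>UNIV. A $ i $ j) = 1" for j
  proof -
    have "A $ i $ j = A $ j $ i" for i
      using arg_cong[OF sym, of "\<lambda>B. B $ i $ j"] by (simp add: transpose_def)
    then show ?thesis using rows[of j] by simp
  qed
  have D_le: "D m \<le> b / (1 - lambda2 A)" if "m \<le> n" for m
    using that
  proof (induction m)
    case 0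
    have "avg (x 0) = x 0 i" for i
    proof -
      have "(\<Sum>j\<in>UNIV. x 0 j) = (\<Sum>j\<in>(UNIV::'n set). x 0 i)"
        by (intro sum.cong init refl)
      then show ?thesis by (simp add: avg_def sum_constant_scaleR)
    qed
    then have "D 0 = 0" by (simp add: D_def L2_set_def)
    then show ?case using b0 lam by simp
  next
    case (Suc m)
    define e where "e i = x (Suc m) i - (\<Sum>j\<in>UNIV. A $ i $ j *\<^sub>R x m j)" for i
    have e: "norm (e i) \<le> \<rho>" for i
      using step[of m i] Suc.prems by (simp add: e_def)
    have avg_e: "norm (avg e) \<le> \<rho>"
    proof -
      have "norm (\<Sum>i\<in>UNIV. e i) \<le> (\<Sum>i\<in>(UNIV::'n set). \<rho>)" by (intro sum_norm_le e)
      then show ?thesis by (simp add: avg_def field_simps)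
    qed
    have avg_step: "avg (x (Suc m)) = avg (x m) + avg e"
    proof -
      have "(\<Sum>i\<in>UNIV. \<Sum>j\<in>UNIV. A $ i $ j *\<^sub>R x m j) = (\<Sum>j\<in>UNIV. x m j)"
        by (subst sum.swap) (simp add: scaleR_sum_left[symmetric] cols)
      then have "(\<Sum>i\<in>UNIV. x (Suc m) i) = (\<Sum>j\<in>UNIV. x m j) + (\<Sum>i\<in>UNIV. e i)"
        by (simp add: e_def sum_subtractf)
      then show ?thesis by (simp add: avg_def scaleR_add_right)
    qed
    define y where "y i = x m i - avg (x m)" for i
    have x_step: "x (Suc m) i - avg (x (Suc m)) = (\<Sum>j\<in>UNIV. A $ i $ j *\<^sub>R y j) + (e i - avg e)" for i
    proof -
      have "(\<Sum>j\<in>UNIV. A $ i $ j *\<^sub>R y j) = (\<Sum>j\<in>UNIV. A $ i $ j *\<^sub>R x m j) - avg (x m)"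
        by (simp add: y_def scaleR_diff_right sum_subtractf scaleR_sum_left[symmetric] rows)
      then show ?thesis by (simp add: avg_step e_def)
    qed
    have "D (Suc m) \<le> L2_set (\<lambda>i. norm (\<Sum>j\<in>UNIV. A $ i $ j *\<^sub>R y j)) UNIV
        + L2_set (\<lambda>i. norm (e i - avg e)) UNIV"
      unfolding D_def x_step by (rule L2_set_norm_triangle)
    also have "L2_set (\<lambda>i. norm (\<Sum>j\<in>UNIV. A $ i $ j *\<^sub>R y j)) UNIV \<le> lambda2 A * D m"
    proof -
      have "(\<Sum>i\<in>UNIV. (norm (\<Sum>j\<in>UNIV. A $ i $ j *\<^sub>R y j))\<^sup>2)
          \<le> (lambda2 A)\<^sup>2 * (\<Sum>i\<in>UNIV. (norm (y i))\<^sup>2)"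
        by (rule sum_norm_squared_mix_le[OF sym rows]) (simp add: y_def sum_avg)
      then have "sqrt (\<Sum>i\<in>UNIV. (norm (\<Sum>j\<in>UNIV. A $ i $ j *\<^sub>R y j))\<^sup>2)
          \<le> sqrt ((lambda2 A)\<^sup>2 * (\<Sum>i\<in>UNIV. (norm (y i))\<^sup>2))"
        by (rule real_sqrt_le_mono)
      then show ?thesis
        using lam0 by (simp add: L2_set_def D_def y_def real_sqrt_mult)
    qed
    also have "L2_set (\<lambda>i. norm (e i - avg e)) UNIV \<le> b"
    proof -
      have "norm (e i - avg e) \<le> 2 * \<rho>" for i
        using norm_triangle_ineq4[of "e i" "avg e"] e[of i] avg_e by linarith
      then have "L2_set (\<lambda>i. norm (e i - avg e)) UNIV \<le> L2_set (\<lambda>i. 2 * \<rho>) (UNIV :: 'n set)"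
        by (intro L2_set_mono) auto
      also have "\<dots> = b" using \<rho> by (simp add: L2_set_def b_def real_sqrt_mult)
      finally show ?thesis .
    qed
    also have "lambda2 A * D m + b \<le> lambda2 A * (b / (1 - lambda2 A)) + b"
      using Suc lam0 by (intro add_mono mult_left_mono) auto
    also have "\<dots> = b / (1 - lambda2 A)" using lam by (simp add: field_simps)
    finally show ?case by simp
  qed
  have "norm (x m i - avg (x m)) \<le> D m" for i
    unfolding D_def using member_le_L2_set[of UNIV i "\<lambda>i. norm (x m i - avg (x m))"] by simp
  then have "norm (x m i - x m j) \<le> D m + D m"
    using norm_triangle_ineq4[of "x m i - avg (x m)" "x m j - avg (x m)"]
    by (smt (verit) diff_diff_eq2 diff_add_cancel add_diff_cancel_right' diff_add_eq)
  also have "\<dots> \<le> b / (1 - lambda2 A) + b / (1 - lambda2 A)"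
    by (intro add_mono D_le m)
  also have "\<dots> = 4 * sqrt CARD('n) * \<rho> / (1 - lambda2 A)"
    by (simp add: b_def add_divide_distrib[symmetric])
  finally show ?thesis .
qed

section \<open>Invariants of the algorithm\<close>

locale bandit =
  fixes P :: "('n::finite, 'd::finite, 's) problem" and \<gamma> G M B0 :: real
  assumes region: "region_ok P" and network: "network_ok P" and spectral_gap: "lambda2 (weights P) < 1"
    and parameters: "parameters_ok P" and case_conditions: "case_ok \<gamma> P" and regular: "regular_ok G M P"
    and responses: "oracle_ok B0 P" and projection: "projection_ok P"
begin

abbreviation "R \<equiv> max_norm P"
abbreviation "r \<equiv> radius P"
abbreviation "\<delta> \<equiv> par_delta P"
abbreviation "\<eta> \<equiv> par_eta P"
abbreviation "K \<equiv> par_K P"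
abbreviation "L \<equiv> par_L P"
abbreviation "T \<equiv> horizon P"
abbreviation "U \<equiv> directions P"
abbreviation "k \<equiv> dim U"
abbreviation "X s m i \<equiv> x_pos (run_alg P s m) i"
abbreviation "Y s m i \<equiv> y_pos (run_alg P s m) i"

text \<open>The square root of the error tolerance: the length scale on which the states of the agents differ.\<close>

definition root_tol :: real where "root_tol = real K * \<eta> / \<delta>"

text \<open>One-point estimates have norm at most \<open>est_bound / \<delta>\<close>. The absolute value keeps this nonnegative when
  there are no rounds, in which case nothing relates \<open>B0\<close> to a response.\<close>

definition est_bound :: real where "est_bound = real k * \<bar>B0\<bar>"

text \<open>A bound for the distance of two agents in units of \<open>root_tol\<close>: the positions follow the mixing
  dynamics up to \<open>(4 + est_bound) * root_tol\<close> per block.\<close>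

definition spread :: real where "spread = 4 * sqrt CARD('n) * (4 + est_bound) / (1 - lambda2 (weights P))"

definition sample_range :: "nat \<Rightarrow> nat \<Rightarrow> ('d, 's) sample set" where
  "sample_range m q = (sphere 0 1 \<inter> U) \<times> {0..1} \<times> window P m q \<times> space (seed_law P)"

definition admissible :: "('n, 'd, 's) samples \<Rightarrow> bool" where
  "admissible s \<longleftrightarrow> (\<forall>m\<in>{1..blocks P}. \<forall>q\<in>{1..K}. \<forall>i. s (m, q, i) \<in> sample_range m q)"

definition block_estimate :: "('n, 'd, 's) samples \<Rightarrow> nat \<Rightarrow> 'n \<Rightarrow> real^'d" where
  "block_estimate s m i = (\<Sum>q=1..K. estimate P i (X s m i) (s (Suc m, q, i)))"

lemma pos: "0 < K" "0 < L" "0 < \<eta>" "0 < \<delta>" "\<delta> < r" "0 < r"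
  using parameters by (auto simp: parameters_ok_def)

lemma root_tol_pos: "0 < root_tol"
  using pos by (simp add: root_tol_def)

lemma tolerance_eq: "tolerance P = root_tol\<^sup>2"
  by (simp add: tolerance_def root_tol_def power_mult_distrib power_divide)

lemma est_bound_nonneg: "0 \<le> est_bound" by (simp add: est_bound_def)

lemma spread_nonneg: "0 \<le> spread"
  using spectral_gap est_bound_nonneg by (simp add: spread_def)

lemma horizon_eq: "T = blocks P * (K * L)"
  using parameters by (auto simp: blocks_def parameters_ok_def mult.commute)

lemma real_horizon_eq: "real T = real (blocks P) * (real K * real L)"
  by (subst horizon_eq) simp

lemma region_facts: "convex (region P)" "compact (region P)" "region P \<subseteq> cube" "center P \<in> region P"
  using region rel_interior_subset[of "region P"] by (auto simp: region_ok_def)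

lemma norm_le_R: "x \<in> region P \<Longrightarrow> norm x \<le> R"
  unfolding max_norm_def
proof (rule cSUP_upper)
  show "bdd_above (norm ` region P)"
    using compact_imp_bounded[OF region_facts(2)] by (auto simp: bounded_iff bdd_above_def)
qed

lemma R_nonneg: "0 \<le> R"
  using norm_le_R[OF region_facts(4)] norm_ge_zero[of "center P"] by linarith

lemma shrunk_subset: "shrunk P \<subseteq> region P"
  unfolding shrunk_def using pos region_facts
  by (auto intro!: convexD)

lemma convex_shrunk: "convex (shrunk P)"
proof -
  have "shrunk P = (\<lambda>x. (\<delta> / r) *\<^sub>R center P + x) ` ((\<lambda>x. (1 - \<delta> / r) *\<^sub>R x) ` region P)"
    by (simp add: shrunk_def image_image add.commute)
  then show ?thesis
    using region_facts(1) by (simp add: convex_scaling convex_translation)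
qed

lemma center_in_shrunk: "center P \<in> shrunk P"
  unfolding shrunk_def using region_facts(4)
  by (auto simp: image_iff scaleR_add_left[symmetric] intro!: bexI[of _ "center P"])

lemma subspace_directions: "subspace U"
  unfolding directions_def using region_facts(4)
  by (intro affine_diffs_subspace_subtract[where S = "affine hull region P", simplified]) (auto simp: hull_inc)

lemma diff_in_directions:
  assumes "x \<in> region P" "y \<in> region P" shows "x - y \<in> U"
proof -
  have "x - center P \<in> U" "y - center P \<in> U"
    unfolding directions_def using assms by (auto simp: hull_inc)
  then have "(x - center P) - (y - center P) \<in> U" by (rule subspace_diff[OF subspace_directions])
  then show ?thesis by simp
qed

lemma setting_points:
  "case setting P of Monotone g \<Rightarrow> g = \<gamma> \<and> 0 < \<gamma> \<and> 0 \<in> region P | Nonmonotone u \<Rightarrow> u \<in> region P"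
  using case_conditions by (auto simp: case_ok_def split: setting.splits)

lemma setting_ok: "setting_ok (setting P)"
  using setting_points region_facts(3) by (auto simp: setting_ok_def split: setting.splits simp del: atLeastAtMost_iff)

lemma w_map_in_region:
  assumes x: "x \<in> region P" and z: "z \<in> {0..1}"
  shows "w_map (setting P) x z \<in> region P"
proof (cases "setting P")
  case (Monotone g)
  have "(1 - z) *\<^sub>R 0 + z *\<^sub>R x \<in> region P"
    using setting_points Monotone x z region_facts(1) by (intro convexD) auto
  then show ?thesis using Monotone by simp
next
  case (Nonmonotone u)
  have "(1 - z / 2) *\<^sub>R u + (z / 2) *\<^sub>R x \<in> region P"
    using setting_points Nonmonotone x z region_facts(1) by (intro convexD) auto
  then show ?thesis using Nonmonotone by (simp add: algebra_simps)
qed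

lemma h_map_in_region:
  assumes x: "x \<in> region P" shows "h_map (setting P) x \<in> region P"
proof (cases "setting P")
  case (Nonmonotone u)
  have "(1 / 2) *\<^sub>R x + (1 / 2) *\<^sub>R u \<in> region P"
    using setting_points Nonmonotone x region_facts(1) by (intro convexD) auto
  then show ?thesis using Nonmonotone by (simp add: algebra_simps)
qed (use x in simp)

lemma query_point_in_fdom:
  assumes "x \<in> region P" "a \<in> sample_range m q"
  shows "query_point P x a \<in> fdom P"
  using assms regular w_map_in_region[of x]
  by (auto simp: sample_range_def query_point_def regular_ok_def)

lemma window_subset:
  assumes "m \<in> {1..blocks P}" "q \<in> {1..K}"
  shows "window P m q \<subseteq> {1..T}"
proof
  fix t assume t: "t \<in> window P m q"
  obtain m' where m: "m = Suc m'" "m' < blocks P" using assms by (cases m) auto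
  have "1 \<le> t" using t by (auto simp: window_def)
  have "t \<le> m' * K * L + q * L" using t m by (auto simp: window_def)
  also have "m' * K * L + q * L \<le> m' * K * L + K * L" using assms by simp
  also have "\<dots> = Suc m' * (K * L)" by simp
  also have "\<dots> \<le> blocks P * (K * L)" using m by (intro mult_right_mono) auto
  finally show "t \<in> {1..T}" using \<open>1 \<le> t\<close> horizon_eq by auto
qed

lemma response_bounded:
  assumes "t \<in> {1..T}" "x \<in> fdom P" "\<xi> \<in> space (seed_law P)"
  shows "\<bar>response P t i x \<xi>\<bar> \<le> \<bar>B0\<bar>"
proof -
  have "\<bar>response P t i x \<xi>\<bar> \<le> B0"
    using responses assms unfolding oracle_ok_def by blast
  then show ?thesis by linarith
qed

lemma norm_estimate_le:
  assumes x: "x \<in> region P" and a: "a \<in> sample_range m q" and m: "m \<in> {1..blocks P}" "q \<in> {1..K}"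
  shows "norm (estimate P i x a) \<le> est_bound / \<delta>"
proof -
  obtain v z t \<xi> where a_eq: "a = (v, z, t, \<xi>)" by (cases a)
  have "\<bar>response P t i (query_point P x a) \<xi>\<bar> \<le> \<bar>B0\<bar>"
    using a window_subset[OF m] query_point_in_fdom[OF x a]
    by (intro response_bounded) (auto simp: a_eq sample_range_def)
  moreover have "norm v = 1" using a by (simp add: a_eq sample_range_def)
  ultimately show ?thesis
    using pos by (auto simp: a_eq estimate_def est_bound_def abs_mult intro!: mult_left_mono divide_right_mono)
qed

lemma weights_nonneg: "0 \<le> weights P $ i $ j"
  and weights_sym: "transpose (weights P) = weights P"
  and weights_rows: "(\<Sum>j\<in>UNIV. weights P $ i $ j) = 1"
  and weights_cols: "(\<Sum>i\<in>UNIV. weights P $ i $ j) = 1"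
  using network by (auto simp: network_ok_def)

lemma mix_eq: "mix P y i = (\<Sum>j\<in>UNIV. weights P $ i $ j *\<^sub>R y j)"
  unfolding mix_def
proof (rule sum.mono_neutral_left)
  show "\<forall>j\<in>UNIV - ({j. (i, j) \<in> edges P} \<union> {i}). weights P $ i $ j *\<^sub>R y j = 0"
    using network weights_nonneg unfolding network_ok_def
    by (auto simp: less_le)
qed auto

lemma mix_diff: "mix P y i - mix P y' i = mix P (\<lambda>j. y j - y' j) i"
  by (simp add: mix_eq scaleR_diff_right sum_subtractf)

lemma mix_const: "mix P (\<lambda>j. c) i = c"
  by (simp add: mix_eq scaleR_sum_left[symmetric] weights_rows)

lemma norm_mix_le: "(\<And>j. norm (y j) \<le> c) \<Longrightarrow> norm (mix P y i) \<le> c"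
  unfolding mix_eq by (rule norm_convex_combination_le[OF weights_nonneg weights_rows])

lemma mix_in_shrunk: "(\<And>j. y j \<in> shrunk P) \<Longrightarrow> mix P y i \<in> shrunk P"
  unfolding mix_eq by (intro convex_sum convex_shrunk weights_nonneg weights_rows) auto

lemma infeasible_projection_step:
  assumes x0: "x0 \<in> shrunk P" and out: "loo_run (lmo P) (proj_alg P x0 y0) = (x, y)"
  shows "x \<in> shrunk P" "norm y \<le> R" "norm (x - y) \<le> 2 * root_tol"
    "\<And>z. z \<in> shrunk P \<Longrightarrow> (norm (y - z))\<^sup>2 \<le> (norm (y0 - z))\<^sup>2"
    "real (loo_count (lmo P) (proj_alg P x0 y0)) \<le> max 0 (of_int \<lceil>27 * R\<^sup>2 / root_tol\<^sup>2 - 2\<rceil>) *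
          max 1 ((norm (x0 - y0))\<^sup>2 * ((norm (x0 - y0))\<^sup>2 - root_tol\<^sup>2) / (4 * (root_tol\<^sup>2)\<^sup>2) + 1)"
proof -
  have *: "(x \<in> shrunk P \<and> norm y \<le> R \<and> (norm (x - y))\<^sup>2 \<le> 3 * root_tol\<^sup>2 \<and>
           (\<forall>z\<in>shrunk P. (norm (y - z))\<^sup>2 \<le> (norm (y0 - z))\<^sup>2)) \<and>
        real (loo_count (lmo P) (proj_alg P x0 y0)) \<le> max 0 (of_int \<lceil>27 * R\<^sup>2 / root_tol\<^sup>2 - 2\<rceil>) *
          max 1 ((norm (x0 - y0))\<^sup>2 * ((norm (x0 - y0))\<^sup>2 - root_tol\<^sup>2) / (4 * (root_tol\<^sup>2)\<^sup>2) + 1)"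
    using projection[unfolded projection_ok_def infeasible_projection_def tolerance_eq,
        THEN conjunct2, THEN conjunct2, THEN bspec, OF x0, THEN spec, of y0]
    unfolding out prod.case .
  then show "x \<in> shrunk P" "norm y \<le> R" by auto
  have "(norm (x - y))\<^sup>2 \<le> (2 * root_tol)\<^sup>2"
  proof -
    have "(norm (x - y))\<^sup>2 \<le> 3 * root_tol\<^sup>2" using * by blast
    moreover have "(2 * root_tol)\<^sup>2 = 4 * root_tol\<^sup>2" by (simp add: power_mult_distrib)
    ultimately show ?thesis using zero_le_power2[of root_tol] by linarith
  qed
  then show "norm (x - y) \<le> 2 * root_tol"
    using root_tol_pos by (intro power2_le_imp_le[of "norm (x - y)"]) auto
  show "(norm (y - z))\<^sup>2 \<le> (norm (y0 - z))\<^sup>2" if "z \<in> shrunk P" for z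
    using * that by blast
  show "real (loo_count (lmo P) (proj_alg P x0 y0)) \<le> max 0 (of_int \<lceil>27 * R\<^sup>2 / root_tol\<^sup>2 - 2\<rceil>) *
          max 1 ((norm (x0 - y0))\<^sup>2 * ((norm (x0 - y0))\<^sup>2 - root_tol\<^sup>2) / (4 * (root_tol\<^sup>2)\<^sup>2) + 1)"
    using * by blast
qed

definition y_target :: "('n, 'd, 's) samples \<Rightarrow> nat \<Rightarrow> 'n \<Rightarrow> real^'d" where
  "y_target s m i = mix P (y_pos (run_alg P s m)) i + \<eta> *\<^sub>R block_estimate s m i"

lemma run_alg_Suc:
  "loo_run (lmo P) (proj_alg P (mix P (x_pos (run_alg P s m)) i) (y_target s m i)) = (X s (Suc m) i, Y s (Suc m) i)"
  "loo_calls (run_alg P s (Suc m)) i = loo_calls (run_alg P s m) i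
    + loo_count (lmo P) (proj_alg P (mix P (x_pos (run_alg P s m)) i) (y_target s m i))"
  "comms (run_alg P s (Suc m)) i = comms (run_alg P s m) i + 1"
  by (simp_all add: Let_def y_target_def block_estimate_def)

lemma state_invariant:
  "(\<forall>i. X s m i \<in> shrunk P) \<and> (\<forall>i. norm (Y s m i) \<le> R) \<and> (\<forall>i. norm (X s m i - Y s m i) \<le> 2 * root_tol)"
proof (induction m)
  case 0
  then show ?case using center_in_shrunk norm_le_R[OF region_facts(4)] root_tol_pos by simp
next
  case (Suc m)
  have "mix P (x_pos (run_alg P s m)) i \<in> shrunk P" for i
    using Suc by (intro mix_in_shrunk) auto
  from infeasible_projection_step[OF this run_alg_Suc(1)] show ?case by blast
qed

lemma X_in_shrunk: "X s m i \<in> shrunk P"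
  and norm_Y_le: "norm (Y s m i) \<le> R"
  and norm_X_minus_Y_le: "norm (X s m i - Y s m i) \<le> 2 * root_tol"
  using state_invariant[of s m] by auto

lemma X_in_region: "X s m i \<in> region P"
  using X_in_shrunk shrunk_subset by blast

lemma admissibleD:
  assumes "admissible s" "m < blocks P" "q \<in> {1..K}"
  shows "s (Suc m, q, i) \<in> sample_range (Suc m) q"
proof -
  have "Suc m \<in> {1..blocks P}" using assms by auto
  then show ?thesis using assms unfolding admissible_def by blast
qed

lemma norm_block_estimate_le:
  assumes s: "admissible s" and m: "m < blocks P"
  shows "norm (block_estimate s m i) \<le> real K * est_bound / \<delta>"
proof -
  have "norm (block_estimate s m i) \<le> (\<Sum>q=1..K. est_bound / \<delta>)"
    unfolding block_estimate_def
  proof (intro sum_norm_le)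
    fix q assume q: "q \<in> {1..K}"
    show "norm (estimate P i (X s m i) (s (Suc m, q, i))) \<le> est_bound / \<delta>"
      using m q by (intro norm_estimate_le[OF X_in_region admissibleD[OF s m q]]) auto
  qed
  then show ?thesis by simp
qed

text \<open>The projection is called with a start and a target of distance \<open>O(root_tol)\<close>: the two kinds of
  state differ by at most \<open>2 * root_tol\<close>, and the accumulated estimates contribute
  \<open>\<eta> K est_bound / \<delta> = est_bound * root_tol\<close>.\<close>

lemma norm_y_target_minus_mix_le:
  assumes s: "admissible s" and m: "m < blocks P"
  shows "norm (y_target s m i - mix P (x_pos (run_alg P s m)) i) \<le> (2 + est_bound) * root_tol"
proof -
  have "norm (mix P (\<lambda>j. Y s m j - X s m j) i) \<le> 2 * root_tol"
    by (intro norm_mix_le) (use norm_X_minus_Y_le in \<open>simp add: norm_minus_commute\<close>)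
  moreover have "norm (\<eta> *\<^sub>R block_estimate s m i) \<le> est_bound * root_tol"
  proof -
    have "norm (\<eta> *\<^sub>R block_estimate s m i) \<le> \<eta> * (real K * est_bound / \<delta>)"
      using pos mult_left_mono[OF norm_block_estimate_le[OF s m], of \<eta>] by simp
    then show ?thesis by (simp add: root_tol_def mult.commute mult.left_commute)
  qed
  moreover have "y_target s m i - mix P (x_pos (run_alg P s m)) i
      = mix P (\<lambda>j. Y s m j - X s m j) i + \<eta> *\<^sub>R block_estimate s m i"
    unfolding mix_diff[symmetric] y_target_def by simp
  ultimately show ?thesis
    using norm_triangle_ineq[of "mix P (\<lambda>j. Y s m j - X s m j) i" "\<eta> *\<^sub>R block_estimate s m i"]
    by (simp add: algebra_simps)
qed

lemma mix_X_in_shrunk: "mix P (x_pos (run_alg P s m)) i \<in> shrunk P"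
  by (intro mix_in_shrunk X_in_shrunk)

text \<open>The starting point of the projection is itself feasible. Taken as the comparison point of the
  projection guarantee, it shows that the new state is no further from it than the target was.\<close>

lemma norm_X_Suc_minus_mix_le:
  assumes s: "admissible s" and m: "m < blocks P"
  shows "norm (X s (Suc m) i - mix P (x_pos (run_alg P s m)) i) \<le> (4 + est_bound) * root_tol"
proof -
  let ?x0 = "mix P (x_pos (run_alg P s m)) i"
  note step = infeasible_projection_step[OF mix_X_in_shrunk run_alg_Suc(1)[of s m i]]
  have "(norm (Y s (Suc m) i - ?x0))\<^sup>2 \<le> (norm (y_target s m i - ?x0))\<^sup>2"
    by (rule step(4)[OF mix_X_in_shrunk])
  then have "norm (Y s (Suc m) i - ?x0) \<le> norm (y_target s m i - ?x0)"
    by (rule power2_le_imp_le) simp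
  also have "\<dots> \<le> (2 + est_bound) * root_tol" by (rule norm_y_target_minus_mix_le[OF s m])
  finally have "norm (Y s (Suc m) i - ?x0) \<le> (2 + est_bound) * root_tol" .
  then show ?thesis
    using step(3) norm_triangle_ineq[of "X s (Suc m) i - Y s (Suc m) i" "Y s (Suc m) i - ?x0"]
    by (simp add: algebra_simps)
qed

lemma consensus:
  assumes s: "admissible s" and m: "m \<le> blocks P"
  shows "norm (X s m i - X s m j) \<le> spread * root_tol"
proof -
  have "norm (X s m i - X s m j)
      \<le> 4 * sqrt CARD('n) * ((4 + est_bound) * root_tol) / (1 - lambda2 (weights P))"
  proof (rule consensus_bound[OF weights_sym weights_rows spectral_gap _ _ m, where x = "\<lambda>m. x_pos (run_alg P s m)"])
    show "norm (X s (Suc m) i - (\<Sum>j\<in>UNIV. weights P $ i $ j *\<^sub>R X s m j)) \<le> (4 + est_bound) * root_tol"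
      if "m < blocks P" for m i
      using norm_X_Suc_minus_mix_le[OF s that] by (simp add: mix_eq)
  qed (use root_tol_pos est_bound_nonneg in auto)
  also have "\<dots> = spread * root_tol" by (simp add: spread_def)
  finally show ?thesis .
qed

text \<open>The squared distance of start and target is at most \<open>(2 + est_bound)\<^sup>2 \<epsilon>\<close>, so the second factor of
  the call bound of the projection is bounded by a constant.\<close>

lemma loo_calls_le:
  assumes s: "admissible s" and m: "m \<le> blocks P"
  shows "real (loo_calls (run_alg P s m) i) \<le> real m * (27 * R\<^sup>2 / root_tol\<^sup>2 * ((2 + est_bound)^4 / 4 + 1))"
  using m
proof (induction m)
  case (Suc m)
  let ?x0 = "mix P (x_pos (run_alg P s m)) i"
  define D where "D = (norm (?x0 - y_target s m i))\<^sup>2"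
  let ?b = "(2 + est_bound)^4 / 4 + 1"
  have kp: "0 < root_tol\<^sup>2" using root_tol_pos by simp
  have "norm (?x0 - y_target s m i) \<le> (2 + est_bound) * root_tol"
    using norm_y_target_minus_mix_le[OF s, of m i] Suc.prems by (simp add: norm_minus_commute)
  then have D: "D \<le> (2 + est_bound)\<^sup>2 * root_tol\<^sup>2"
    unfolding D_def power_mult_distrib[symmetric] by (intro power_mono) auto
  have D0: "0 \<le> D" by (simp add: D_def)
  have "D * (D - root_tol\<^sup>2) \<le> D * D"
    using D0 kp by (intro mult_left_mono) auto
  also have "\<dots> \<le> ((2 + est_bound)\<^sup>2 * root_tol\<^sup>2) * ((2 + est_bound)\<^sup>2 * root_tol\<^sup>2)"
    using D D0 by (intro mult_mono) auto
  also have "\<dots> = (2 + est_bound)^4 / 4 * (4 * (root_tol\<^sup>2)\<^sup>2)"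
    by (simp add: power2_eq_square power4_eq_xxxx)
  finally have "D * (D - root_tol\<^sup>2) / (4 * (root_tol\<^sup>2)\<^sup>2) \<le> (2 + est_bound)^4 / 4"
    using kp by (simp add: divide_le_eq)
  then have m1: "max 1 (D * (D - root_tol\<^sup>2) / (4 * (root_tol\<^sup>2)\<^sup>2) + 1) \<le> ?b"
    by simp
  have "of_int \<lceil>27 * R\<^sup>2 / root_tol\<^sup>2 - 2\<rceil> \<le> 27 * R\<^sup>2 / root_tol\<^sup>2" by linarith
  then have m0: "max 0 (of_int \<lceil>27 * R\<^sup>2 / root_tol\<^sup>2 - 2\<rceil>) \<le> 27 * R\<^sup>2 / root_tol\<^sup>2"
    by simp
  have "real (loo_count (lmo P) (proj_alg P ?x0 (y_target s m i)))
      \<le> max 0 (of_int \<lceil>27 * R\<^sup>2 / root_tol\<^sup>2 - 2\<rceil>) * max 1 (D * (D - root_tol\<^sup>2) / (4 * (root_tol\<^sup>2)\<^sup>2) + 1)"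
    using infeasible_projection_step(5)[OF mix_X_in_shrunk run_alg_Suc(1)[of s m i]] by (simp only: D_def)
  also have "\<dots> \<le> 27 * R\<^sup>2 / root_tol\<^sup>2 * ?b"
    using m0 m1 by (intro mult_mono) auto
  finally have "real (loo_calls (run_alg P s (Suc m)) i) \<le> real (loo_calls (run_alg P s m) i) + 27 * R\<^sup>2 / root_tol\<^sup>2 * ?b"
    unfolding run_alg_Suc(2) by simp
  also have "\<dots> \<le> real m * (27 * R\<^sup>2 / root_tol\<^sup>2 * ?b) + 27 * R\<^sup>2 / root_tol\<^sup>2 * ?b"
    using Suc by simp
  also have "\<dots> = real (Suc m) * (27 * R\<^sup>2 / root_tol\<^sup>2 * ?b)"
    unfolding of_nat_Suc distrib_right by simp
  finally show ?case .
qed simp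

lemma comms_eq: "comms (run_alg P s m) i = m"
  by (induction m) (simp_all add: Let_def)

lemma sum_mix_distance_le:
  "(\<Sum>i\<in>UNIV. (norm (mix P y i - u))\<^sup>2) \<le> (\<Sum>j\<in>UNIV. (norm (y j - u))\<^sup>2)"
proof -
  have "mix P y i - u = (\<Sum>j\<in>UNIV. weights P $ i $ j *\<^sub>R (y j - u))" for i
    unfolding mix_eq[symmetric] mix_diff[symmetric] mix_const ..
  then have "(\<Sum>i\<in>UNIV. (norm (mix P y i - u))\<^sup>2)
      \<le> (\<Sum>i\<in>UNIV. \<Sum>j\<in>UNIV. weights P $ i $ j * (norm (y j - u))\<^sup>2)"
    by (intro sum_mono) (simp add: norm_convex_combination_squared_le[OF weights_nonneg weights_rows])
  also have "\<dots> = (\<Sum>j\<in>UNIV. (norm (y j - u))\<^sup>2)"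
    by (subst sum.swap) (simp add: sum_distrib_right[symmetric] weights_cols)
  finally show ?thesis .
qed

text \<open>The sum of squared distances of the \<open>y\<close>-states to a feasible comparator is the potential of the
  gradient ascent: neither the projection nor the mixing increases it.\<close>

lemma potential_step:
  assumes s: "admissible s" and m: "m < blocks P" and u: "u \<in> shrunk P"
  shows "(\<Sum>j\<in>UNIV. (norm (Y s (Suc m) j - u))\<^sup>2) \<le> (\<Sum>j\<in>UNIV. (norm (Y s m j - u))\<^sup>2)
    - 2 * \<eta> * (\<Sum>j\<in>UNIV. block_estimate s m j \<bullet> (u - mix P (y_pos (run_alg P s m)) j))
    + real CARD('n) * (est_bound * root_tol)\<^sup>2"
proof -
  let ?o = "block_estimate s m" and ?y = "\<lambda>j. mix P (y_pos (run_alg P s m)) j"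
  have "(norm (Y s (Suc m) j - u))\<^sup>2
      \<le> (norm (?y j - u))\<^sup>2 - 2 * \<eta> * (?o j \<bullet> (u - ?y j)) + (est_bound * root_tol)\<^sup>2" for j
  proof -
    have "(norm (Y s (Suc m) j - u))\<^sup>2 \<le> (norm (y_target s m j - u))\<^sup>2"
      by (rule infeasible_projection_step(4)[OF mix_X_in_shrunk run_alg_Suc(1) u])
    also have "\<dots> = (norm (?y j - u))\<^sup>2 - 2 * \<eta> * (?o j \<bullet> (u - ?y j)) + (\<eta> * norm (?o j))\<^sup>2"
      unfolding y_target_def power_mult_distrib power2_norm_eq_inner
      by (simp add: inner_diff inner_add inner_commute algebra_simps power2_eq_square)
    also have "\<eta> * norm (?o j) \<le> \<eta> * (real K * est_bound / \<delta>)"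
      using pos norm_block_estimate_le[OF s m] by (intro mult_left_mono) auto
    then have "(\<eta> * norm (?o j))\<^sup>2 \<le> (est_bound * root_tol)\<^sup>2"
      using pos by (intro power_mono) (auto simp: root_tol_def mult.commute mult.left_commute)
    finally show ?thesis by simp
  qed
  then have "(\<Sum>j\<in>UNIV. (norm (Y s (Suc m) j - u))\<^sup>2)
      \<le> (\<Sum>j\<in>UNIV. (norm (?y j - u))\<^sup>2 - 2 * \<eta> * (?o j \<bullet> (u - ?y j)) + (est_bound * root_tol)\<^sup>2)"
    by (intro sum_mono)
  also have "\<dots> = (\<Sum>j\<in>UNIV. (norm (?y j - u))\<^sup>2)
      - 2 * \<eta> * (\<Sum>j\<in>UNIV. ?o j \<bullet> (u - ?y j)) + real CARD('n) * (est_bound * root_tol)\<^sup>2"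
    by (simp add: sum.distrib sum_subtractf sum_distrib_left)
  finally show ?thesis using sum_mix_distance_le[of "y_pos (run_alg P s m)" u] by simp
qed

lemma gradient_ascent_bound:
  assumes s: "admissible s" and u: "u \<in> shrunk P"
  shows "(\<Sum>m<blocks P. \<Sum>j\<in>UNIV. block_estimate s m j \<bullet> (u - mix P (y_pos (run_alg P s m)) j))
    \<le> real CARD('n) * (2 * R\<^sup>2 / \<eta> + real (blocks P) * ((est_bound * root_tol)\<^sup>2 / (2 * \<eta>)))"
proof -
  define S where "S m = (\<Sum>j\<in>UNIV. block_estimate s m j \<bullet> (u - mix P (y_pos (run_alg P s m)) j))" for m
  define V where "V m = (\<Sum>j\<in>UNIV. (norm (Y s m j - u))\<^sup>2)" for m
  have "V n + 2 * \<eta> * (\<Sum>m<n. S m) \<le> V 0 + real n * (real CARD('n) * (est_bound * root_tol)\<^sup>2)" if "n \<le> blocks P" for n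
    using that
  proof (induction n)
    case (Suc n)
    then show ?case
      using potential_step[OF s, of n u] u by (simp add: V_def S_def algebra_simps del: run_alg.simps)
  qed simp
  from this[OF order_refl] have "2 * \<eta> * (\<Sum>m<blocks P. S m)
      \<le> V 0 + real (blocks P) * (real CARD('n) * (est_bound * root_tol)\<^sup>2)"
    using sum_nonneg[of UNIV "\<lambda>j. (norm (Y s (blocks P) j - u))\<^sup>2"] by (simp add: V_def)
  moreover have "V 0 \<le> real CARD('n) * (4 * R\<^sup>2)"
  proof -
    have "(norm (Y s 0 j - u))\<^sup>2 \<le> (2 * R)\<^sup>2" for j
      using norm_Y_le[of s 0 j] norm_le_R[of u] u shrunk_subset norm_triangle_ineq4[of "Y s 0 j" u]
      by (intro power_mono) auto
    then have "V 0 \<le> (\<Sum>j\<in>(UNIV::'n set). (2 * R)\<^sup>2)"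
      unfolding V_def by (intro sum_mono)
    then show ?thesis by (simp add: power_mult_distrib)
  qed
  ultimately have "2 * \<eta> * (\<Sum>m<blocks P. S m)
      \<le> real CARD('n) * (4 * R\<^sup>2) + real (blocks P) * (real CARD('n) * (est_bound * root_tol)\<^sup>2)"
    by linarith
  also have "\<dots> = 2 * \<eta> * (real CARD('n) * (2 * R\<^sup>2 / \<eta> + real (blocks P) * ((est_bound * root_tol)\<^sup>2 / (2 * \<eta>))))"
    using pos by (simp add: field_simps)
  finally show ?thesis
    using pos by (simp add: S_def)
qed

text \<open>The estimates are taken at the \<open>x\<close>-states, whereas the potential argument controls gains at the
  mixed \<open>y\<close>-states. Their distance is \<open>O(root_tol)\<close> by consensus.\<close>

lemma linear_regret_bound:
  assumes s: "admissible s" and u: "u \<in> shrunk P"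
  shows "(\<Sum>m<blocks P. \<Sum>j\<in>UNIV. block_estimate s m j \<bullet> (u - X s m j))
    \<le> real CARD('n) * (2 * R\<^sup>2 / \<eta>
        + real (blocks P) * ((real K)\<^sup>2 * \<eta> / \<delta>\<^sup>2) * (est_bound\<^sup>2 / 2 + est_bound * (2 + spread)))"
proof -
  let ?y = "\<lambda>m j. mix P (y_pos (run_alg P s m)) j"
  have dist: "norm (?y m j - X s m j) \<le> (2 + spread) * root_tol" if m: "m < blocks P" for m j
  proof -
    have "norm (mix P (\<lambda>l. Y s m l - X s m j) j) \<le> (2 + spread) * root_tol"
    proof (rule norm_mix_le)
      fix l
      have "norm (Y s m l - X s m j) \<le> norm (X s m l - Y s m l) + norm (X s m l - X s m j)"
        using norm_triangle_ineq4[of "X s m l - X s m j" "X s m l - Y s m l"] by (simp add: add.commute)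
      then show "norm (Y s m l - X s m j) \<le> (2 + spread) * root_tol"
        using norm_X_minus_Y_le[of s m l] consensus[OF s, of m l j] m by (simp add: algebra_simps)
    qed
    then show ?thesis unfolding mix_diff[symmetric] mix_const .
  qed
  have "(\<Sum>m<blocks P. \<Sum>j\<in>UNIV. block_estimate s m j \<bullet> (?y m j - X s m j))
      \<le> (\<Sum>m<blocks P. \<Sum>j\<in>(UNIV::'n set). (real K * est_bound / \<delta>) * ((2 + spread) * root_tol))"
  proof (intro sum_mono)
    fix m j assume "m \<in> {..<blocks P}"
    then have m: "m < blocks P" by simp
    have "block_estimate s m j \<bullet> (?y m j - X s m j) \<le> norm (block_estimate s m j) * norm (?y m j - X s m j)"
      by (rule norm_cauchy_schwarz)
    also have "\<dots> \<le> (real K * est_bound / \<delta>) * ((2 + spread) * root_tol)"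
      using norm_block_estimate_le[OF s m] dist[OF m] pos est_bound_nonneg by (intro mult_mono) auto
    finally show "block_estimate s m j \<bullet> (?y m j - X s m j) \<le> (real K * est_bound / \<delta>) * ((2 + spread) * root_tol)" .
  qed
  then have 1: "(\<Sum>m<blocks P. \<Sum>j\<in>UNIV. block_estimate s m j \<bullet> (?y m j - X s m j))
      \<le> real CARD('n) * (real (blocks P) * ((real K * est_bound / \<delta>) * ((2 + spread) * root_tol)))"
    by (simp add: mult.left_commute)
  have "(\<Sum>m<blocks P. \<Sum>j\<in>UNIV. block_estimate s m j \<bullet> (u - X s m j))
    = (\<Sum>m<blocks P. \<Sum>j\<in>UNIV. block_estimate s m j \<bullet> (u - ?y m j))
    + (\<Sum>m<blocks P. \<Sum>j\<in>UNIV. block_estimate s m j \<bullet> (?y m j - X s m j))"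
    unfolding sum.distrib[symmetric] inner_add_right[symmetric] by simp
  also have "\<dots> \<le> real CARD('n) * (2 * R\<^sup>2 / \<eta> + real (blocks P) * ((est_bound * root_tol)\<^sup>2 / (2 * \<eta>)))
     + real CARD('n) * (real (blocks P) * ((real K * est_bound / \<delta>) * ((2 + spread) * root_tol)))"
    using gradient_ascent_bound[OF s u] 1 by linarith
  also have "\<dots> = real CARD('n) * (2 * R\<^sup>2 / \<eta>
        + real (blocks P) * ((real K)\<^sup>2 * \<eta> / \<delta>\<^sup>2) * (est_bound\<^sup>2 / 2 + est_bound * (2 + spread)))"
  proof -
    have regroup: "n * (a + b * (c * p)) + n * (b * (c * q)) = n * (a + b * c * (p + q))"
      for n a b c p q :: real by (simp add: algebra_simps)
    have 2: "(est_bound * root_tol)\<^sup>2 / (2 * \<eta>) = ((real K)\<^sup>2 * \<eta> / \<delta>\<^sup>2) * (est_bound\<^sup>2 / 2)"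
      using pos by (simp add: root_tol_def power2_eq_square mult_ac)
    have 3: "(real K * est_bound / \<delta>) * ((2 + spread) * root_tol) = ((real K)\<^sup>2 * \<eta> / \<delta>\<^sup>2) * (est_bound * (2 + spread))"
      by (simp add: root_tol_def power2_eq_square)
    show ?thesis unfolding 2 3 by (rule regroup)
  qed
  finally show ?thesis .
qed

end

section \<open>Samples are independent of the past\<close>

text \<open>Conditioning on \<open>X\<close> amounts to freezing it and integrating over the law of \<open>Y\<close>.\<close>

lemma (in prob_space) expectation_indep_pair:
  fixes g :: "'b \<times> 'b \<Rightarrow> real"
  assumes ind: "indep_var M1 X M2 Y" and g: "g \<in> borel_measurable (M1 \<Otimes>\<^sub>M M2)"
    and bd: "\<And>p. \<bar>g p\<bar> \<le> C"
  shows "integrable M (\<lambda>\<omega>. \<integral>y. g (X \<omega>, y) \<partial>distr M M2 Y)" (is ?int)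
    and "(\<integral>\<omega>. g (X \<omega>, Y \<omega>) \<partial>M) = (\<integral>\<omega>. (\<integral>y. g (X \<omega>, y) \<partial>distr M M2 Y) \<partial>M)" (is ?eq)
proof -
  have X: "X \<in> M \<rightarrow>\<^sub>M M1" and Y: "Y \<in> M \<rightarrow>\<^sub>M M2"
    using ind by (auto dest: indep_var_rv1 indep_var_rv2)
  interpret X: prob_space "distr M M1 X" by (rule prob_space_distr[OF X])
  interpret Y: prob_space "distr M M2 Y" by (rule prob_space_distr[OF Y])
  interpret XY: pair_prob_space "distr M M1 X" "distr M M2 Y" ..
  have joint: "distr M M1 X \<Otimes>\<^sub>M distr M M2 Y = distr M (M1 \<Otimes>\<^sub>M M2) (\<lambda>\<omega>. (X \<omega>, Y \<omega>))"
    using ind by (simp add: indep_var_distribution_eq)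
  have g': "g \<in> borel_measurable (distr M M1 X \<Otimes>\<^sub>M distr M M2 Y)"
    using g by (simp cong: measurable_cong_sets add: sets_pair_measure_cong[OF sets_distr sets_distr])
  have int: "integrable (distr M M1 X \<Otimes>\<^sub>M distr M M2 Y) g"
    using g' bd by (intro XY.integrable_const_bound[of _ C]) auto
  have inner: "(\<lambda>x. \<integral>y. g (x, y) \<partial>distr M M2 Y) \<in> borel_measurable M1"
  proof (rule Y.borel_measurable_lebesgue_integral)
    show "(\<lambda>(x, y). g (x, y)) \<in> borel_measurable (M1 \<Otimes>\<^sub>M distr M M2 Y)"
      using g by (simp cong: measurable_cong_sets add: sets_pair_measure_cong[OF refl sets_distr])
  qed
  show ?int
    using XY.integrable_fst'[OF int] by (subst (asm) integrable_distr_eq[OF X inner])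
  have "(\<integral>\<omega>. g (X \<omega>, Y \<omega>) \<partial>M) = (\<integral>p. g p \<partial>distr M (M1 \<Otimes>\<^sub>M M2) (\<lambda>\<omega>. (X \<omega>, Y \<omega>)))"
    using X Y g by (subst integral_distr) auto
  also have "\<dots> = (\<integral>x. (\<integral>y. g (x, y) \<partial>distr M M2 Y) \<partial>distr M M1 X)"
    unfolding joint[symmetric] by (rule XY.integral_fst'[OF int, symmetric])
  also have "\<dots> = (\<integral>\<omega>. (\<integral>y. g (X \<omega>, y) \<partial>distr M M2 Y) \<partial>M)"
    by (rule integral_distr[OF X inner])
  finally show ?eq .
qed

text \<open>Independence of a pair of random variables is defined for a common codomain. The maps \<open>\<phi>\<close> and \<open>\<psi>\<close>
  lead from there to the types of a position and of a sample.\<close>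

lemma (in prob_space) expectation_indep_images:
  fixes g :: "'c \<times> 'd \<Rightarrow> real"
  assumes ind: "indep_var N1 X N2 Y" and \<phi>: "\<phi> \<in> N1 \<rightarrow>\<^sub>M M1" and \<psi>: "\<psi> \<in> N2 \<rightarrow>\<^sub>M M2"
    and g: "g \<in> borel_measurable (M1 \<Otimes>\<^sub>M M2)" and bd: "\<And>p. \<bar>g p\<bar> \<le> C"
  shows "integrable M (\<lambda>\<omega>. \<integral>y. g (\<phi> (X \<omega>), y) \<partial>distr M M2 (\<lambda>\<omega>. \<psi> (Y \<omega>)))" (is ?int)
    and "(\<integral>\<omega>. g (\<phi> (X \<omega>), \<psi> (Y \<omega>)) \<partial>M) = (\<integral>\<omega>. (\<integral>y. g (\<phi> (X \<omega>), y) \<partial>distr M M2 (\<lambda>\<omega>. \<psi> (Y \<omega>))) \<partial>M)" (is ?eq)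
proof -
  have X: "X \<in> M \<rightarrow>\<^sub>M N1" and Y: "Y \<in> M \<rightarrow>\<^sub>M N2"
    using ind by (auto dest: indep_var_rv1 indep_var_rv2)
  have g': "(\<lambda>p. g (\<phi> (fst p), \<psi> (snd p))) \<in> borel_measurable (N1 \<Otimes>\<^sub>M N2)"
    using \<phi> \<psi> g by measurable
  have inner: "(\<integral>y. g (\<phi> (X \<omega>), \<psi> y) \<partial>distr M N2 Y) = (\<integral>y. g (\<phi> (X \<omega>), y) \<partial>distr M M2 (\<lambda>\<omega>. \<psi> (Y \<omega>)))"
    if "\<omega> \<in> space M" for \<omega>
  proof -
    have "\<phi> (X \<omega>) \<in> space M1" using X \<phi> that by (meson measurable_space)
    then have gm: "(\<lambda>y. g (\<phi> (X \<omega>), y)) \<in> borel_measurable M2"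
      using g by measurable
    have "distr M M2 (\<lambda>\<omega>. \<psi> (Y \<omega>)) = distr (distr M N2 Y) M2 \<psi>"
      using Y \<psi> by (simp add: distr_distr comp_def)
    then show ?thesis using \<psi> gm by (simp add: integral_distr)
  qed
  note base = expectation_indep_pair[OF ind g' bd]
  show ?int
    using base(1) inner by (simp cong: Bochner_Integration.integrable_cong)
  show ?eq
    using base(2) inner by (simp cong: Bochner_Integration.integral_cong)
qed

definition clip :: "real \<Rightarrow> real \<Rightarrow> real" where
  "clip C y = max (- C) (min C y)"

lemma clip_bounded: "0 \<le> C \<Longrightarrow> \<bar>clip C y\<bar> \<le> C"
  by (auto simp: clip_def)

lemma clip_eq: "\<bar>y\<bar> \<le> C \<Longrightarrow> clip C y = y"
  by (auto simp: clip_def)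

lemma measurable_clip [measurable]: "clip C \<in> borel_measurable borel"
  unfolding clip_def[abs_def] by measurable

text \<open>Measurability of the responses in all rounds, also those beyond the horizon, makes the states
  measurable functions of arbitrary samples. The general case is reduced to this one in
  \<open>bandit_measurable_mute\<close>.\<close>

locale bandit_measurable = bandit P \<gamma> G M B0
  for P :: "('n::finite, 'd::finite, 's) problem" and \<gamma> G M B0 :: real +
  assumes response_measurable:
    "\<And>t i. (\<lambda>(x, \<xi>). response P t i x \<xi>) \<in> borel_measurable (borel \<Otimes>\<^sub>M seed_law P)"
begin

lemma measurable_w_map [measurable (raw)]:
  assumes [measurable]: "f \<in> borel_measurable N" "g \<in> borel_measurable N"
  shows "(\<lambda>p. w_map (setting P) (f p) (g p)) \<in> borel_measurable N"
  by (cases "setting P") simp_all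

lemma measurable_estimate:
  "(\<lambda>(x, a). estimate P i x a) \<in> borel_measurable (borel \<Otimes>\<^sub>M sample_space P)"
proof -
  let ?N = "borel \<Otimes>\<^sub>M sample_space P"
  let ?q = "\<lambda>p. w_map (setting P) (fst p) (fst (snd (snd p))) + \<delta> *\<^sub>R fst (snd p)"
  have "(\<lambda>p. response P t i (?q p) (snd (snd (snd (snd p))))) \<in> borel_measurable ?N" for t
  proof -
    have "(\<lambda>p. (?q p, snd (snd (snd (snd p))))) \<in> ?N \<rightarrow>\<^sub>M borel \<Otimes>\<^sub>M seed_law P"
      by measurable
    from measurable_compose[OF this response_measurable[of t i]] show ?thesis by simp
  qed
  then have resp: "(\<lambda>p. response P (fst (snd (snd (snd p)))) i (?q p) (snd (snd (snd (snd p))))) \<in> borel_measurable ?N"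
    by (rule measurable_compose_countable) measurable
  have "(\<lambda>p. (real k / \<delta> * response P (fst (snd (snd (snd p)))) i (?q p) (snd (snd (snd (snd p))))) *\<^sub>R fst (snd p)) \<in> borel_measurable ?N"
    using resp by measurable
  then show ?thesis
    by (simp add: estimate_def query_point_def case_prod_beta')
qed

definition past :: "nat \<Rightarrow> (nat \<times> nat \<times> 'n) set" where
  "past m = {1..m} \<times> {1..K} \<times> UNIV"

lemma run_alg_cong:
  assumes "\<And>a. a \<in> past m \<Longrightarrow> s a = s' a"
  shows "run_alg P s m = run_alg P s' m"
  using assms
proof (induction m)
  case (Suc m)
  have "run_alg P s m = run_alg P s' m"
    by (rule Suc.IH) (use Suc.prems in \<open>auto simp: past_def\<close>)
  moreover have "s (Suc m, q, i) = s' (Suc m, q, i)" if "q \<in> {1..K}" for q i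
    using that by (intro Suc.prems) (auto simp: past_def)
  then have "(\<Sum>q=1..K. estimate P i x (s (Suc m, q, i))) = (\<Sum>q=1..K. estimate P i x (s' (Suc m, q, i)))" for i x
    by (intro sum.cong refl) simp
  ultimately show ?case by (simp only: run_alg.simps Let_def)
qed simp

lemma measurable_state:
  assumes "m \<le> n"
  shows "(\<lambda>s. X s m i) \<in> borel_measurable (PiM (past n) (\<lambda>_. sample_space P)) \<and>
    (\<lambda>s. Y s m i) \<in> borel_measurable (PiM (past n) (\<lambda>_. sample_space P))"
  using assms
proof (induction m arbitrary: i)
  case (Suc m)
  let ?N = "PiM (past n) (\<lambda>_. sample_space P)"
  have X [measurable]: "(\<lambda>s. X s m i) \<in> borel_measurable ?N" and
    Y [measurable]: "(\<lambda>s. Y s m i) \<in> borel_measurable ?N" for i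
    using Suc by auto
  have est: "(\<lambda>s. estimate P i (X s m i) (s (Suc m, q, i))) \<in> borel_measurable ?N" if "q \<in> {1..K}" for q
  proof -
    have "(Suc m, q, i) \<in> past n" using that Suc.prems by (simp add: past_def)
    then have "(\<lambda>s. s (Suc m, q, i)) \<in> ?N \<rightarrow>\<^sub>M sample_space P"
      by (rule measurable_component_singleton)
    then have "(\<lambda>s. (X s m i, s (Suc m, q, i))) \<in> ?N \<rightarrow>\<^sub>M borel \<Otimes>\<^sub>M sample_space P"
      by (intro measurable_Pair X)
    from measurable_compose[OF this measurable_estimate[of i]] show ?thesis by simp
  qed
  have target: "(\<lambda>s. y_target s m i) \<in> borel_measurable ?N"
    unfolding y_target_def mix_eq block_estimate_def
    by (intro borel_measurable_add borel_measurable_scaleR borel_measurable_sum borel_measurable_const est Y)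
  moreover have "(\<lambda>s. mix P (x_pos (run_alg P s m)) i) \<in> borel_measurable ?N"
    unfolding mix_eq by measurable
  ultimately have "(\<lambda>s. (mix P (x_pos (run_alg P s m)) i, y_target s m i)) \<in> ?N \<rightarrow>\<^sub>M borel \<Otimes>\<^sub>M borel"
    by (intro measurable_Pair)
  moreover have "(\<lambda>(x0, y0). loo_run (lmo P) (proj_alg P x0 y0)) \<in> borel \<Otimes>\<^sub>M borel \<rightarrow>\<^sub>M borel \<Otimes>\<^sub>M borel"
    using projection by (simp add: projection_ok_def infeasible_projection_def)
  ultimately have "(\<lambda>s. case (mix P (x_pos (run_alg P s m)) i, y_target s m i) of
      (x0, y0) \<Rightarrow> loo_run (lmo P) (proj_alg P x0 y0)) \<in> ?N \<rightarrow>\<^sub>M borel \<Otimes>\<^sub>M borel"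
    by (rule measurable_compose)
  then have pair: "(\<lambda>s. (X s (Suc m) i, Y s (Suc m) i)) \<in> ?N \<rightarrow>\<^sub>M borel \<Otimes>\<^sub>M borel"
    by (simp only: prod.case run_alg_Suc(1))
  show ?case
    using measurable_compose[OF pair measurable_fst] measurable_compose[OF pair measurable_snd]
    by (simp only: fst_conv snd_conv)
qed simp

text \<open>Averages of the objective and of its gradient over the query points without perturbation. The
  indicator restricts the integrands to the interval that carries the law of \<open>z\<close>.\<close>

definition objective_int :: "nat \<Rightarrow> 'n \<Rightarrow> real^'d \<Rightarrow> real" where
  "objective_int t j x = (\<integral>z. indicator {0..1} z *\<^sub>R objective P t j (w_map (setting P) x z) \<partial>z_law (setting P))"

definition grad_int :: "nat \<Rightarrow> 'n \<Rightarrow> real^'d \<Rightarrow> real^'d" where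
  "grad_int t j x = (\<integral>z. indicator {0..1} z *\<^sub>R grad (fdom P) (objective P t j) (w_map (setting P) x z) \<partial>z_law (setting P))"

definition sample_law :: "(real^'d) measure \<Rightarrow> nat \<Rightarrow> nat \<Rightarrow> ('d, 's) sample measure" where
  "sample_law \<mu> m q = \<mu> \<Otimes>\<^sub>M (z_law (setting P) \<Otimes>\<^sub>M (measure_pmf (pmf_of_set (window P m q)) \<Otimes>\<^sub>M seed_law P))"

lemma prob_space_seed: "prob_space (seed_law P)"
  using responses by (simp add: oracle_ok_def)

lemma window_card: "0 < q \<Longrightarrow> card (window P m q) = L" "0 < q \<Longrightarrow> window P m q \<noteq> {}" "finite (window P m q)"
proof -
  assume q: "0 < q"
  then have "q * L = (q - 1) * L + L" by (cases q) auto
  then show c: "card (window P m q) = L" by (simp add: window_def)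
  then show "window P m q \<noteq> {}" using pos by auto
qed (simp add: window_def)

lemma objective_regular:
  assumes "t \<in> {1..T}"
  shows "objective P t j differentiable_on fdom P" "G-lipschitz_on (fdom P) (objective P t j)"
    "M-lipschitz_on (fdom P) (grad (fdom P) (objective P t j))" "continuous_on (fdom P) (objective P t j)"
  using regular assms by (auto simp: regular_ok_def)

lemma fdom_facts: "convex (fdom P)" "cube \<subseteq> fdom P" "region P \<subseteq> fdom P"
  using regular region_facts(3) by (auto simp: regular_ok_def simp del: atLeastAtMost_iff)

lemma continuous_on_w_map: "continuous_on A (w_map (setting P) x)"
  by (cases "setting P") (auto intro!: continuous_intros)

lemma continuous_on_path:
  assumes t: "t \<in> {1..T}" and x: "x \<in> region P"
  shows "continuous_on {0..1} (\<lambda>z. objective P t j (w_map (setting P) x z))"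
    "continuous_on {0..1} (\<lambda>z. grad (fdom P) (objective P t j) (w_map (setting P) x z))"
proof -
  have sub: "w_map (setting P) x ` {0..1} \<subseteq> fdom P"
    using w_map_in_region[OF x] fdom_facts(3) by blast
  show "continuous_on {0..1} (\<lambda>z. objective P t j (w_map (setting P) x z))"
    by (rule continuous_on_compose2[OF objective_regular(4)[OF t] continuous_on_w_map sub])
  show "continuous_on {0..1} (\<lambda>z. grad (fdom P) (objective P t j) (w_map (setting P) x z))"
    by (rule continuous_on_compose2[OF lipschitz_on_continuous_on[OF objective_regular(3)[OF t]] continuous_on_w_map sub])
qed

lemma integrable_z_law_continuous:
  fixes g :: "real \<Rightarrow> 'a::euclidean_space"
  assumes "continuous_on {0..1} g"
  shows "integrable (z_law (setting P)) (\<lambda>z. indicator {0..1} z *\<^sub>R g z)"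
proof -
  interpret prob_space "z_law (setting P)" by (rule prob_space_z_law[OF setting_ok])
  have "compact (g ` {0..1})" by (rule compact_continuous_image[OF assms]) simp
  then obtain B where B: "\<And>z. z \<in> {0..1} \<Longrightarrow> norm (g z) \<le> B"
    using compact_imp_bounded[of "g ` {0..1}"] unfolding bounded_iff by blast
  show ?thesis
  proof (rule integrable_const_bound)
    show "AE z in z_law (setting P). norm (indicator {0..1} z *\<^sub>R g z) \<le> max 0 B"
      using B by (intro AE_I2) (auto simp: indicator_def le_max_iff_disj)
    show "(\<lambda>z. indicator {0..1} z *\<^sub>R g z) \<in> borel_measurable (z_law (setting P))"
      using borel_measurable_indicator_continuous[OF assms] by (simp cong: measurable_cong_sets)
  qed
qed

lemma one_point_linearization:
  assumes t: "t \<in> {1..T}" and x: "x \<in> region P" and y: "y \<in> region P"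
  shows "approx_ratio (setting P) * objective P t j y - objective P t j (h_map (setting P) x)
    \<le> lin_coeff (setting P) * (grad_int t j x \<bullet> (y - x))"
proof -
  let ?f = "objective P t j"
  have xy: "x \<in> cube" "y \<in> cube" using x y region_facts(3) by auto
  have diff: "?f differentiable_on cube"
    by (rule differentiable_on_subset[OF objective_regular(1)[OF t] fdom_facts(2)])
  have grad_eq: "grad cube ?f x = grad (fdom P) ?f x" if "x \<in> cube" for x
    by (rule grad_cube_eq[OF objective_regular(1)[OF t] fdom_facts(2) that])
  have cont: "continuous_on cube (grad cube ?f)"
    using continuous_on_subset[OF lipschitz_on_continuous_on[OF objective_regular(3)[OF t]] fdom_facts(2)]
    by (subst continuous_on_cong[OF refl grad_eq]) auto
  have ord: "order_conditions (setting P) ?f"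
    using case_conditions t by (auto simp: case_ok_def order_conditions_def simp del: atLeastAtMost_iff split: setting.splits)
  have "approx_ratio (setting P) * ?f y - ?f (h_map (setting P) x) \<le> lin_coeff (setting P) *
    (\<integral>z. indicator {0..1} z *\<^sub>R (grad cube ?f (w_map (setting P) x z) \<bullet> (y - x)) \<partial>z_law (setting P))"
    by (rule upper_linearization[OF setting_ok diff cont ord xy])
  also have "(\<integral>z. indicator {0..1} z *\<^sub>R (grad cube ?f (w_map (setting P) x z) \<bullet> (y - x)) \<partial>z_law (setting P))
    = (\<integral>z. (indicator {0..1} z *\<^sub>R grad (fdom P) ?f (w_map (setting P) x z)) \<bullet> (y - x) \<partial>z_law (setting P))"
  proof (intro Bochner_Integration.integral_cong refl)
    fix z :: real
    show "indicator {0..1} z *\<^sub>R (grad cube ?f (w_map (setting P) x z) \<bullet> (y - x))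
      = (indicator {0..1} z *\<^sub>R grad (fdom P) ?f (w_map (setting P) x z)) \<bullet> (y - x)"
    proof (cases "z \<in> {0..1}")
      case True
      then have "w_map (setting P) x z \<in> cube" using w_map_in_region[OF x] region_facts(3) by blast
      then show ?thesis by (simp add: grad_eq)
    qed (simp add: indicator_def)
  qed
  also have "\<dots> = grad_int t j x \<bullet> (y - x)"
    unfolding grad_int_def
    by (intro integral_inner_left integrable_z_law_continuous continuous_on_path t x)
  finally show ?thesis .
qed

end

section \<open>The mean of a one-point estimate\<close>

context bandit_measurable
begin

text \<open>The bound \<open>2 R est_bound / \<delta>\<close> for linear gains holds only for positions in the region and samples in
  their range. Clipping at this bound changes nothing there and makes the gains bounded
  everywhere, hence integrable with respect to every law below.\<close>

definition clip_bound :: real where "clip_bound = 2 * R * (est_bound / \<delta>)"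

lemma clip_bound_nonneg: "0 \<le> clip_bound"
  using R_nonneg est_bound_nonneg pos by (simp add: clip_bound_def)

lemma inner_estimate_bounded:
  assumes x: "x \<in> region P" and u: "u \<in> region P" and a: "a \<in> sample_range m q" and m: "m \<in> {1..blocks P}" "q \<in> {1..K}"
  shows "\<bar>(u - x) \<bullet> estimate P j x a\<bar> \<le> clip_bound"
proof -
  have "norm (u - x) \<le> 2 * R"
    using norm_triangle_ineq4[of u x] norm_le_R[OF x] norm_le_R[OF u] by linarith
  then have "norm (u - x) * norm (estimate P j x a) \<le> 2 * R * (est_bound / \<delta>)"
    using norm_estimate_le[OF x a m] R_nonneg by (intro mult_mono) auto
  then show ?thesis
    using Cauchy_Schwarz_ineq2[of "u - x" "estimate P j x a"] by (simp add: clip_bound_def)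
qed

text \<open>The Taylor expansion at the unperturbed query point, multiplied by \<open>(k/\<delta>) (a \<bullet> v)\<close>.\<close>

lemma perturbed_value_ge:
  assumes t: "t \<in> {1..T}" and x: "x \<in> region P" and z: "z \<in> {0..1}" and v: "norm v = 1" "v \<in> U"
  shows "(real k / \<delta> * (a \<bullet> v)) * objective P t j (w_map (setting P) x z)
      + (real k * (a \<bullet> v)) * (grad (fdom P) (objective P t j) (w_map (setting P) x z) \<bullet> v)
      - real k * M * \<delta> * norm a
    \<le> (real k / \<delta> * (a \<bullet> v)) * objective P t j (w_map (setting P) x z + \<delta> *\<^sub>R v)"
proof -
  let ?f = "objective P t j" and ?w = "w_map (setting P) x z"
  let ?g = "grad (fdom P) ?f ?w"
  have w: "?w \<in> region P" by (rule w_map_in_region[OF x z])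
  have "?w + \<delta> *\<^sub>R v \<in> fdom P" using regular w v by (auto simp: regular_ok_def)
  then have "\<bar>?f (?w + \<delta> *\<^sub>R v) - ?f ?w - ?g \<bullet> ((?w + \<delta> *\<^sub>R v) - ?w)\<bar> \<le> M * (norm ((?w + \<delta> *\<^sub>R v) - ?w))\<^sup>2"
    using w fdom_facts by (intro abs_taylor_remainder_le[of "fdom P"] objective_regular[OF t]) auto
  then have taylor: "\<bar>?f (?w + \<delta> *\<^sub>R v) - ?f ?w - \<delta> * (?g \<bullet> v)\<bar> \<le> M * \<delta>\<^sup>2"
    using v by simp
  define e where "e = ?f (?w + \<delta> *\<^sub>R v) - ?f ?w - \<delta> * (?g \<bullet> v)"
  have "\<bar>a \<bullet> v\<bar> \<le> norm a" using Cauchy_Schwarz_ineq2[of a v] v by simp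
  then have "\<bar>a \<bullet> v\<bar> * \<bar>e\<bar> \<le> norm a * (M * \<delta>\<^sup>2)"
    using taylor unfolding e_def[symmetric] by (intro mult_mono) auto
  then have "- (norm a * (M * \<delta>\<^sup>2)) \<le> (a \<bullet> v) * e"
    using abs_le_D2[of "(a \<bullet> v) * e"] by (simp add: abs_mult) (smt (verit) abs_mult)
  then have "(real k / \<delta>) * (- (norm a * (M * \<delta>\<^sup>2))) \<le> (real k / \<delta>) * ((a \<bullet> v) * e)"
    using pos by (intro mult_left_mono) auto
  moreover have "(real k / \<delta>) * (- (norm a * (M * \<delta>\<^sup>2))) = - (real k * M * \<delta> * norm a)"
    using pos by (simp add: power2_eq_square)
  moreover have "(real k / \<delta>) * ((a \<bullet> v) * e) = (real k / \<delta> * (a \<bullet> v)) * ?f (?w + \<delta> *\<^sub>R v)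
     - (real k / \<delta> * (a \<bullet> v)) * ?f ?w - (real k * (a \<bullet> v)) * (?g \<bullet> v)"
    using pos by (simp add: e_def algebra_simps)
  ultimately show ?thesis by linarith
qed

lemma measurable_inner_estimate:
  "(\<lambda>p. clip C ((u - fst p) \<bullet> estimate P j (fst p) (snd p))) \<in> borel_measurable (borel \<Otimes>\<^sub>M sample_space P)"
proof -
  have [measurable]: "(\<lambda>p. estimate P j (fst p) (snd p)) \<in> borel_measurable (borel \<Otimes>\<^sub>M sample_space P)"
    using measurable_estimate[of j] by (simp add: case_prod_beta')
  show ?thesis by measurable
qed

text \<open>Integrate the noise first, which replaces the response by the objective; then the query round and
  \<open>z\<close> for a fixed direction \<open>v\<close>, after Taylor expansion; and \<open>v\<close> last. The zeroth-order term vanishes as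
  \<open>v\<close> has mean zero, and the covariance of \<open>v\<close> cancels the factor \<open>k\<close> of the estimate.\<close>

lemma clipped_estimate_mean_ge:
  assumes \<mu>: "uniform_on_unit_sphere U \<mu>" and x: "x \<in> region P" and u: "u \<in> region P"
    and m: "m \<in> {1..blocks P}" "q \<in> {1..K}"
  shows "(\<Sum>t\<in>window P m q. grad_int t j x \<bullet> (u - x)) / L - real k * M * \<delta> * norm (u - x)
    \<le> (\<integral>a. clip clip_bound ((u - x) \<bullet> estimate P j x a) \<partial>sample_law \<mu> m q)"
proof -
  let ?W = "window P m q" and ?s = "setting P"
  let ?pm = "measure_pmf (pmf_of_set ?W)"
  define a where "a = u - x"
  define g where "g = (\<lambda>p. clip clip_bound (a \<bullet> estimate P j x p))"
  have aU: "a \<in> U" unfolding a_def by (rule diff_in_directions[OF u x])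
  have W: "card ?W = L" "?W \<noteq> {}" "finite ?W" using m window_card by auto
  have tW: "t \<in> {1..T}" if "t \<in> ?W" for t using that window_subset[OF m] by auto
  interpret mu: prob_space \<mu> using \<mu> by (simp add: uniform_on_unit_sphere_def)
  interpret Z: prob_space "z_law ?s" by (rule prob_space_z_law[OF setting_ok])
  interpret S: prob_space "seed_law P" by (rule prob_space_seed)
  interpret TS: pair_prob_space ?pm "seed_law P" ..
  interpret ZTS: pair_prob_space "z_law ?s" "?pm \<Otimes>\<^sub>M seed_law P" ..
  interpret A: pair_prob_space \<mu> "z_law ?s \<Otimes>\<^sub>M (?pm \<Otimes>\<^sub>M seed_law P)" ..
  have space_\<mu>: "space \<mu> = UNIV" and sets_\<mu>: "sets \<mu> = sets borel"
    using \<mu> sets_eq_imp_space_eq[of \<mu> borel] by (auto simp: uniform_on_unit_sphere_def)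
  have g_bd: "\<bar>g p\<bar> \<le> clip_bound" for p
    unfolding g_def by (rule clip_bounded[OF clip_bound_nonneg])
  have "g \<in> borel_measurable (sample_space P)"
    using measurable_Pair2[OF measurable_inner_estimate[of clip_bound u j], of x] by (simp add: g_def a_def)
  moreover have "sets (sample_law \<mu> m q) = sets (sample_space P)"
    unfolding sample_law_def by (intro sets_pair_measure_cong) (auto simp: sets_\<mu>)
  ultimately have g_meas: "g \<in> borel_measurable (sample_law \<mu> m q)"
    by (simp cong: measurable_cong_sets)
  have int_A: "integrable (\<mu> \<Otimes>\<^sub>M (z_law ?s \<Otimes>\<^sub>M (?pm \<Otimes>\<^sub>M seed_law P))) g"
    using g_meas g_bd unfolding sample_law_def by (intro A.integrable_const_bound[of _ clip_bound]) auto
  define c where "c = (\<Sum>t\<in>?W. objective_int t j x) / L"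
  define b where "b = (1 / real L) *\<^sub>R (\<Sum>t\<in>?W. grad_int t j x)"
  define low where "low v = (real k / \<delta> * c) * (a \<bullet> v) + real k * ((b \<bullet> v) * (a \<bullet> v)) - real k * M * \<delta> * norm a" for v
  have inner: "low v \<le> (\<integral>y. g (v, y) \<partial>(z_law ?s \<Otimes>\<^sub>M (?pm \<Otimes>\<^sub>M seed_law P)))"
    if v: "norm v = 1" "v \<in> U" for v
  proof -
    have gv_meas: "(\<lambda>y. g (v, y)) \<in> borel_measurable (z_law ?s \<Otimes>\<^sub>M (?pm \<Otimes>\<^sub>M seed_law P))"
      using measurable_Pair2[OF g_meas[unfolded sample_law_def], of v] by (simp add: space_\<mu>)
    then have int_v: "integrable (z_law ?s \<Otimes>\<^sub>M (?pm \<Otimes>\<^sub>M seed_law P)) (\<lambda>y. g (v, y))"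
      using g_bd by (intro ZTS.integrable_const_bound[of _ clip_bound]) auto
    have query_mean: "(\<integral>y. g (v, z, y) \<partial>(?pm \<Otimes>\<^sub>M seed_law P))
        = (\<Sum>t\<in>?W. (real k / \<delta> * (a \<bullet> v)) * objective P t j (w_map ?s x z + \<delta> *\<^sub>R v)) / L"
      if z: "z \<in> {0..1}" for z
    proof -
      have "(\<lambda>y. g (v, z, y)) \<in> borel_measurable (?pm \<Otimes>\<^sub>M seed_law P)"
        using measurable_Pair2[OF gv_meas, of z] by simp
      then have "integrable (?pm \<Otimes>\<^sub>M seed_law P) (\<lambda>y. g (v, z, y))"
        using g_bd by (intro TS.integrable_const_bound[of _ clip_bound]) auto
      then have "(\<integral>y. g (v, z, y) \<partial>(?pm \<Otimes>\<^sub>M seed_law P)) = (\<integral>t. (\<integral>\<xi>. g (v, z, t, \<xi>) \<partial>seed_law P) \<partial>?pm)"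
        by (rule TS.integral_fst'[symmetric])
      also have "\<dots> = (\<Sum>t\<in>?W. (\<integral>\<xi>. g (v, z, t, \<xi>) \<partial>seed_law P)) / L"
        using W by (simp add: integral_pmf_of_set)
      also have "(\<Sum>t\<in>?W. (\<integral>\<xi>. g (v, z, t, \<xi>) \<partial>seed_law P))
          = (\<Sum>t\<in>?W. (real k / \<delta> * (a \<bullet> v)) * objective P t j (w_map ?s x z + \<delta> *\<^sub>R v))"
      proof (intro sum.cong refl)
        fix t assume t: "t \<in> ?W"
        have "g (v, z, t, \<xi>) = (real k / \<delta> * (a \<bullet> v)) * response P t j (w_map ?s x z + \<delta> *\<^sub>R v) \<xi>"
          if \<xi>: "\<xi> \<in> space (seed_law P)" for \<xi>
        proof -
          have "(v, z, t, \<xi>) \<in> sample_range m q"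
            using v z t \<xi> by (simp add: sample_range_def)
          from clip_eq[OF inner_estimate_bounded[OF x u this m]]
          show ?thesis by (simp add: g_def a_def estimate_def query_point_def mult_ac)
        qed
        then have "(\<integral>\<xi>. g (v, z, t, \<xi>) \<partial>seed_law P)
            = (\<integral>\<xi>. (real k / \<delta> * (a \<bullet> v)) * response P t j (w_map ?s x z + \<delta> *\<^sub>R v) \<xi> \<partial>seed_law P)"
          by (intro Bochner_Integration.integral_cong refl)
        also have "\<dots> = (real k / \<delta> * (a \<bullet> v)) * (\<integral>\<xi>. response P t j (w_map ?s x z + \<delta> *\<^sub>R v) \<xi> \<partial>seed_law P)"
          by (rule integral_mult_right_zero)
        also have "(\<integral>\<xi>. response P t j (w_map ?s x z + \<delta> *\<^sub>R v) \<xi> \<partial>seed_law P) = objective P t j (w_map ?s x z + \<delta> *\<^sub>R v)"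
        proof -
          have "w_map ?s x z + \<delta> *\<^sub>R v \<in> fdom P"
            using regular w_map_in_region[OF x z] v by (auto simp: regular_ok_def)
          then show ?thesis using responses tW[OF t] unfolding oracle_ok_def by blast
        qed
        finally show "(\<integral>\<xi>. g (v, z, t, \<xi>) \<partial>seed_law P)
          = (real k / \<delta> * (a \<bullet> v)) * objective P t j (w_map ?s x z + \<delta> *\<^sub>R v)" .
      qed
      finally show ?thesis .
    qed
    define F where "F t z = indicator {0..1} z *\<^sub>R objective P t j (w_map ?s x z)" for t and z :: real
    define D where "D t z = indicator {0..1} z *\<^sub>R grad (fdom P) (objective P t j) (w_map ?s x z)" for t and z :: real
    have int_F: "integrable (z_law ?s) (F t)" and int_D: "integrable (z_law ?s) (D t)" if "t \<in> ?W" for t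
      unfolding F_def D_def
      by (rule integrable_z_law_continuous[OF continuous_on_path(1)[OF tW[OF that] x]],
          rule integrable_z_law_continuous[OF continuous_on_path(2)[OF tW[OF that] x]])
    define H where "H z = (\<Sum>t\<in>?W. (real k / \<delta> * (a \<bullet> v)) * F t z + (real k * (a \<bullet> v)) * (D t z \<bullet> v)) / L
        - real k * M * \<delta> * norm a" for z
    have int_FD: "integrable (z_law ?s) (\<lambda>z. (real k / \<delta> * (a \<bullet> v)) * F t z + (real k * (a \<bullet> v)) * (D t z \<bullet> v))"
      if "t \<in> ?W" for t
      by (intro Bochner_Integration.integrable_add integrable_mult_right integrable_inner_left int_F int_D that)
    have int_sum: "integrable (z_law ?s)
        (\<lambda>z. (\<Sum>t\<in>?W. (real k / \<delta> * (a \<bullet> v)) * F t z + (real k * (a \<bullet> v)) * (D t z \<bullet> v)) / L)"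
      by (intro integrable_divide_zero Bochner_Integration.integrable_sum int_FD)
    have int_H: "integrable (z_law ?s) H"
      unfolding H_def by (intro Bochner_Integration.integrable_diff int_sum) simp
    have "low v = (\<integral>z. H z \<partial>z_law ?s)"
    proof -
      have "(\<integral>z. H z \<partial>z_law ?s) = (\<integral>z. (\<Sum>t\<in>?W. (real k / \<delta> * (a \<bullet> v)) * F t z + (real k * (a \<bullet> v)) * (D t z \<bullet> v)) / L \<partial>z_law ?s)
          - real k * M * \<delta> * norm a"
        unfolding H_def
        by (subst Bochner_Integration.integral_diff[OF int_sum]) (auto simp: Z.prob_space[simplified])
      also have "(\<integral>z. (\<Sum>t\<in>?W. (real k / \<delta> * (a \<bullet> v)) * F t z + (real k * (a \<bullet> v)) * (D t z \<bullet> v)) / L \<partial>z_law ?s)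
          = (\<Sum>t\<in>?W. \<integral>z. (real k / \<delta> * (a \<bullet> v)) * F t z + (real k * (a \<bullet> v)) * (D t z \<bullet> v) \<partial>z_law ?s) / L"
        unfolding integral_divide_zero by (subst Bochner_Integration.integral_sum[OF int_FD]) auto
      also have "\<dots> = (\<Sum>t\<in>?W. (real k / \<delta> * (a \<bullet> v)) * objective_int t j x + (real k * (a \<bullet> v)) * (grad_int t j x \<bullet> v)) / L"
      proof (intro arg_cong2[where f = "(/)"] sum.cong refl)
        fix t assume t: "t \<in> ?W"
        have "(\<integral>z. D t z \<bullet> v \<partial>z_law ?s) = grad_int t j x \<bullet> v"
          unfolding integral_inner_left[OF int_D[OF t]] by (simp only: grad_int_def D_def[abs_def])
        moreover have "(\<integral>z. F t z \<partial>z_law ?s) = objective_int t j x"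
          by (simp only: objective_int_def F_def[abs_def])
        ultimately show "(\<integral>z. (real k / \<delta> * (a \<bullet> v)) * F t z + (real k * (a \<bullet> v)) * (D t z \<bullet> v) \<partial>z_law ?s)
            = (real k / \<delta> * (a \<bullet> v)) * objective_int t j x + (real k * (a \<bullet> v)) * (grad_int t j x \<bullet> v)"
          by (subst Bochner_Integration.integral_add)
            (auto intro!: integrable_mult_right integrable_inner_left int_F int_D t)
      qed
      also have "\<dots> - real k * M * \<delta> * norm a = low v"
        unfolding low_def c_def b_def
        by (simp only: sum.distrib sum_distrib_left[symmetric] inner_sum_left inner_scaleR_left add_divide_distrib)
          (simp add: mult_ac)
      finally show ?thesis by simp
    qed
    also have "\<dots> \<le> (\<integral>z. (\<integral>y. g (v, z, y) \<partial>(?pm \<Otimes>\<^sub>M seed_law P)) \<partial>z_law ?s)"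
    proof (rule integral_mono_AE[OF int_H ZTS.integrable_fst'[OF int_v]])
      show "AE z in z_law ?s. H z \<le> (\<integral>y. g (v, z, y) \<partial>(?pm \<Otimes>\<^sub>M seed_law P))"
        using AE_z_law[OF setting_ok]
      proof eventually_elim
        case (elim z)
        let ?e = "real k * M * \<delta> * norm a"
        have "H z = (\<Sum>t\<in>?W. (real k / \<delta> * (a \<bullet> v)) * objective P t j (w_map ?s x z)
            + (real k * (a \<bullet> v)) * (grad (fdom P) (objective P t j) (w_map ?s x z) \<bullet> v) - ?e) / L"
          using elim W pos by (simp add: H_def F_def D_def sum_subtractf diff_divide_distrib)
        also have "\<dots> \<le> (\<Sum>t\<in>?W. (real k / \<delta> * (a \<bullet> v)) * objective P t j (w_map ?s x z + \<delta> *\<^sub>R v)) / L"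
          using perturbed_value_ge[OF tW x elim v] by (intro divide_right_mono sum_mono) auto
        finally show ?case by (simp only: query_mean[OF elim])
      qed
    qed
    also have "\<dots> = (\<integral>y. g (v, y) \<partial>(z_law ?s \<Otimes>\<^sub>M (?pm \<Otimes>\<^sub>M seed_law P)))"
      by (rule ZTS.integral_fst'[OF int_v])
    finally show ?thesis .
  qed
  note int_v = integrable_inner_unit_sphere[OF \<mu>]
  have "(\<integral>v. low v \<partial>\<mu>) = (real k / \<delta> * c) * (\<integral>v. a \<bullet> v \<partial>\<mu>) + real k * (\<integral>v. (b \<bullet> v) * (a \<bullet> v) \<partial>\<mu>) - real k * M * \<delta> * norm a"
    unfolding low_def using int_v mu.prob_space by simp
  also have "\<dots> = real k * ((b \<bullet> a) / k) - real k * M * \<delta> * norm a"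
    by (simp add: uniform_on_unit_sphere_mean[OF \<mu> subspace_directions]
        uniform_on_unit_sphere_second_moment[OF \<mu> subspace_directions aU])
  also have "real k * ((b \<bullet> a) / k) = b \<bullet> a"
  \<comment> \<open>In dimension zero the quotient is \<open>0\<close> by convention, but then \<open>a\<close> vanishes as well.\<close>
  proof (cases "k = 0")
    case True
    then have "a = 0" using aU by (auto simp: dim_eq_0)
    then show ?thesis by simp
  qed simp
  also have "b \<bullet> a = (\<Sum>t\<in>?W. grad_int t j x \<bullet> a) / L"
    by (simp add: b_def inner_sum_left)
  finally have "(\<Sum>t\<in>?W. grad_int t j x \<bullet> a) / L - real k * M * \<delta> * norm a = (\<integral>v. low v \<partial>\<mu>)" by simp
  also have "\<dots> \<le> (\<integral>v. (\<integral>y. g (v, y) \<partial>(z_law ?s \<Otimes>\<^sub>M (?pm \<Otimes>\<^sub>M seed_law P))) \<partial>\<mu>)"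
  proof (rule integral_mono_AE[OF _ A.integrable_fst'[OF int_A]])
    show "integrable \<mu> low" unfolding low_def using int_v by simp
    show "AE v in \<mu>. low v \<le> (\<integral>y. g (v, y) \<partial>(z_law ?s \<Otimes>\<^sub>M (?pm \<Otimes>\<^sub>M seed_law P)))"
      using AE_uniform_on_unit_sphere[OF \<mu>] by eventually_elim (use inner in blast)
  qed
  also have "\<dots> = (\<integral>p. g p \<partial>sample_law \<mu> m q)"
    unfolding sample_law_def by (rule A.integral_fst'[OF int_A])
  finally show ?thesis by (simp add: g_def a_def)
qed

text \<open>The conditional expectation of the linear gain towards \<open>u\<close>, given that the position of agent \<open>j\<close> is
  \<open>x\<close>.\<close>

definition estimate_mean :: "'w measure \<Rightarrow> (nat \<times> nat \<times> 'n \<Rightarrow> 'w \<Rightarrow> ('d, 's) sample) \<Rightarrow>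
    real^'d \<Rightarrow> nat \<Rightarrow> nat \<Rightarrow> 'n \<Rightarrow> real^'d \<Rightarrow> real" where
  "estimate_mean \<Omega> S u m q j x =
    (\<integral>a. clip clip_bound ((u - x) \<bullet> estimate P j x a) \<partial>distr \<Omega> (sample_space P) (S (Suc m, q, j)))"

lemma
  assumes sampling: "sampling_ok P \<Omega> S" and m: "m < blocks P" and q: "q \<in> {1..K}" and u: "u \<in> region P"
  shows integrable_estimate_mean: "integrable \<Omega> (\<lambda>\<omega>. estimate_mean \<Omega> S u m q j (X (\<lambda>a. S a \<omega>) m j))"
    and expectation_estimate: "(\<integral>\<omega>. estimate_mean \<Omega> S u m q j (X (\<lambda>a. S a \<omega>) m j) \<partial>\<Omega>)
      = (\<integral>\<omega>. (u - X (\<lambda>a. S a \<omega>) m j) \<bullet> estimate P j (X (\<lambda>a. S a \<omega>) m j) (S (Suc m, q, j) \<omega>) \<partial>\<Omega>)"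
    and estimate_mean_ge: "x \<in> region P \<Longrightarrow>
      (\<Sum>t\<in>window P (Suc m) q. grad_int t j x \<bullet> (u - x)) / L - real k * M * \<delta> * norm (u - x) \<le> estimate_mean \<Omega> S u m q j x"
    and integrable_estimate: "integrable \<Omega>
      (\<lambda>\<omega>. (u - X (\<lambda>a. S a \<omega>) m j) \<bullet> estimate P j (X (\<lambda>a. S a \<omega>) m j) (S (Suc m, q, j) \<omega>))"
proof -
  interpret prob_space \<Omega> using sampling by (simp add: sampling_ok_def)
  let ?I = "{1..blocks P} \<times> {1..K} \<times> UNIV" and ?N = "\<lambda>_. sample_space P" and ?a = "(Suc m, q, j)"
  let ?past = "\<lambda>\<omega>. restrict (\<lambda>a. S a \<omega>) (past m)" and ?now = "\<lambda>\<omega>. restrict (\<lambda>a. S a \<omega>) {?a}"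
  define g where "g p = clip clip_bound ((u - fst p) \<bullet> estimate P j (fst p) (snd p))" for p
  have mb: "Suc m \<in> {1..blocks P}" using m by auto
  have ind: "indep_var (PiM (past m) ?N) ?past (PiM {?a} ?N) ?now"
  proof (rule indep_var_restrict)
    show "indep_vars ?N S ?I" using sampling by (simp add: sampling_ok_def)
  qed (use mb q in \<open>auto simp: past_def\<close>)
  have X_past: "X (?past \<omega>) m j = X (\<lambda>a. S a \<omega>) m j" for \<omega>
    by (rule arg_cong[where f = "\<lambda>st. x_pos st j", OF run_alg_cong]) simp
  have now: "(?now \<omega>) ?a = S ?a \<omega>" for \<omega> by simp
  have \<phi>: "(\<lambda>s. X s m j) \<in> PiM (past m) ?N \<rightarrow>\<^sub>M borel" using measurable_state[of m m j] by simp
  have \<psi>: "(\<lambda>s. s ?a) \<in> PiM {?a} ?N \<rightarrow>\<^sub>M sample_space P" by (rule measurable_component_singleton) simp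
  have gm: "g \<in> borel_measurable (borel \<Otimes>\<^sub>M sample_space P)"
    using measurable_inner_estimate[of clip_bound u j] by (simp add: g_def[abs_def])
  have gb: "\<bar>g p\<bar> \<le> clip_bound" for p
    unfolding g_def by (rule clip_bounded[OF clip_bound_nonneg])
  note main = expectation_indep_images[OF ind \<phi> \<psi> gm gb, unfolded X_past now]
  have range: "S ?a \<omega> \<in> sample_range (Suc m) q" if "\<omega> \<in> space \<Omega>" for \<omega>
    using sampling mb q that unfolding sampling_ok_def sample_range_def by blast
  have unclip: "g (X (\<lambda>a. S a \<omega>) m j, S ?a \<omega>)
      = (u - X (\<lambda>a. S a \<omega>) m j) \<bullet> estimate P j (X (\<lambda>a. S a \<omega>) m j) (S ?a \<omega>)" if "\<omega> \<in> space \<Omega>" for \<omega>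
    using clip_eq[OF inner_estimate_bounded[OF X_in_region u range[OF that] mb q]] by (simp add: g_def)
  show "integrable \<Omega> (\<lambda>\<omega>. estimate_mean \<Omega> S u m q j (X (\<lambda>a. S a \<omega>) m j))"
    using main(1) by (simp add: estimate_mean_def g_def)
  show "(\<integral>\<omega>. estimate_mean \<Omega> S u m q j (X (\<lambda>a. S a \<omega>) m j) \<partial>\<Omega>)
      = (\<integral>\<omega>. (u - X (\<lambda>a. S a \<omega>) m j) \<bullet> estimate P j (X (\<lambda>a. S a \<omega>) m j) (S ?a \<omega>) \<partial>\<Omega>)"
    using main(2) unclip by (simp add: estimate_mean_def g_def cong: Bochner_Integration.integral_cong)
  have "(\<lambda>\<omega>. (X (?past \<omega>) m j, (?now \<omega>) ?a)) \<in> \<Omega> \<rightarrow>\<^sub>M borel \<Otimes>\<^sub>M sample_space P"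
    using measurable_compose[OF indep_var_rv1[OF ind] \<phi>] measurable_compose[OF indep_var_rv2[OF ind] \<psi>]
    by (intro measurable_Pair)
  then have "(\<lambda>\<omega>. g (X (\<lambda>a. S a \<omega>) m j, S ?a \<omega>)) \<in> borel_measurable \<Omega>"
    unfolding X_past now by (rule measurable_compose[OF _ gm])
  then have "integrable \<Omega> (\<lambda>\<omega>. g (X (\<lambda>a. S a \<omega>) m j, S ?a \<omega>))"
    using gb by (intro integrable_const_bound[of _ clip_bound]) auto
  then show "integrable \<Omega> (\<lambda>\<omega>. (u - X (\<lambda>a. S a \<omega>) m j) \<bullet> estimate P j (X (\<lambda>a. S a \<omega>) m j) (S ?a \<omega>))"
    using unclip by (simp cong: Bochner_Integration.integrable_cong)
  show "(\<Sum>t\<in>window P (Suc m) q. grad_int t j x \<bullet> (u - x)) / L - real k * M * \<delta> * norm (u - x) \<le> estimate_mean \<Omega> S u m q j x"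
    if x: "x \<in> region P"
  proof -
    obtain \<mu> where \<mu>: "uniform_on_unit_sphere U \<mu>" "distr \<Omega> (sample_space P) (S ?a) = sample_law \<mu> (Suc m) q"
      using sampling mb q unfolding sampling_ok_def sample_law_def by blast
    show ?thesis
      unfolding estimate_mean_def \<mu>(2) by (rule clipped_estimate_mean_ge[OF \<mu>(1) x u mb q])
  qed
qed

end

section \<open>Decomposition of the regret\<close>

context bandit_measurable
begin

lemma approx_ratio_bounds: "0 \<le> approx_ratio (setting P)" "approx_ratio (setting P) \<le> 1"
proof -
  have "0 \<le> approx_ratio (setting P) \<and> approx_ratio (setting P) \<le> 1"
  proof (cases "setting P")
    case (Monotone g)
    then show ?thesis using setting_points by simp
  next
    case (Nonmonotone u)
    then have u: "u \<in> cube" using setting_points region_facts(3) by auto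
    have "infnorm u \<le> 1"
      unfolding infnorm_cart using cubeD[OF u] by (intro cSup_least) auto
    then show ?thesis using Nonmonotone infnorm_pos_le[of u] by simp
  qed
  then show "0 \<le> approx_ratio (setting P)" "approx_ratio (setting P) \<le> 1" by auto
qed

lemma best_point_exists:
  "\<exists>u\<in>region P. (SUP u\<in>region P. avg_total P (\<lambda>t. u)) = avg_total P (\<lambda>t. u)"
proof -
  have cont: "continuous_on (region P) (\<lambda>u. avg_total P (\<lambda>t. u))"
    unfolding avg_total_def
    by (intro continuous_intros continuous_on_subset[OF objective_regular(4) fdom_facts(3)]) auto
  have ne: "region P \<noteq> {}" using region_facts(4) by auto
  obtain u where u: "u \<in> region P" "\<And>x. x \<in> region P \<Longrightarrow> avg_total P (\<lambda>t. x) \<le> avg_total P (\<lambda>t. u)"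
    using continuous_attains_sup[OF region_facts(2) ne cont] by blast
  then have "(SUP u\<in>region P. avg_total P (\<lambda>t. u)) = avg_total P (\<lambda>t. u)"
    by (intro cSup_eq_maximum) auto
  then show ?thesis using u by blast
qed

lemma window_Suc_eq: "q \<in> {1..K} \<Longrightarrow> window P (Suc m) q = {(m * K + (q - 1)) * L + 1..(m * K + (q - 1)) * L + L}"
  by (cases q) (auto simp: window_def algebra_simps)

lemma sum_over_windows:
  fixes \<phi> :: "nat \<Rightarrow> real"
  shows "(\<Sum>t=1..T. \<phi> t) = (\<Sum>m<blocks P. \<Sum>q=1..K. \<Sum>t\<in>window P (Suc m) q. \<phi> t)"
proof -
  have shift: "(\<Sum>t=a + 1..a + n. \<phi> t) = (\<Sum>t=a..<a + n. \<phi> (Suc t))" for a n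
    by (rule sum.reindex_bij_witness[of _ Suc "\<lambda>t. t - 1"]) auto
  have "(\<Sum>q=1..K. \<Sum>t\<in>window P (Suc m) q. \<phi> t) = (\<Sum>p=m * K..<m * K + K. \<Sum>t=p * L..<p * L + L. \<phi> (Suc t))" for m
  proof -
    have "(\<Sum>q=1..K. \<Sum>t\<in>window P (Suc m) q. \<phi> t) = (\<Sum>q=1..K. \<Sum>t=(m * K + (q - 1)) * L..<(m * K + (q - 1)) * L + L. \<phi> (Suc t))"
      by (intro sum.cong[OF refl]) (simp only: window_Suc_eq shift)
    also have "\<dots> = (\<Sum>p=m * K..<m * K + K. \<Sum>t=p * L..<p * L + L. \<phi> (Suc t))"
      by (rule sum.reindex_bij_witness[of _ "\<lambda>p. p - m * K + 1" "\<lambda>q. m * K + (q - 1)"]) auto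
    finally show ?thesis .
  qed
  then have "(\<Sum>m<blocks P. \<Sum>q=1..K. \<Sum>t\<in>window P (Suc m) q. \<phi> t)
      = (\<Sum>m<blocks P. \<Sum>p=m * K..<m * K + K. \<Sum>t=p * L..<p * L + L. \<phi> (Suc t))" by simp
  also have "\<dots> = (\<Sum>p<blocks P * K. \<Sum>t=p * L..<p * L + L. \<phi> (Suc t))"
    by (rule sum.nat_group)
  also have "\<dots> = (\<Sum>t<blocks P * K * L. \<phi> (Suc t))"
    by (rule sum.nat_group)
  also have "\<dots> = (\<Sum>t=1..T. \<phi> t)"
    using shift[of 0 T] horizon_eq by (simp add: atLeast0LessThan mult.assoc)
  finally show ?thesis by simp
qed

lemma played_eq:
  assumes q: "q \<in> {1..K}" and t: "t \<in> window P (Suc m) q"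
  shows "played P s t i =
    (if t = fst (snd (snd (s (Suc m, q, i)))) then query_point P (X s m i) (s (Suc m, q, i))
     else h_map (setting P) (X s m i))"
proof -
  \<comment> \<open>Rounds count from one; the digits of \<open>t - 1\<close> in mixed radix are block, repetition and offset.\<close>
  obtain e where e: "t - 1 = m * (K * L) + ((q - 1) * L + e)" "e < L"
    using t pos unfolding window_Suc_eq[OF q]
    by (intro that[of "t - ((m * K + (q - 1)) * L + 1)"]) (auto simp: algebra_simps)
  have "(q - 1) * L + e < K * L"
  proof -
    have "(q - 1) * L + e < (q - 1) * L + L" using e by simp
    also have "\<dots> = q * L" using q by (cases q) auto
    also have "\<dots> \<le> K * L" using q by auto
    finally show ?thesis .
  qed
  have "(t - 1) div (K * L) = m" "(t - 1) mod (K * L) = (q - 1) * L + e"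
  proof -
    have "(m * n + x) div n = m \<and> (m * n + x) mod n = x" if "x < n" for n x :: nat
      using that by simp
    from this[OF \<open>(q - 1) * L + e < K * L\<close>]
    show "(t - 1) div (K * L) = m" "(t - 1) mod (K * L) = (q - 1) * L + e"
      unfolding e(1) by auto
  qed
  moreover have "((q - 1) * L + e) div L + 1 = q"
    using e(2) q by simp
  ultimately show ?thesis
    unfolding played_def Let_def by (auto split: prod.split)
qed

lemma h_map_nonexpansive: "norm (h_map (setting P) x - h_map (setting P) y) \<le> norm (x - y)"
proof (cases "setting P")
  case (Nonmonotone u)
  have "h_map (setting P) x - h_map (setting P) y = (1 / 2) *\<^sub>R (x - y)"
    using Nonmonotone by (simp add: algebra_simps)
  then show ?thesis by simp
qed simp

lemma objective_lipschitz:
  assumes "t \<in> {1..T}" "x \<in> fdom P" "y \<in> fdom P"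
  shows "\<bar>objective P t j x - objective P t j y\<bar> \<le> \<bar>G\<bar> * norm (x - y)"
proof -
  have "\<bar>objective P t j x - objective P t j y\<bar> \<le> G * norm (x - y)"
    using lipschitz_onD[OF objective_regular(2)] assms by (simp add: dist_norm)
  also have "\<dots> \<le> \<bar>G\<bar> * norm (x - y)" by (intro mult_right_mono) auto
  finally show ?thesis .
qed

definition shrink :: "real^'d \<Rightarrow> real^'d" where
  "shrink u = (1 - \<delta> / r) *\<^sub>R u + (\<delta> / r) *\<^sub>R center P"

lemma shrink_in_shrunk: "u \<in> region P \<Longrightarrow> shrink u \<in> shrunk P"
  by (auto simp: shrink_def shrunk_def)

lemma shrink_in_region: "u \<in> region P \<Longrightarrow> shrink u \<in> region P"
  using shrink_in_shrunk shrunk_subset by blast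

lemma norm_minus_shrink_le:
  assumes u: "u \<in> region P" shows "norm (u - shrink u) \<le> 2 * R * \<delta> / r"
proof -
  have "u - shrink u = (\<delta> / r) *\<^sub>R (u - center P)"
    by (simp add: shrink_def algebra_simps)
  moreover have "norm (u - center P) \<le> 2 * R"
    using norm_triangle_ineq4[of u "center P"] norm_le_R[OF u] norm_le_R[OF region_facts(4)] by linarith
  then have "\<delta> / r * norm (u - center P) \<le> \<delta> / r * (2 * R)"
    using pos by (intro mult_left_mono) auto
  ultimately show ?thesis using pos by (simp add: mult.commute)
qed

text \<open>Besides the linearized term there are three errors: moving the comparator into the shrunk set,
  replacing the position of agent \<open>i\<close> by the position of the agent \<open>j\<close> whose objective is evaluated, and
  playing the query point instead of \<open>h(x)\<close> in the exploration round of the window.\<close>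

lemma round_regret_le:
  assumes s: "admissible s" and m: "m < blocks P" and q: "q \<in> {1..K}" and t: "t \<in> window P (Suc m) q"
    and u: "u \<in> region P"
  shows "approx_ratio (setting P) * objective P t j u - objective P t j (played P s t i)
    \<le> lin_coeff (setting P) * (grad_int t j (X s m j) \<bullet> (shrink u - X s m j))
      + \<bar>G\<bar> * (2 * R * \<delta> / r) + \<bar>G\<bar> * (spread * root_tol)
      + (if t = fst (snd (snd (s (Suc m, q, i)))) then \<bar>G\<bar> * (2 * R + r) else 0)"
proof -
  let ?f = "objective P t j" and ?h = "h_map (setting P)" and ?\<alpha> = "approx_ratio (setting P)"
  let ?a = "s (Suc m, q, i)"
  have mb: "Suc m \<in> {1..blocks P}" using m by auto
  have tT: "t \<in> {1..T}" using window_subset[OF mb q] t by auto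
  have a: "?a \<in> sample_range (Suc m) q" by (rule admissibleD[OF s m q])
  have h_in: "?h (X s m j) \<in> region P" for j by (rule h_map_in_region[OF X_in_region])
  have comparator: "?\<alpha> * ?f u \<le> ?\<alpha> * ?f (shrink u) + \<bar>G\<bar> * (2 * R * \<delta> / r)"
  proof -
    have "?f u - ?f (shrink u) \<le> \<bar>G\<bar> * norm (u - shrink u)"
      using objective_lipschitz[OF tT subsetD[OF fdom_facts(3) u] subsetD[OF fdom_facts(3) shrink_in_region[OF u]], of j]
      by linarith
    also have "\<dots> \<le> \<bar>G\<bar> * (2 * R * \<delta> / r)"
      by (intro mult_left_mono norm_minus_shrink_le u) auto
    finally have "?f u - ?f (shrink u) \<le> \<bar>G\<bar> * (2 * R * \<delta> / r)" .
    then have "?\<alpha> * (?f u - ?f (shrink u)) \<le> ?\<alpha> * (\<bar>G\<bar> * (2 * R * \<delta> / r))"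
      using approx_ratio_bounds by (intro mult_left_mono) auto
    also have "\<dots> \<le> 1 * (\<bar>G\<bar> * (2 * R * \<delta> / r))"
      using approx_ratio_bounds pos R_nonneg by (intro mult_right_mono) auto
    finally show ?thesis by (simp add: algebra_simps)
  qed
  have neighbour: "?f (?h (X s m j)) - \<bar>G\<bar> * (spread * root_tol) \<le> ?f (?h (X s m i))"
  proof -
    have "norm (?h (X s m j) - ?h (X s m i)) \<le> spread * root_tol"
      using h_map_nonexpansive[of "X s m j" "X s m i"] consensus[OF s, of m j i] m by linarith
    then have "\<bar>G\<bar> * norm (?h (X s m j) - ?h (X s m i)) \<le> \<bar>G\<bar> * (spread * root_tol)"
      by (intro mult_left_mono) auto
    then show ?thesis
      using objective_lipschitz[OF tT subsetD[OF fdom_facts(3) h_in[of j]] subsetD[OF fdom_facts(3) h_in[of i]], of j]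
      by linarith
  qed
  have exploration: "?f (?h (X s m i)) - (if t = fst (snd (snd ?a)) then \<bar>G\<bar> * (2 * R + r) else 0)
      \<le> ?f (played P s t i)"
  proof (cases "t = fst (snd (snd ?a))")
    case True
    obtain v z t' \<xi> where a_eq: "?a = (v, z, t', \<xi>)" by (cases ?a)
    have v: "norm v = 1" "z \<in> {0..1}" using a by (auto simp: a_eq sample_range_def)
    let ?w = "w_map (setting P) (X s m i) z"
    have "norm (?h (X s m i) - query_point P (X s m i) ?a) \<le> norm (?h (X s m i)) + norm ?w + norm (\<delta> *\<^sub>R v)"
      unfolding a_eq query_point_def prod.case
      using norm_triangle_ineq4[of "?h (X s m i)" "?w + \<delta> *\<^sub>R v"] norm_triangle_ineq[of ?w "\<delta> *\<^sub>R v"] by linarith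
    also have "\<dots> \<le> R + R + \<delta>"
      using norm_le_R[OF h_in[of i]] norm_le_R[OF w_map_in_region[OF X_in_region v(2)], of s m i] v pos by simp
    also have "\<dots> \<le> 2 * R + r" using pos by simp
    finally have "\<bar>G\<bar> * norm (?h (X s m i) - query_point P (X s m i) ?a) \<le> \<bar>G\<bar> * (2 * R + r)"
      by (intro mult_left_mono) auto
    moreover have "query_point P (X s m i) ?a \<in> fdom P" by (rule query_point_in_fdom[OF X_in_region a])
    ultimately show ?thesis
      using objective_lipschitz[OF tT subsetD[OF fdom_facts(3) h_in[of i]], of "query_point P (X s m i) ?a" j] True
      unfolding played_eq[OF q t] by simp
  qed (simp add: played_eq[OF q t])
  have "?\<alpha> * ?f (shrink u) - ?f (?h (X s m j)) \<le> lin_coeff (setting P) * (grad_int t j (X s m j) \<bullet> (shrink u - X s m j))"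
    by (rule one_point_linearization[OF tT X_in_region shrink_in_region[OF u]])
  then show ?thesis using comparator neighbour exploration by linarith
qed

definition linearized_total :: "('n, 'd, 's) samples \<Rightarrow> real^'d \<Rightarrow> real" where
  "linearized_total s u = (\<Sum>m<blocks P. \<Sum>q=1..K. \<Sum>j\<in>UNIV. \<Sum>t\<in>window P (Suc m) q.
     grad_int t j (X s m j) \<bullet> (u - X s m j))"

lemma regret_le:
  assumes s: "admissible s" and u: "u \<in> region P"
    and best: "(SUP u\<in>region P. avg_total P (\<lambda>t. u)) = avg_total P (\<lambda>t. u)"
  shows "regret P s i \<le> lin_coeff (setting P) / real CARD('n) * linearized_total s (shrink u)
    + real T * (\<bar>G\<bar> * (2 * R * \<delta> / r) + \<bar>G\<bar> * (spread * root_tol)) + real T / real L * (\<bar>G\<bar> * (2 * R + r))"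
proof -
  let ?\<alpha> = "approx_ratio (setting P)" and ?\<beta> = "lin_coeff (setting P)" and ?N = "real CARD('n)"
  let ?tau = "\<lambda>m q. fst (snd (snd (s (Suc m, q, i))))"
  define e1 where "e1 = \<bar>G\<bar> * (2 * R * \<delta> / r) + \<bar>G\<bar> * (spread * root_tol)"
  define e2 where "e2 = \<bar>G\<bar> * (2 * R + r)"
  have e2: "0 \<le> e2" using R_nonneg pos by (simp add: e2_def)
  have blocksum: "(\<Sum>t\<in>window P (Suc m) q. \<Sum>j\<in>UNIV. ?\<alpha> * objective P t j u - objective P t j (played P s t i))
      \<le> ?\<beta> * (\<Sum>j\<in>UNIV. \<Sum>t\<in>window P (Suc m) q. grad_int t j (X s m j) \<bullet> (shrink u - X s m j))
        + ?N * (real L * e1 + e2)"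
    if m: "m < blocks P" and q: "q \<in> {1..K}" for m q
  proof -
    have W: "card (window P (Suc m) q) = L" "finite (window P (Suc m) q)" using q window_card by auto
    have "(\<Sum>t\<in>window P (Suc m) q. \<Sum>j\<in>UNIV. ?\<alpha> * objective P t j u - objective P t j (played P s t i))
      \<le> (\<Sum>t\<in>window P (Suc m) q. \<Sum>j\<in>UNIV. ?\<beta> * (grad_int t j (X s m j) \<bullet> (shrink u - X s m j)) + e1
          + (if t = ?tau m q then e2 else 0))"
      using round_regret_le[OF s m q _ u] unfolding e1_def e2_def by (intro sum_mono) (simp add: add.assoc)
    also have "\<dots> = ?\<beta> * (\<Sum>j\<in>UNIV. \<Sum>t\<in>window P (Suc m) q. grad_int t j (X s m j) \<bullet> (shrink u - X s m j))
        + ?N * (real L * e1) + ?N * (\<Sum>t\<in>window P (Suc m) q. if t = ?tau m q then e2 else 0)"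
      using W by (subst sum.swap) (simp add: sum.distrib sum_distrib_left)
    also have "(\<Sum>t\<in>window P (Suc m) q. if t = ?tau m q then e2 else 0) \<le> e2"
      using W e2 by (simp add: sum.delta)
    finally show ?thesis by (simp add: distrib_left mult_left_mono)
  qed
  have "regret P s i = ?\<alpha> * avg_total P (\<lambda>t. u) - avg_total P (\<lambda>t. played P s t i)"
    by (simp add: regret_def best)
  also have "\<dots> = (\<Sum>t=1..T. \<Sum>j\<in>UNIV. ?\<alpha> * objective P t j u - objective P t j (played P s t i)) / ?N"
    by (simp only: avg_total_def sum_subtractf sum_distrib_left[symmetric]) (simp add: diff_divide_distrib)
  also have "(\<Sum>t=1..T. \<Sum>j\<in>UNIV. ?\<alpha> * objective P t j u - objective P t j (played P s t i))
      = (\<Sum>m<blocks P. \<Sum>q=1..K. \<Sum>t\<in>window P (Suc m) q. \<Sum>j\<in>UNIV. ?\<alpha> * objective P t j u - objective P t j (played P s t i))"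
    by (rule sum_over_windows)
  also have "\<dots> \<le> (\<Sum>m<blocks P. \<Sum>q=1..K.
      ?\<beta> * (\<Sum>j\<in>UNIV. \<Sum>t\<in>window P (Suc m) q. grad_int t j (X s m j) \<bullet> (shrink u - X s m j))
        + ?N * (real L * e1 + e2))"
    by (intro sum_mono blocksum) auto
  also have "\<dots> = ?\<beta> * linearized_total s (shrink u) + real (blocks P) * real K * (?N * (real L * e1 + e2))"
    unfolding linearized_total_def by (simp add: sum.distrib sum_distrib_left)
  also have "real (blocks P) * real K * (?N * (real L * e1 + e2)) = ?N * (real T * e1 + real T / real L * e2)"
    using pos unfolding real_horizon_eq by (simp add: algebra_simps)
  finally have "regret P s i \<le> (?\<beta> * linearized_total s (shrink u) + ?N * (real T * e1 + real T / real L * e2)) / ?N"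
    by (simp add: divide_right_mono)
  also have "\<dots> = ?\<beta> / ?N * linearized_total s (shrink u) + real T * e1 + real T / real L * e2"
    by (simp add: add_divide_distrib)
  finally show ?thesis by (simp add: e1_def e2_def)
qed

end

section \<open>The expected regret\<close>

lemma (in bandit) admissible_samples:
  assumes "sampling_ok P \<Omega> S" "\<omega> \<in> space \<Omega>"
  shows "admissible (\<lambda>a. S a \<omega>)"
  using assms unfolding sampling_ok_def admissible_def sample_range_def by blast

text \<open>The summands are the coefficients of \<open>L / \<eta>\<close>, \<open>\<eta> T K / \<delta>\<^sup>2\<close>, \<open>\<delta> T\<close> and \<open>T / L\<close>, in this order.\<close>

definition (in bandit) regret_const :: real where
  "regret_const = 2 * R\<^sup>2 + (est_bound\<^sup>2 / 2 + est_bound * (2 + spread) + r * \<bar>G\<bar> * spread)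
    + (2 * R * real k * \<bar>M\<bar> + 2 * R * \<bar>G\<bar> / r) + \<bar>G\<bar> * (2 * R + r)"

context bandit_measurable
begin

lemma expected_regret_le:
  assumes sampling: "sampling_ok P \<Omega> S"
  shows "(\<integral>\<omega>. regret P (\<lambda>a. S a \<omega>) i \<partial>\<Omega>)
    \<le> regret_const * (L / \<eta> + \<eta> * T * K / \<delta>\<^sup>2 + \<delta> * T + T / L)"
proof -
  interpret prob_space \<Omega> using sampling by (simp add: sampling_ok_def)
  let ?\<beta> = "lin_coeff (setting P)" and ?N = "real CARD('n)"
  let ?s = "\<lambda>\<omega> a. S a \<omega>"
  define c2 where "c2 = est_bound\<^sup>2 / 2 + est_bound * (2 + spread)"
  define e where "e = 2 * R * real k * \<bar>M\<bar> * \<delta>"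
  define rest where "rest = real T * (\<bar>G\<bar> * (2 * R * \<delta> / r) + \<bar>G\<bar> * (spread * root_tol)) + real T / real L * (\<bar>G\<bar> * (2 * R + r))"
  define bound where "bound = regret_const * (L / \<eta> + \<eta> * T * K / \<delta>\<^sup>2 + \<delta> * T + T / L)"
  have c2: "0 \<le> c2" using est_bound_nonneg spread_nonneg by (simp add: c2_def)
  have \<beta>: "0 \<le> ?\<beta>" "?\<beta> \<le> 1" using lin_coeff_bounds[OF setting_ok] by auto
  obtain u0 where u0: "u0 \<in> region P" "(SUP u\<in>region P. avg_total P (\<lambda>t. u)) = avg_total P (\<lambda>t. u0)"
    using best_point_exists by blast
  define u where "u = shrink u0"
  have u: "u \<in> shrunk P" "u \<in> region P" using u0 shrink_in_shrunk shrink_in_region by (auto simp: u_def)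
  define \<Psi> where "\<Psi> \<omega> m q j = estimate_mean \<Omega> S u m q j (X (?s \<omega>) m j)" for \<omega> m q j
  define \<Theta> where "\<Theta> \<omega> m q j = (u - X (?s \<omega>) m j) \<bullet> estimate P j (X (?s \<omega>) m j) (S (Suc m, q, j) \<omega>)" for \<omega> m q j
  have adm: "admissible (?s \<omega>)" if "\<omega> \<in> space \<Omega>" for \<omega>
    by (rule admissible_samples[OF sampling that])
  have lin_le: "linearized_total (?s \<omega>) u \<le> L * (\<Sum>m<blocks P. \<Sum>q=1..K. \<Sum>j\<in>UNIV. \<Psi> \<omega> m q j) + real T * ?N * e" for \<omega>
  proof -
    have "linearized_total (?s \<omega>) u \<le> (\<Sum>m<blocks P. \<Sum>q=1..K. \<Sum>j\<in>(UNIV::'n set). L * \<Psi> \<omega> m q j + L * e)"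
      unfolding linearized_total_def
    proof (intro sum_mono)
      fix m q and j :: 'n assume "m \<in> {..<blocks P}" and q: "q \<in> {1..K}"
      then have m: "m < blocks P" by simp
      let ?x = "X (?s \<omega>) m j"
      have "norm (u - ?x) \<le> 2 * R"
        using norm_triangle_ineq4[of u ?x] norm_le_R[OF u(2)] norm_le_R[OF X_in_region, of "?s \<omega>" m j] by linarith
      moreover have "real k * M * \<delta> \<le> real k * \<bar>M\<bar> * \<delta>"
        using pos by (intro mult_right_mono mult_left_mono) auto
      ultimately have "real k * M * \<delta> * norm (u - ?x) \<le> real k * \<bar>M\<bar> * \<delta> * (2 * R)"
        using pos by (intro mult_mono[of "real k * M * \<delta>"]) auto
      also have "\<dots> = e" by (simp add: e_def)
      finally have "(\<Sum>t\<in>window P (Suc m) q. grad_int t j ?x \<bullet> (u - ?x)) / L \<le> \<Psi> \<omega> m q j + e"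
        using estimate_mean_ge[OF sampling m q u(2) X_in_region, of j "?s \<omega>" m j] unfolding \<Psi>_def by linarith
      then show "(\<Sum>t\<in>window P (Suc m) q. grad_int t j ?x \<bullet> (u - ?x)) \<le> L * \<Psi> \<omega> m q j + L * e"
        using pos by (simp add: divide_le_eq algebra_simps)
    qed
    also have "\<dots> = L * (\<Sum>m<blocks P. \<Sum>q=1..K. \<Sum>j\<in>UNIV. \<Psi> \<omega> m q j) + real T * ?N * e"
      unfolding real_horizon_eq by (simp add: sum.distrib sum_distrib_left)
    finally show ?thesis .
  qed
  define D where "D \<omega> = ?\<beta> / ?N * (L * (\<Sum>m<blocks P. \<Sum>q=1..K. \<Sum>j\<in>UNIV. \<Psi> \<omega> m q j) + real T * ?N * e) + rest" for \<omega>
  have regret_D: "regret P (?s \<omega>) i \<le> D \<omega>" if "\<omega> \<in> space \<Omega>" for \<omega>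
  proof -
    have "?\<beta> / ?N * linearized_total (?s \<omega>) u \<le> ?\<beta> / ?N * (L * (\<Sum>m<blocks P. \<Sum>q=1..K. \<Sum>j\<in>UNIV. \<Psi> \<omega> m q j) + real T * ?N * e)"
      using \<beta> by (intro mult_left_mono lin_le) auto
    then show ?thesis
      using regret_le[OF adm[OF that] u0, of i] unfolding D_def rest_def u_def by linarith
  qed
  have int_\<Psi>: "integrable \<Omega> (\<lambda>\<omega>. \<Psi> \<omega> m q j)" and exp_\<Psi>: "(\<integral>\<omega>. \<Psi> \<omega> m q j \<partial>\<Omega>) = (\<integral>\<omega>. \<Theta> \<omega> m q j \<partial>\<Omega>)"
    and int_\<Theta>: "integrable \<Omega> (\<lambda>\<omega>. \<Theta> \<omega> m q j)" if "m < blocks P" "q \<in> {1..K}" for m q j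
    using integrable_estimate_mean[OF sampling that u(2), of j] expectation_estimate[OF sampling that u(2), of j]
      integrable_estimate[OF sampling that u(2), of j] by (simp_all only: \<Psi>_def \<Theta>_def)
  have "(\<integral>\<omega>. (\<Sum>m<blocks P. \<Sum>q=1..K. \<Sum>j\<in>UNIV. \<Psi> \<omega> m q j) \<partial>\<Omega>)
      = (\<integral>\<omega>. (\<Sum>m<blocks P. \<Sum>q=1..K. \<Sum>j\<in>UNIV. \<Theta> \<omega> m q j) \<partial>\<Omega>)"
  proof -
    have swap: "(\<integral>\<omega>. (\<Sum>m<blocks P. \<Sum>q=1..K. \<Sum>j\<in>UNIV. F \<omega> m q j) \<partial>\<Omega>)
        = (\<Sum>m<blocks P. \<Sum>q=1..K. \<Sum>j\<in>UNIV. \<integral>\<omega>. F \<omega> m q j \<partial>\<Omega>)"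
      if int: "\<And>m q j. m < blocks P \<Longrightarrow> q \<in> {1..K} \<Longrightarrow> integrable \<Omega> (\<lambda>\<omega>. F \<omega> m q j)"
      for F :: "_ \<Rightarrow> nat \<Rightarrow> nat \<Rightarrow> 'n \<Rightarrow> real"
    proof -
      have "(\<integral>\<omega>. (\<Sum>m<blocks P. \<Sum>q=1..K. \<Sum>j\<in>UNIV. F \<omega> m q j) \<partial>\<Omega>)
          = (\<Sum>m<blocks P. \<integral>\<omega>. (\<Sum>q=1..K. \<Sum>j\<in>UNIV. F \<omega> m q j) \<partial>\<Omega>)"
        by (intro Bochner_Integration.integral_sum Bochner_Integration.integrable_sum int) auto
      also have "\<dots> = (\<Sum>m<blocks P. \<Sum>q=1..K. \<integral>\<omega>. (\<Sum>j\<in>UNIV. F \<omega> m q j) \<partial>\<Omega>)"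
        by (intro sum.cong refl Bochner_Integration.integral_sum Bochner_Integration.integrable_sum int) auto
      also have "\<dots> = (\<Sum>m<blocks P. \<Sum>q=1..K. \<Sum>j\<in>UNIV. \<integral>\<omega>. F \<omega> m q j \<partial>\<Omega>)"
        by (intro sum.cong refl Bochner_Integration.integral_sum int) auto
      finally show ?thesis .
    qed
    have "(\<Sum>m<blocks P. \<Sum>q=1..K. \<Sum>j\<in>UNIV. \<integral>\<omega>. \<Psi> \<omega> m q j \<partial>\<Omega>)
        = (\<Sum>m<blocks P. \<Sum>q=1..K. \<Sum>j\<in>UNIV. \<integral>\<omega>. \<Theta> \<omega> m q j \<partial>\<Omega>)"
      by (intro sum.cong refl exp_\<Psi>) auto
    from trans[OF swap[of \<Psi>, OF int_\<Psi>] trans[OF this swap[of \<Theta>, OF int_\<Theta>, symmetric]]]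
    show ?thesis by simp
  qed
  also have "\<dots> \<le> ?N * (2 * R\<^sup>2 / \<eta> + real (blocks P) * ((real K)\<^sup>2 * \<eta> / \<delta>\<^sup>2) * c2)"
  proof (rule integral_le_const)
    show "integrable \<Omega> (\<lambda>\<omega>. \<Sum>m<blocks P. \<Sum>q=1..K. \<Sum>j\<in>UNIV. \<Theta> \<omega> m q j)"
      by (intro Bochner_Integration.integrable_sum int_\<Theta>) auto
    show "AE \<omega> in \<Omega>. (\<Sum>m<blocks P. \<Sum>q=1..K. \<Sum>j\<in>UNIV. \<Theta> \<omega> m q j)
        \<le> ?N * (2 * R\<^sup>2 / \<eta> + real (blocks P) * ((real K)\<^sup>2 * \<eta> / \<delta>\<^sup>2) * c2)"
    proof (rule AE_I2)
      fix \<omega> assume \<omega>: "\<omega> \<in> space \<Omega>"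
      have "(\<Sum>m<blocks P. \<Sum>q=1..K. \<Sum>j\<in>UNIV. \<Theta> \<omega> m q j)
          = (\<Sum>m<blocks P. \<Sum>j\<in>UNIV. block_estimate (?s \<omega>) m j \<bullet> (u - X (?s \<omega>) m j))"
        unfolding \<Theta>_def block_estimate_def inner_sum_left
        by (subst (2) sum.swap) (simp add: inner_commute)
      then show "(\<Sum>m<blocks P. \<Sum>q=1..K. \<Sum>j\<in>UNIV. \<Theta> \<omega> m q j)
          \<le> ?N * (2 * R\<^sup>2 / \<eta> + real (blocks P) * ((real K)\<^sup>2 * \<eta> / \<delta>\<^sup>2) * c2)"
        using linear_regret_bound[OF adm[OF \<omega>] u(1)] by (simp only: c2_def)
    qed
  qed
  finally have exp_sum: "(\<integral>\<omega>. (\<Sum>m<blocks P. \<Sum>q=1..K. \<Sum>j\<in>UNIV. \<Psi> \<omega> m q j) \<partial>\<Omega>)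
      \<le> ?N * (2 * R\<^sup>2 / \<eta> + real (blocks P) * ((real K)\<^sup>2 * \<eta> / \<delta>\<^sup>2) * c2)" .
  have int_sum: "integrable \<Omega> (\<lambda>\<omega>. \<Sum>m<blocks P. \<Sum>q=1..K. \<Sum>j\<in>UNIV. \<Psi> \<omega> m q j)"
    by (intro Bochner_Integration.integrable_sum int_\<Psi>) auto
  have int_D: "integrable \<Omega> D" unfolding D_def using int_sum by simp
  have split: "regret_const = 2 * R\<^sup>2 + (c2 + r * \<bar>G\<bar> * spread) + (2 * R * real k * \<bar>M\<bar> + 2 * R * \<bar>G\<bar> / r) + \<bar>G\<bar> * (2 * R + r)"
    by (simp add: regret_const_def c2_def)
  have terms_nonneg: "0 \<le> 2 * R\<^sup>2" "0 \<le> c2 + r * \<bar>G\<bar> * spread" "0 \<le> 2 * R * real k * \<bar>M\<bar> + 2 * R * \<bar>G\<bar> / r" "0 \<le> \<bar>G\<bar> * (2 * R + r)"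
    using c2 R_nonneg pos spread_nonneg by auto
  have rates_nonneg: "0 \<le> L / \<eta>" "0 \<le> \<eta> * T * K / \<delta>\<^sup>2" "0 \<le> \<delta> * T" "0 \<le> real T / real L"
    using pos by auto
  have "(\<integral>\<omega>. D \<omega> \<partial>\<Omega>) \<le> bound"
  proof -
    have "(\<integral>\<omega>. D \<omega> \<partial>\<Omega>) = ?\<beta> / ?N * (L * (\<integral>\<omega>. (\<Sum>m<blocks P. \<Sum>q=1..K. \<Sum>j\<in>UNIV. \<Psi> \<omega> m q j) \<partial>\<Omega>) + real T * ?N * e) + rest"
      unfolding D_def using int_sum by (simp add: prob_space)
    also have "\<dots> \<le> ?\<beta> / ?N * (L * (?N * (2 * R\<^sup>2 / \<eta> + real (blocks P) * ((real K)\<^sup>2 * \<eta> / \<delta>\<^sup>2) * c2)) + real T * ?N * e) + rest"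
      using \<beta> exp_sum by (intro add_mono mult_left_mono) auto
    also have "\<dots> = ?\<beta> * (L * (2 * R\<^sup>2 / \<eta> + real (blocks P) * ((real K)\<^sup>2 * \<eta> / \<delta>\<^sup>2) * c2) + real T * e) + rest"
      by (simp add: field_simps)
    also have "\<dots> \<le> 1 * (L * (2 * R\<^sup>2 / \<eta> + real (blocks P) * ((real K)\<^sup>2 * \<eta> / \<delta>\<^sup>2) * c2) + real T * e) + rest"
      using \<beta> c2 pos R_nonneg unfolding e_def
      by (intro add_mono mult_right_mono order_refl add_nonneg_nonneg mult_nonneg_nonneg divide_nonneg_nonneg) auto
    also have "\<dots> = 2 * R\<^sup>2 * (L / \<eta>) + c2 * (\<eta> * T * K / \<delta>\<^sup>2)
        + (2 * R * real k * \<bar>M\<bar>) * (\<delta> * T) + rest"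
      unfolding real_horizon_eq e_def by (simp add: algebra_simps power2_eq_square)
    also have "rest = (2 * R * \<bar>G\<bar> / r) * (\<delta> * T) + (\<bar>G\<bar> * spread) * (T * root_tol) + \<bar>G\<bar> * (2 * R + r) * (T / L)"
      by (simp add: rest_def algebra_simps)
    also have "(\<bar>G\<bar> * spread) * (T * root_tol) \<le> (\<bar>G\<bar> * spread) * (r * (\<eta> * T * K / \<delta>\<^sup>2))"
    proof (intro mult_left_mono)
      have "T * root_tol = \<delta> * (\<eta> * T * K / \<delta>\<^sup>2)" using pos by (simp add: root_tol_def power2_eq_square)
      also have "\<dots> \<le> r * (\<eta> * T * K / \<delta>\<^sup>2)" using pos rates_nonneg by (intro mult_right_mono) auto
      finally show "T * root_tol \<le> r * (\<eta> * T * K / \<delta>\<^sup>2)" .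
    qed (use spread_nonneg in auto)
    finally have "(\<integral>\<omega>. D \<omega> \<partial>\<Omega>) \<le> 2 * R\<^sup>2 * (L / \<eta>) + c2 * (\<eta> * T * K / \<delta>\<^sup>2) + (2 * R * real k * \<bar>M\<bar>) * (\<delta> * T)
        + ((2 * R * \<bar>G\<bar> / r) * (\<delta> * T) + (\<bar>G\<bar> * spread) * (r * (\<eta> * T * K / \<delta>\<^sup>2)) + \<bar>G\<bar> * (2 * R + r) * (T / L))"
      by simp
    note collected = this
    have "(\<integral>\<omega>. D \<omega> \<partial>\<Omega>) \<le> 2 * R\<^sup>2 * (L / \<eta>) + (c2 + r * \<bar>G\<bar> * spread) * (\<eta> * T * K / \<delta>\<^sup>2)
        + (2 * R * real k * \<bar>M\<bar> + 2 * R * \<bar>G\<bar> / r) * (\<delta> * T) + \<bar>G\<bar> * (2 * R + r) * (T / L)"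
    proof -
      have "a + c * x + p * y + (p' * y + (g * s) * (r' * x) + h) = a + (c + r' * g * s) * x + (p + p') * y + h"
        for a c x p y p' g s r' h :: real by (simp add: algebra_simps)
      from collected[unfolded this] show ?thesis .
    qed
    also have "\<dots> \<le> regret_const * (L / \<eta>) + regret_const * (\<eta> * T * K / \<delta>\<^sup>2)
        + regret_const * (\<delta> * T) + regret_const * (T / L)"
    proof -
      have "2 * R\<^sup>2 \<le> regret_const" "c2 + r * \<bar>G\<bar> * spread \<le> regret_const"
        "2 * R * real k * \<bar>M\<bar> + 2 * R * \<bar>G\<bar> / r \<le> regret_const" "\<bar>G\<bar> * (2 * R + r) \<le> regret_const"
        unfolding split using terms_nonneg by linarith+
      then show ?thesis by (intro add_mono mult_right_mono rates_nonneg)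
    qed
    also have "\<dots> = bound" by (simp add: bound_def distrib_left)
    finally show ?thesis .
  qed
  \<comment> \<open>The integral of a function that is not integrable is zero by convention.\<close>
  moreover have "(\<integral>\<omega>. regret P (?s \<omega>) i \<partial>\<Omega>) \<le> max 0 (\<integral>\<omega>. D \<omega> \<partial>\<Omega>)"
  proof (cases "integrable \<Omega> (\<lambda>\<omega>. regret P (?s \<omega>) i)")
    case True
    then have "(\<integral>\<omega>. regret P (?s \<omega>) i \<partial>\<Omega>) \<le> (\<integral>\<omega>. D \<omega> \<partial>\<Omega>)"
      using int_D regret_D by (intro integral_mono) auto
    then show ?thesis by simp
  qed (simp add: not_integrable_integral_eq)
  moreover have "0 \<le> bound"
  proof -
    have "0 \<le> regret_const" unfolding split using terms_nonneg by linarith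
    then show ?thesis unfolding bound_def using rates_nonneg
      by (intro mult_nonneg_nonneg[of regret_const] add_nonneg_nonneg)
  qed
  ultimately show ?thesis unfolding bound_def by linarith
qed

end

text \<open>Setting the responses after the horizon to zero makes all responses measurable without
  affecting a run on admissible samples, as these query only rounds up to the horizon.\<close>

definition mute_after_horizon :: "('n::finite, 'd::finite, 's) problem \<Rightarrow> ('n, 'd, 's) problem" where
  "mute_after_horizon P = P\<lparr>response := \<lambda>t i x \<xi>. if t \<in> {1..horizon P} then response P t i x \<xi> else 0\<rparr>"

lemma mute_simps [simp]:
  "region (mute_after_horizon P) = region P" "setting (mute_after_horizon P) = setting P"
  "fdom (mute_after_horizon P) = fdom P" "objective (mute_after_horizon P) = objective P"
  "seed_law (mute_after_horizon P) = seed_law P" "edges (mute_after_horizon P) = edges P"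
  "weights (mute_after_horizon P) = weights P" "center (mute_after_horizon P) = center P"
  "radius (mute_after_horizon P) = radius P" "horizon (mute_after_horizon P) = horizon P"
  "par_K (mute_after_horizon P) = par_K P" "par_L (mute_after_horizon P) = par_L P"
  "par_eta (mute_after_horizon P) = par_eta P" "par_delta (mute_after_horizon P) = par_delta P"
  "lmo (mute_after_horizon P) = lmo P" "proj_alg (mute_after_horizon P) = proj_alg P"
  "response (mute_after_horizon P) = (\<lambda>t i x \<xi>. if t \<in> {1..horizon P} then response P t i x \<xi> else 0)"
  by (simp_all add: mute_after_horizon_def)

lemma mute_defs [simp]:
  fixes P :: "('n::finite, 'd::finite, 's) problem"
  shows "max_norm (mute_after_horizon P) = max_norm P" "directions (mute_after_horizon P) = directions P"
    "shrunk (mute_after_horizon P) = shrunk P" "tolerance (mute_after_horizon P) = tolerance P"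
    "blocks (mute_after_horizon P) = blocks P" "window (mute_after_horizon P) = window P"
    "mix (mute_after_horizon P) = mix P" "query_point (mute_after_horizon P) = query_point P"
    "avg_total (mute_after_horizon P) = avg_total P"
  by (simp_all add: max_norm_def directions_def shrunk_def tolerance_def blocks_def window_def fun_eq_iff
      mix_def query_point_def avg_total_def)

context bandit
begin

lemma bandit_measurable_mute: "bandit_measurable (mute_after_horizon P) \<gamma> G M B0"
proof
  show "region_ok (mute_after_horizon P)" using region by (simp add: region_ok_def)
  show "network_ok (mute_after_horizon P)" using network by (simp add: network_ok_def)
  show "lambda2 (weights (mute_after_horizon P)) < 1" using spectral_gap by simp
  show "parameters_ok (mute_after_horizon P)" using parameters by (simp add: parameters_ok_def)
  show "case_ok \<gamma> (mute_after_horizon P)" using case_conditions unfolding case_ok_def mute_simps .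
  show "regular_ok G M (mute_after_horizon P)" using regular by (simp add: regular_ok_def)
  show "oracle_ok B0 (mute_after_horizon P)" using responses by (simp add: oracle_ok_def)
  show "projection_ok (mute_after_horizon P)" using projection by (simp add: projection_ok_def)
  show "(\<lambda>(x, \<xi>). response (mute_after_horizon P) t i x \<xi>) \<in> borel_measurable (borel \<Otimes>\<^sub>M seed_law (mute_after_horizon P))" for t i
    using responses by (cases "t \<in> {1..T}") (auto simp: oracle_ok_def)
qed

lemma estimate_mute:
  assumes "a \<in> sample_range m q" "m \<in> {1..blocks P}" "q \<in> {1..K}"
  shows "estimate (mute_after_horizon P) i x a = estimate P i x a"
  using assms(1) window_subset[OF assms(2,3)]
  by (cases a) (auto simp: sample_range_def estimate_def)

lemma run_alg_mute:
  assumes s: "admissible s" and m: "m \<le> blocks P"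
  shows "run_alg (mute_after_horizon P) s m = run_alg P s m"
  using m
proof (induction m)
  case (Suc m)
  have "(\<Sum>q=1..K. estimate (mute_after_horizon P) i x (s (Suc m, q, i))) = (\<Sum>q=1..K. estimate P i x (s (Suc m, q, i)))" for i x
    using Suc.prems by (intro sum.cong refl estimate_mute[OF admissibleD[OF s]]) auto
  then show ?case using Suc by (simp add: Let_def)
qed simp

lemma regret_mute:
  assumes s: "admissible s"
  shows "regret (mute_after_horizon P) s i = regret P s i"
proof -
  have "played (mute_after_horizon P) s t i = played P s t i" if t: "t \<in> {1..T}" for t
  proof -
    have "t - 1 < blocks P * (K * L)" using t horizon_eq by auto
    then have "(t - 1) div (K * L) < blocks P" by (rule less_mult_imp_div_less)
    then have "run_alg (mute_after_horizon P) s ((t - 1) div (K * L) + 1 - 1) = run_alg P s ((t - 1) div (K * L) + 1 - 1)"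
      by (simp add: run_alg_mute[OF s])
    then show ?thesis unfolding played_def Let_def mute_simps mute_defs by (simp only:)
  qed
  then have "avg_total P (\<lambda>t. played (mute_after_horizon P) s t i) = avg_total P (\<lambda>t. played P s t i)"
    unfolding avg_total_def by (intro arg_cong2[where f = "(*)"] refl sum.cong) simp
  then show ?thesis by (simp add: regret_def)
qed

lemma regret_bound:
  assumes sampling: "sampling_ok P \<Omega> S"
  shows "(\<integral>\<omega>. regret P (\<lambda>a. S a \<omega>) i \<partial>\<Omega>)
    \<le> regret_const * (L / \<eta> + \<eta> * T * K / \<delta>\<^sup>2 + \<delta> * T + T / L)"
proof -
  interpret muted: bandit_measurable "mute_after_horizon P" \<gamma> G M B0 by (rule bandit_measurable_mute)
  have "sampling_ok (mute_after_horizon P) \<Omega> S"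
    using sampling by (simp add: sampling_ok_def)
  from muted.expected_regret_le[OF this, of i]
  have "(\<integral>\<omega>. regret (mute_after_horizon P) (\<lambda>a. S a \<omega>) i \<partial>\<Omega>)
    \<le> regret_const * (L / \<eta> + \<eta> * T * K / \<delta>\<^sup>2 + \<delta> * T + T / L)"
    by (simp add: muted.regret_const_def regret_const_def muted.est_bound_def est_bound_def muted.spread_def spread_def)
  also have "(\<integral>\<omega>. regret (mute_after_horizon P) (\<lambda>a. S a \<omega>) i \<partial>\<Omega>) = (\<integral>\<omega>. regret P (\<lambda>a. S a \<omega>) i \<partial>\<Omega>)"
    by (intro Bochner_Integration.integral_cong refl regret_mute admissible_samples[OF sampling])
  finally show ?thesis .
qed

end

theorem theorem6:
  fixes \<gamma> R r lam G M B0 :: real and k :: nat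
  assumes "lam < 1"
  shows "\<exists>C>0. \<forall>(P :: ('n::finite, 'd::finite, 's) problem) (\<Omega> :: 'w measure) S.
     region_ok P \<and> max_norm P = R \<and> radius P = r \<and> dim (directions P) = k \<and>
     network_ok P \<and> lambda2 (weights P) = lam \<and>
     parameters_ok P \<and> case_ok \<gamma> P \<and> regular_ok G M P \<and> oracle_ok B0 P \<and>
     projection_ok P \<and> sampling_ok P \<Omega> S \<longrightarrow>
     (let T = real (horizon P); K = real (par_K P); L = real (par_L P);
          \<eta> = par_eta P; \<delta> = par_delta P; \<epsilon> = tolerance P;
          final = (\<lambda>\<omega>. run_alg P (\<lambda>a. S a \<omega>) (blocks P))
      in
        (\<forall>i. (\<integral>\<omega>. regret P (\<lambda>a. S a \<omega>) i \<partial>\<Omega>) \<le> C * (L / \<eta> + \<eta> * T * K / \<delta>\<^sup>2 + \<delta> * T + T / L)) \<and>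
        (\<forall>i. \<forall>\<omega>\<in>space \<Omega>. real (loo_calls (final \<omega>) i) \<le> C * (T / (\<epsilon> * K * L))) \<and>
        (\<forall>\<omega>\<in>space \<Omega>. real (\<Sum>i\<in>UNIV. comms (final \<omega>) i) \<le> C * (T / (K * L))) \<and>
        (\<forall>\<theta>. 0 \<le> \<theta> \<and> \<theta> \<le> 4 / 5 \<and> K = T powr (1 - 5 * \<theta> / 4) \<and> \<delta> = T powr (- \<theta> / 4) \<and>
              L = T powr (\<theta> / 4) \<and> \<eta> = T powr (\<theta> / 2 - 1) \<longrightarrow>
           (\<forall>i. (\<integral>\<omega>. regret P (\<lambda>a. S a \<omega>) i \<partial>\<Omega>) \<le> C * T powr (1 - \<theta> / 4)) \<and>
           (\<forall>i. \<forall>\<omega>\<in>space \<Omega>. real (loo_calls (final \<omega>) i) \<le> C * T powr (2 * \<theta>)) \<and>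
           (\<forall>\<omega>\<in>space \<Omega>. real (\<Sum>i\<in>UNIV. comms (final \<omega>) i) \<le> C * T powr \<theta>)))"
proof -
  define c where "c = real k * \<bar>B0\<bar>"
  define e where "e = 4 * sqrt CARD('n) * (4 + c) / (1 - lam)"
  define C1 where "C1 = 2 * R\<^sup>2 + (c\<^sup>2 / 2 + c * (2 + e) + r * \<bar>G\<bar> * e)
    + (2 * R * real k * \<bar>M\<bar> + 2 * R * \<bar>G\<bar> / r) + \<bar>G\<bar> * (2 * R + r)"
  define C2 where "C2 = 27 * R\<^sup>2 * ((2 + c)^4 / 4 + 1)"
  \<comment> \<open>The factor four: for the particular choice of parameters all four rates coincide.\<close>
  define C where "C = 4 * \<bar>C1\<bar> + C2 + real CARD('n)"
  have C2: "0 \<le> C2" by (simp add: C2_def c_def)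
  have "0 < real CARD('n)" by simp
  then have C: "0 < C" "C1 \<le> C" "C2 \<le> C" "real CARD('n) \<le> C" "4 * C1 \<le> C"
    using C2 unfolding C_def by linarith+
  show ?thesis
  proof (intro exI[of _ C] conjI allI impI C(1))
    fix P :: "('n, 'd, 's) problem" and \<Omega> :: "'w measure" and S
    assume H: "region_ok P \<and> max_norm P = R \<and> radius P = r \<and> dim (directions P) = k \<and>
     network_ok P \<and> lambda2 (weights P) = lam \<and>
     parameters_ok P \<and> case_ok \<gamma> P \<and> regular_ok G M P \<and> oracle_ok B0 P \<and>
     projection_ok P \<and> sampling_ok P \<Omega> S"
    then interpret bandit P \<gamma> G M B0
      using assms by unfold_locales auto
    have sampling: "sampling_ok P \<Omega> S" using H by simp
    let ?T = "real (horizon P)" and ?K = "real (par_K P)" and ?L = "real (par_L P)"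
    let ?\<eta> = "par_eta P" and ?\<delta> = "par_delta P" and ?\<epsilon> = "tolerance P"
    let ?final = "\<lambda>\<omega>. run_alg P (\<lambda>a. S a \<omega>) (blocks P)"
    let ?rate = "?L / ?\<eta> + ?\<eta> * ?T * ?K / ?\<delta>\<^sup>2 + ?\<delta> * ?T + ?T / ?L"
    have rate: "0 \<le> ?rate" using pos by (intro add_nonneg_nonneg) auto
    have C1_eq: "regret_const = C1"
      using H by (simp add: regret_const_def C1_def est_bound_def spread_def c_def e_def)
    have regret: "(\<integral>\<omega>. regret P (\<lambda>a. S a \<omega>) i \<partial>\<Omega>) \<le> C1 * ?rate" for i
      using regret_bound[OF sampling, of i] unfolding C1_eq .
    have b: "real (blocks P) = ?T / (?K * ?L)"
      using pos unfolding real_horizon_eq by simp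
    have loo: "real (loo_calls (?final \<omega>) i) \<le> C2 * (?T / (?\<epsilon> * ?K * ?L))" if "\<omega> \<in> space \<Omega>" for \<omega> i
    proof -
      have "real (loo_calls (?final \<omega>) i) \<le> real (blocks P) * (C2 / ?\<epsilon>)"
        using loo_calls_le[OF admissible_samples[OF sampling that] order_refl, of i] H
        by (simp add: C2_def tolerance_eq est_bound_def c_def)
      then show ?thesis unfolding b by (simp add: mult_ac)
    qed
    have comm: "real (\<Sum>i\<in>UNIV. comms (?final \<omega>) i) = real CARD('n) * (?T / (?K * ?L))" for \<omega>
      by (simp add: comms_eq b)
    have q1: "0 \<le> ?T / (?\<epsilon> * ?K * ?L)" "0 \<le> ?T / (?K * ?L)"
      using pos by (auto simp: tolerance_eq)
    have R1: "(\<integral>\<omega>. regret P (\<lambda>a. S a \<omega>) i \<partial>\<Omega>) \<le> C * ?rate" for i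
      using regret[of i] mult_right_mono[OF C(2) rate] by linarith
    have R2: "real (loo_calls (?final \<omega>) i) \<le> C * (?T / (?\<epsilon> * ?K * ?L))" if "\<omega> \<in> space \<Omega>" for \<omega> i
      using loo[OF that, of i] mult_right_mono[OF C(3) q1(1)] by linarith
    have R3: "real (\<Sum>i\<in>UNIV. comms (?final \<omega>) i) \<le> C * (?T / (?K * ?L))" for \<omega>
      unfolding comm by (rule mult_right_mono[OF C(4) q1(2)])
    have R4: "(\<forall>i. (\<integral>\<omega>. regret P (\<lambda>a. S a \<omega>) i \<partial>\<Omega>) \<le> C * ?T powr (1 - \<theta> / 4)) \<and>
           (\<forall>i. \<forall>\<omega>\<in>space \<Omega>. real (loo_calls (?final \<omega>) i) \<le> C * ?T powr (2 * \<theta>)) \<and>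
           (\<forall>\<omega>\<in>space \<Omega>. real (\<Sum>i\<in>UNIV. comms (?final \<omega>) i) \<le> C * ?T powr \<theta>)"
      if \<theta>: "?K = ?T powr (1 - 5 * \<theta> / 4)" "?\<delta> = ?T powr (- \<theta> / 4)"
        "?L = ?T powr (\<theta> / 4)" "?\<eta> = ?T powr (\<theta> / 2 - 1)" for \<theta>
    proof -
      have T: "?T \<noteq> 0"
      proof
        assume "?T = 0"
        then show False using \<theta>(1) pos(1) by simp
      qed
      then have T0: "0 < ?T" by simp
      have T1: "?T powr 1 = ?T" using T0 by simp
      have dd: "?\<delta>\<^sup>2 = ?T powr (- \<theta> / 2)"
        unfolding \<theta>(2) power2_eq_square powr_add[symmetric] by (simp add: field_simps)
      have "?L / ?\<eta> = ?T powr (1 - \<theta> / 4)"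
        unfolding \<theta>(3,4) powr_diff[symmetric] by (simp add: field_simps)
      moreover have "?\<eta> * ?T * ?K / ?\<delta>\<^sup>2 = ?T powr (1 - \<theta> / 4)"
        unfolding dd \<theta>(1,4) 
        by (subst (2) T1[symmetric], unfold powr_diff[symmetric] powr_add[symmetric]) (simp add: field_simps)
      moreover have "?\<delta> * ?T = ?T powr (1 - \<theta> / 4)"
        unfolding \<theta>(2) by (subst (2) T1[symmetric], unfold powr_add[symmetric]) (simp add: field_simps)
      moreover have "?T / ?L = ?T powr (1 - \<theta> / 4)"
        unfolding \<theta>(3) by (subst T1[symmetric], unfold powr_diff[symmetric]) (simp add: field_simps)
      ultimately have rate_eq: "?rate = 4 * ?T powr (1 - \<theta> / 4)" by simp
      have KL: "?T / (?K * ?L) = ?T powr \<theta>"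
        unfolding \<theta>(1,3) by (subst T1[symmetric], unfold powr_diff[symmetric] powr_add[symmetric]) (simp add: field_simps)
      have KK: "?K\<^sup>2 = ?T powr (2 - 5 * \<theta> / 2)"
        unfolding \<theta>(1) power2_eq_square powr_add[symmetric] by (rule arg_cong[where f = "\<lambda>x. ?T powr x"]) simp
      have ee: "?\<eta>\<^sup>2 = ?T powr (\<theta> - 2)"
        unfolding \<theta>(4) power2_eq_square powr_add[symmetric] by (rule arg_cong[where f = "\<lambda>x. ?T powr x"]) simp
      have eps: "?\<epsilon> = ?T powr (- \<theta>)"
        unfolding tolerance_def dd KK ee powr_add[symmetric] powr_diff[symmetric]
        by (simp add: field_simps)
      have "?T / (?\<epsilon> * ?K * ?L) = (?T / (?K * ?L)) / ?\<epsilon>" by (simp add: mult.assoc)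
      also have "\<dots> = ?T powr (2 * \<theta>)"
        unfolding KL eps powr_diff[symmetric] by simp
      finally have eKL: "?T / (?\<epsilon> * ?K * ?L) = ?T powr (2 * \<theta>)" .
      have "(\<integral>\<omega>. regret P (\<lambda>a. S a \<omega>) i \<partial>\<Omega>) \<le> C * ?T powr (1 - \<theta> / 4)" for i
        using regret[of i] mult_right_mono[OF C(5), of "?T powr (1 - \<theta> / 4)"] unfolding rate_eq by simp
      then show ?thesis
        using R2 R3 unfolding eKL KL by blast
    qed
    show "let T = real (horizon P); K = real (par_K P); L = real (par_L P);
          \<eta> = par_eta P; \<delta> = par_delta P; \<epsilon> = tolerance P;
          final = (\<lambda>\<omega>. run_alg P (\<lambda>a. S a \<omega>) (blocks P))
      in
        (\<forall>i. (\<integral>\<omega>. regret P (\<lambda>a. S a \<omega>) i \<partial>\<Omega>) \<le> C * (L / \<eta> + \<eta> * T * K / \<delta>\<^sup>2 + \<delta> * T + T / L)) \<and>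
        (\<forall>i. \<forall>\<omega>\<in>space \<Omega>. real (loo_calls (final \<omega>) i) \<le> C * (T / (\<epsilon> * K * L))) \<and>
        (\<forall>\<omega>\<in>space \<Omega>. real (\<Sum>i\<in>UNIV. comms (final \<omega>) i) \<le> C * (T / (K * L))) \<and>
        (\<forall>\<theta>. 0 \<le> \<theta> \<and> \<theta> \<le> 4 / 5 \<and> K = T powr (1 - 5 * \<theta> / 4) \<and> \<delta> = T powr (- \<theta> / 4) \<and>
              L = T powr (\<theta> / 4) \<and> \<eta> = T powr (\<theta> / 2 - 1) \<longrightarrow>
           (\<forall>i. (\<integral>\<omega>. regret P (\<lambda>a. S a \<omega>) i \<partial>\<Omega>) \<le> C * T powr (1 - \<theta> / 4)) \<and>
           (\<forall>i. \<forall>\<omega>\<in>space \<Omega>. real (loo_calls (final \<omega>) i) \<le> C * T powr (2 * \<theta>)) \<and>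
           (\<forall>\<omega>\<in>space \<Omega>. real (\<Sum>i\<in>UNIV. comms (final \<omega>) i) \<le> C * T powr \<theta>))"
      unfolding Let_def using R1 R2 R3 R4 by blast
  qed
qed

end
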